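(* Let $G$ be a connected digraph and $x$ a vertex of $G$. The algebra $\pi^1_x(G)$ carries a Hopf algebra structure with antipode, whose multiplication is given by the shuffle product, and whose unit, comultiplication, counit and antipode are obtained by restricting the unit $\eta$, the comultiplication $\Delta$, the counit $\epsilon$ and the antipode $j$ of $\mathcal{Q}_x(G)$, respectively.
   Context: $\mathbb{K}$ is a fixed field of characteristic $0$. A digraph $G=(G_0,G_1)$ has a finite vertex set $G_0$ and arrow set $G_1\subset (G_0\times G_0)\setminus\{(v,v)\}$ (no self-loops; both $u\to v$ and $v\to u$ may be arrows). A digraph map $f\colon G\to H$ is a map $G_0\to H_0$ such that for each arrow $u\to v$ of $G$ either $f(u)=f(v)$ or $f(u)\to f(v)$ is an arrow of $H$. A line digraph $I_n$ ($n\ge 0$) has vertices $0,\ldots,n$ and, for each $0\le i<n$, exactly one of the arrows $i\to i+1$, $i+1\to i$, and no other arrows. A path map on $G$ is a digraph map $\alpha\colon I_n\to G$, going from $\alpha(0)$ to $\alpha(n)$; it is a loop at $x$ if $\alpha(0)=\alpha(n)=x$. $G$ is connected if any two vertices are joined by a path map. A $1$-form on $G$ is a function $\omega\colon G_1\to\mathbb{K}$. For $\alpha\colon I_n\to G$ and $1\le t\le n$, set $\langle\omega,\alpha_t\rangle=0$ if $\alpha(t-1)=\alpha(t)$; otherwise $\langle\omega,\alpha_t\rangle=\omega(\alpha(t-1)\to\alpha(t))$ if $(t-1)\to t$ is in $I_n$, and $\langle\omega,\alpha_t\rangle=-\omega(\alpha(t)\to\alpha(t-1))$ if $t\to (t-1)$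 is in $I_n$. With $\tau(t_1,\ldots,t_r)=\prod_{k\ge1}\varphi_k!$, $\varphi_k$ the multiplicity of $k$ in $(t_1,\ldots,t_r)$, define $$\oint_\alpha\omega_1\cdots\omega_r=\sum_{1\le t_1\le\cdots\le t_r\le n}\frac{\prod_{i=1}^r\langle\omega_i,\alpha_{t_i}\rangle}{\tau(t_1,\ldots,t_r)},$$ with the integral of the empty word equal to $1$. $\oint_x\omega_1\cdots\omega_r$ denotes the function $\alpha\mapsto\oint_\alpha\omega_1\cdots\omega_r$ on loops at $x$. $\mathcal{Q}_x(G)$ is the $\mathbb{K}$-algebra of functions on loops at $x$ generated by all $\oint_x\omega_1\cdots\omega_r$, $r\ge1$, with unit the constant function $1$ and multiplication the shuffle product $\oint_x\omega_1\cdots\omega_r\oint_x\omega_{r+1}\cdots\omega_{r+s}=\sum_\sigma\oint_x\omega_{\sigma(1)}\cdots\omega_{\sigma(r+s)}$, $\sigma$ running over permutations with $\sigma^{-1}(1)<\cdots<\sigma^{-1}(r)$ and $\sigma^{-1}(r+1)<\cdots<\sigma^{-1}(r+s)$ (the pointwise product). It is a Hopf algebra with $\eta(c)=c\cdot1$, $\epsilon(u)=u(r_x)$ ($r_x$ the constant loop at $x$), $\Delta(\oint_x\omega_1\cdots\omega_r)=\sum_{i=0}^r\oint_x\omega_1\cdots\omega_i\otimes\oint_x\omega_{i+1}\cdots\omega_r$, and $j(\oint_x\omega_1\cdots\omega_r)=(-1)^r\oint_x\omega_r\cdots\omega_1$. $C_\partial$-homotopy. A shrinking map $h\colon I_n\to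 I_m$ ($m\le n$) is a digraph map with $h(0)=0$, $h(n)=m$, $h(i)\le h(j)$ for $i\le j$. The cylinder $C_h$ has vertex set $(I_n)_0\sqcup(I_m)_0$ and arrows those of $I_n$ and $I_m$ together with $i\to h(i)$ for all $i\in I_n$; $C_h^-$ is the same with $h(i)\to i$ instead. Path maps $\alpha\colon I_n\to G$, $\beta\colon I_m\to G$ with the same initial vertex and the same final vertex are one-step $C_\partial$-homotopic if for some shrinking map $h$ there is a digraph map from $C_h$ or $C_h^-$ to $G$ restricting to $\alpha$ on $I_n$ and $\beta$ on $I_m$. $C_\partial$-homotopy $\simeq_C$ is the equivalence relation generated by this. $\pi^1_x(G)$ is the subalgebra of $\mathcal{Q}_x(G)$ consisting of all elements $u$ independent of $C_\partial$-homotopy, i.e. with $u(\alpha)=u(\alpha')$ for all loops $\alpha\simeq_C\alpha'$ at $x$. *)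

theory Defs
  imports
    "HOL-Library.Poly_Mapping"
    "HOL-Combinatorics.Permutations"
    "HOL-Algebra.Algebraic_Closure_Type"
    "Graph_Theory.Pair_Digraph"
begin

section \<open>Tensor products and Hopf algebras over a field\<close>

text \<open>
  Vector spaces and algebras over the field \<open>'k\<close> are carrier-based
  (records of type \<^typ>\<open>('k, 'a) module\<close>), because the algebras of interest below are
  subspaces of a function space; the field itself enters the HOL-Algebra locales as
  \<^term>\<open>ring_of_type_algebra\<close>.
\<close>

definition linear_maps :: "('k, 'a) module \<Rightarrow> ('k, 'b) module \<Rightarrow> ('a \<Rightarrow> 'b) set" where
  "linear_maps M N = {f \<in> carrier M \<rightarrow> carrier N.
     (\<forall>a\<in>carrier M. \<forall>b\<in>carrier M. f (a \<oplus>\<^bsub>M\<^esub> b) = f a \<oplus>\<^bsub>N\<^esub> f b) \<and>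
     (\<forall>c. \<forall>a\<in>carrier M. f (c \<odot>\<^bsub>M\<^esub> a) = c \<odot>\<^bsub>N\<^esub> f a)}"

abbreviation formal_scale :: "'k::comm_ring_1 \<Rightarrow> ('a \<Rightarrow>\<^sub>0 'k) \<Rightarrow> ('a \<Rightarrow>\<^sub>0 'k)" where
  "formal_scale c \<equiv> Poly_Mapping.map ((*) c)"

text \<open>
  \<open>M \<otimes> N\<close> is the free vector space on \<open>carrier M \<times> carrier N\<close> modulo the span of the
  bilinearity relators; its elements are cosets, i.e. sets of formal sums.
\<close>

definition tensor_relators ::
  "('k::comm_ring_1, 'a) module \<Rightarrow> ('k, 'b) module \<Rightarrow> (('a \<times> 'b) \<Rightarrow>\<^sub>0 'k) set" where
  "tensor_relators M N =
     {Poly_Mapping.single (a \<oplus>\<^bsub>M\<^esub> a', b) 1 - Poly_Mapping.single (a, b) 1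
        - Poly_Mapping.single (a', b) 1 |
        a a' b. a \<in> carrier M \<and> a' \<in> carrier M \<and> b \<in> carrier N} \<union>
     {Poly_Mapping.single (a, b \<oplus>\<^bsub>N\<^esub> b') 1 - Poly_Mapping.single (a, b) 1
        - Poly_Mapping.single (a, b') 1 |
        a b b'. a \<in> carrier M \<and> b \<in> carrier N \<and> b' \<in> carrier N} \<union>
     {Poly_Mapping.single (c \<odot>\<^bsub>M\<^esub> a, b) 1 - Poly_Mapping.single (a, b) c |
        c a b. a \<in> carrier M \<and> b \<in> carrier N} \<union>
     {Poly_Mapping.single (a, c \<odot>\<^bsub>N\<^esub> b) 1 - Poly_Mapping.single (a, b) c |
        c a b. a \<in> carrier M \<and> b \<in> carrier N}"

definition tensor_class ::
  "('k::comm_ring_1, 'a) module \<Rightarrow> ('k, 'b) module \<Rightarrow> (('a \<times> 'b) \<Rightarrow>\<^sub>0 'k)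
     \<Rightarrow> (('a \<times> 'b) \<Rightarrow>\<^sub>0 'k) set" where
  "tensor_class M N f = {g. g - f \<in> Modules.module.span formal_scale (tensor_relators M N)}"

definition pure_tensor ::
  "('k::comm_ring_1, 'a) module \<Rightarrow> ('k, 'b) module \<Rightarrow> 'a \<Rightarrow> 'b
     \<Rightarrow> (('a \<times> 'b) \<Rightarrow>\<^sub>0 'k) set" where
  "pure_tensor M N a b = tensor_class M N (Poly_Mapping.single (a, b) 1)"

text \<open>
  The operations are computed on representatives; each union is over classes that all
  coincide. The multiplication \<open>(a \<otimes> b)(a' \<otimes> b') = aa' \<otimes> bb'\<close> and the unit are meaningful
  when \<open>M\<close> and \<open>N\<close> are algebras and irrelevant otherwise.
\<close>

definition tensor ::
  "('k::comm_ring_1, 'a) module \<Rightarrow> ('k, 'b) module \<Rightarrow> ('k, (('a \<times> 'b) \<Rightarrow>\<^sub>0 'k) set) module" where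
  "tensor M N =
     \<lparr> carrier = tensor_class M N ` {f. Poly_Mapping.keys f \<subseteq> carrier M \<times> carrier N},
       monoid.mult = (\<lambda>s t. \<Union>f\<in>s. \<Union>g\<in>t. tensor_class M N
          (\<Sum>p\<in>Poly_Mapping.keys f. \<Sum>q\<in>Poly_Mapping.keys g.
             Poly_Mapping.single (fst p \<otimes>\<^bsub>M\<^esub> fst q, snd p \<otimes>\<^bsub>N\<^esub> snd q)
               (Poly_Mapping.lookup f p * Poly_Mapping.lookup g q))),
       one = pure_tensor M N \<one>\<^bsub>M\<^esub> \<one>\<^bsub>N\<^esub>,
       ring.zero = tensor_class M N 0,
       add = (\<lambda>s t. \<Union>f\<in>s. \<Union>g\<in>t. tensor_class M N (f + g)),
       module.smult = (\<lambda>c t. \<Union>f\<in>t. tensor_class M N (formal_scale c f)) \<rparr>"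

text \<open>
  The linear map out of a tensor product induced by a bilinear map \<open>\<beta>\<close> into \<open>P\<close>, i.e.
  \<open>a \<otimes> b \<mapsto> \<beta> a b\<close>: all representatives of a class have the same image.
\<close>

definition tensor_lift ::
  "('k::comm_ring_1, 'c) module \<Rightarrow> ('a \<Rightarrow> 'b \<Rightarrow> 'c) \<Rightarrow> (('a \<times> 'b) \<Rightarrow>\<^sub>0 'k) set \<Rightarrow> 'c" where
  "tensor_lift P \<beta> t = the_elem
     ((\<lambda>f. \<Oplus>\<^bsub>P\<^esub>p\<in>Poly_Mapping.keys f.
             Poly_Mapping.lookup f p \<odot>\<^bsub>P\<^esub> \<beta> (fst p) (snd p)) ` t)"

text \<open>\<open>f \<otimes> g\<close>, where \<open>M\<close> and \<open>N\<close> are the codomains of \<open>f\<close> and \<open>g\<close>.\<close>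

definition tensor_map ::
  "('k::comm_ring_1, 'c) module \<Rightarrow> ('k, 'd) module \<Rightarrow> ('a \<Rightarrow> 'c) \<Rightarrow> ('b \<Rightarrow> 'd)
     \<Rightarrow> (('a \<times> 'b) \<Rightarrow>\<^sub>0 'k) set \<Rightarrow> (('c \<times> 'd) \<Rightarrow>\<^sub>0 'k) set" where
  "tensor_map M N f g = tensor_lift (tensor M N) (\<lambda>a b. pure_tensor M N (f a) (g b))"

text \<open>The associativity isomorphism \<open>(M \<otimes> N) \<otimes> P \<rightarrow> M \<otimes> (N \<otimes> P)\<close>.\<close>

definition tensor_assoc ::
  "('k::comm_ring_1, 'a) module \<Rightarrow> ('k, 'b) module \<Rightarrow> ('k, 'c) module
     \<Rightarrow> (((('a \<times> 'b) \<Rightarrow>\<^sub>0 'k) set \<times> 'c) \<Rightarrow>\<^sub>0 'k) set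
     \<Rightarrow> (('a \<times> (('b \<times> 'c) \<Rightarrow>\<^sub>0 'k) set) \<Rightarrow>\<^sub>0 'k) set" where
  "tensor_assoc M N P =
     tensor_lift (tensor M (tensor N P))
       (\<lambda>t c. tensor_lift (tensor M (tensor N P))
          (\<lambda>a b. pure_tensor M (tensor N P) a (pure_tensor N P b c)) t)"

text \<open>
  The multiplication of the Hopf algebra is that of the record \<open>H\<close>. In \<open>counit_left\<close> and
  \<open>counit_right\<close> the identifications \<open>K \<otimes> H = H = H \<otimes> K\<close> are built into the bilinear maps.
\<close>

locale hopf_algebra =
  module "ring_of_type_algebra :: 'k::field ring" H + ring H
  for H :: "('k::field, 'h) module" (structure) +
  fixes \<eta> :: "'k \<Rightarrow> 'h"
    and \<Delta> :: "'h \<Rightarrow> (('h \<times> 'h) \<Rightarrow>\<^sub>0 'k) set"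
    and \<epsilon> :: "'h \<Rightarrow> 'k"
    and S :: "'h \<Rightarrow> 'h"
  assumes smult_mult_left:
      "\<And>c a b. a \<in> carrier H \<Longrightarrow> b \<in> carrier H \<Longrightarrow> (c \<odot> a) \<otimes> b = c \<odot> (a \<otimes> b)"
    and smult_mult_right:
      "\<And>c a b. a \<in> carrier H \<Longrightarrow> b \<in> carrier H \<Longrightarrow> a \<otimes> (c \<odot> b) = c \<odot> (a \<otimes> b)"
    and unit: "\<And>c. \<eta> c = c \<odot> \<one>"
    and comult_linear: "\<Delta> \<in> linear_maps H (tensor H H)"
    and comult_hom: "\<Delta> \<in> ring_hom H (tensor H H)"
    and counit_linear:
      "\<And>c a. a \<in> carrier H \<Longrightarrow> \<epsilon> (c \<odot> a) = c * \<epsilon> a"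
    and counit_hom: "\<epsilon> \<in> ring_hom H ring_of_type_algebra"
    and coassoc:
      "\<And>a. a \<in> carrier H \<Longrightarrow>
         tensor_assoc H H H (tensor_map (tensor H H) H \<Delta> (\<lambda>b. b) (\<Delta> a))
           = tensor_map H (tensor H H) (\<lambda>b. b) \<Delta> (\<Delta> a)"
    and counit_left: "\<And>a. a \<in> carrier H \<Longrightarrow> tensor_lift H (\<lambda>b c. \<epsilon> b \<odot> c) (\<Delta> a) = a"
    and counit_right: "\<And>a. a \<in> carrier H \<Longrightarrow> tensor_lift H (\<lambda>b c. \<epsilon> c \<odot> b) (\<Delta> a) = a"
    and antipode_linear: "S \<in> linear_maps H H"
    and antipode_left:
      "\<And>a. a \<in> carrier H \<Longrightarrow> tensor_lift H (\<lambda>b c. S b \<otimes> c) (\<Delta> a) = \<eta> (\<epsilon> a)"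
    and antipode_right:
      "\<And>a. a \<in> carrier H \<Longrightarrow> tensor_lift H (\<lambda>b c. b \<otimes> S c) (\<Delta> a) = \<eta> (\<epsilon> a)"

inductive_set generated_subalgebra ::
  "('k, 'a) module \<Rightarrow> 'a set \<Rightarrow> 'a set" for A (structure) and B where
  one: "\<one> \<in> generated_subalgebra A B"
| generator: "a \<in> B \<Longrightarrow> a \<in> generated_subalgebra A B"
| add: "a \<in> generated_subalgebra A B \<Longrightarrow> b \<in> generated_subalgebra A B \<Longrightarrow>
    a \<oplus> b \<in> generated_subalgebra A B"
| smult: "a \<in> generated_subalgebra A B \<Longrightarrow> c \<odot> a \<in> generated_subalgebra A B"
| mult: "a \<in> generated_subalgebra A B \<Longrightarrow> b \<in> generated_subalgebra A B \<Longrightarrow>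
    a \<otimes> b \<in> generated_subalgebra A B"

text \<open>Functions on a set \<open>L\<close> are extensional, i.e. \<^term>\<open>undefined\<close> outside \<open>L\<close>.\<close>

definition function_algebra :: "'p set \<Rightarrow> ('k::comm_ring_1, 'p \<Rightarrow> 'k) module" where
  "function_algebra L =
     \<lparr> carrier = extensional L,
       monoid.mult = (\<lambda>u v. \<lambda>p\<in>L. u p * v p),
       one = (\<lambda>p\<in>L. 1),
       ring.zero = (\<lambda>p\<in>L. 0),
       add = (\<lambda>u v. \<lambda>p\<in>L. u p + v p),
       module.smult = (\<lambda>c u. \<lambda>p\<in>L. c * u p) \<rparr>"


section \<open>Digraphs, path maps and \<open>C\<^sub>\<partial>\<close>-homotopy\<close>

text \<open>Finite digraphs without self-loops are those of the locale \<^locale>\<open>pair_digraph\<close>.\<close>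

definition digraph_map ::
  "'a pair_pre_digraph \<Rightarrow> 'b pair_pre_digraph \<Rightarrow> ('a \<Rightarrow> 'b) \<Rightarrow> bool" where
  "digraph_map G H f \<longleftrightarrow> f \<in> pverts G \<rightarrow> pverts H \<and>
     (\<forall>(u, v)\<in>parcs G. f u = f v \<or> (f u, f v) \<in> parcs H)"

definition line_digraph :: "nat \<Rightarrow> nat pair_pre_digraph \<Rightarrow> bool" where
  "line_digraph n I \<longleftrightarrow> pverts I = {..n} \<and>
     parcs I \<subseteq> (\<Union>i<n. {(i, Suc i), (Suc i, i)}) \<and>
     (\<forall>i<n. ((i, Suc i) \<in> parcs I) \<noteq> ((Suc i, i) \<in> parcs I))"

record 'v path_map =
  path_length :: nat
  path_line :: "nat pair_pre_digraph"
  path_fun :: "nat \<Rightarrow> 'v"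

text \<open>
  The line digraph is part of the data of a path map. Extensionality makes
  \<open>path_fun\<close> a function on the vertices \<open>{..n}\<close> only.
\<close>

definition path_maps :: "'v pair_pre_digraph \<Rightarrow> 'v path_map set" where
  "path_maps G = {\<alpha>. line_digraph (path_length \<alpha>) (path_line \<alpha>) \<and>
     digraph_map (path_line \<alpha>) G (path_fun \<alpha>) \<and>
     path_fun \<alpha> \<in> extensional {..path_length \<alpha>}}"

definition path_start :: "'v path_map \<Rightarrow> 'v" where
  "path_start \<alpha> = path_fun \<alpha> 0"

definition path_end :: "'v path_map \<Rightarrow> 'v" where
  "path_end \<alpha> = path_fun \<alpha> (path_length \<alpha>)"

definition loops :: "'v pair_pre_digraph \<Rightarrow> 'v \<Rightarrow> 'v path_map set" where
  "loops G x = {\<alpha> \<in> path_maps G. path_start \<alpha> = x \<and> path_end \<alpha> = x}"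

definition constant_loop :: "'v \<Rightarrow> 'v path_map" where
  "constant_loop x =
     \<lparr> path_length = 0, path_line = \<lparr> pverts = {0}, parcs = {} \<rparr>, path_fun = (\<lambda>i\<in>{..0}. x) \<rparr>"

definition connected_digraph :: "'v pair_pre_digraph \<Rightarrow> bool" where
  "connected_digraph G \<longleftrightarrow>
     (\<forall>u\<in>pverts G. \<forall>v\<in>pverts G. \<exists>\<alpha>\<in>path_maps G. path_start \<alpha> = u \<and> path_end \<alpha> = v)"

definition shrinking_map ::
  "nat \<Rightarrow> nat pair_pre_digraph \<Rightarrow> nat \<Rightarrow> nat pair_pre_digraph \<Rightarrow> (nat \<Rightarrow> nat) \<Rightarrow> bool" where
  "shrinking_map n I m J h \<longleftrightarrow> m \<le> n \<and> digraph_map I J h \<and> h 0 = 0 \<and> h n = m \<and>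
     (\<forall>i j. i \<le> j \<and> j \<le> n \<longrightarrow> h i \<le> h j)"

definition cylinder ::
  "'a pair_pre_digraph \<Rightarrow> 'b pair_pre_digraph \<Rightarrow> ('a \<Rightarrow> 'b) \<Rightarrow> ('a + 'b) pair_pre_digraph" where
  "cylinder I J h =
     \<lparr> pverts = pverts I <+> pverts J,
       parcs = {(Inl a, Inl b) | a b. (a, b) \<in> parcs I} \<union>
               {(Inr a, Inr b) | a b. (a, b) \<in> parcs J} \<union>
               {(Inl a, Inr (h a)) | a. a \<in> pverts I} \<rparr>"

definition inverse_cylinder ::
  "'a pair_pre_digraph \<Rightarrow> 'b pair_pre_digraph \<Rightarrow> ('a \<Rightarrow> 'b) \<Rightarrow> ('a + 'b) pair_pre_digraph" where
  "inverse_cylinder I J h =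
     \<lparr> pverts = pverts I <+> pverts J,
       parcs = {(Inl a, Inl b) | a b. (a, b) \<in> parcs I} \<union>
               {(Inr a, Inr b) | a b. (a, b) \<in> parcs J} \<union>
               {(Inr (h a), Inl a) | a. a \<in> pverts I} \<rparr>"

definition one_step_homotopic ::
  "'v pair_pre_digraph \<Rightarrow> 'v path_map \<Rightarrow> 'v path_map \<Rightarrow> bool" where
  "one_step_homotopic G \<alpha> \<beta> \<longleftrightarrow>
     \<alpha> \<in> path_maps G \<and> \<beta> \<in> path_maps G \<and>
     path_start \<alpha> = path_start \<beta> \<and> path_end \<alpha> = path_end \<beta> \<and>
     (\<exists>h F. shrinking_map (path_length \<alpha>) (path_line \<alpha>) (path_length \<beta>) (path_line \<beta>) h \<and>
        (digraph_map (cylinder (path_line \<alpha>) (path_line \<beta>) h) G F \<or>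
         digraph_map (inverse_cylinder (path_line \<alpha>) (path_line \<beta>) h) G F) \<and>
        (\<forall>i\<le>path_length \<alpha>. F (Inl i) = path_fun \<alpha> i) \<and>
        (\<forall>j\<le>path_length \<beta>. F (Inr j) = path_fun \<beta> j))"

definition C_homotopic ::
  "'v pair_pre_digraph \<Rightarrow> 'v path_map \<Rightarrow> 'v path_map \<Rightarrow> bool" where
  "C_homotopic G = equivclp (one_step_homotopic G)"


section \<open>Iterated integrals\<close>

text \<open>
  A 1-form on \<open>G\<close> is rendered as a total function on pairs of vertices; for a path map on
  \<open>G\<close>, only its values on arrows of \<open>G\<close> are ever used.
\<close>

type_synonym ('v, 'k) one_form = "'v \<times> 'v \<Rightarrow> 'k"

definition form_pairing ::
  "('v, 'k::comm_ring_1) one_form \<Rightarrow> 'v path_map \<Rightarrow> nat \<Rightarrow> 'k" where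
  "form_pairing \<omega> \<alpha> t =
     (if path_fun \<alpha> (t - 1) = path_fun \<alpha> t then 0
      else if (t - 1, t) \<in> parcs (path_line \<alpha>) then \<omega> (path_fun \<alpha> (t - 1), path_fun \<alpha> t)
      else - \<omega> (path_fun \<alpha> t, path_fun \<alpha> (t - 1)))"

definition iterated_integral ::
  "'v path_map \<Rightarrow> ('v, 'k::field_char_0) one_form list \<Rightarrow> 'k" where
  "iterated_integral \<alpha> ws =
     (\<Sum>ts | length ts = length ws \<and> sorted ts \<and> set ts \<subseteq> {1..path_length \<alpha>}.
        (\<Prod>i<length ws. form_pairing (ws ! i) \<alpha> (ts ! i)) /
        (\<Prod>k\<in>set ts. fact (count_list ts k)))"

definition loop_integral ::
  "'v pair_pre_digraph \<Rightarrow> 'v \<Rightarrow> ('v, 'k::field_char_0) one_form list \<Rightarrow> 'v path_map \<Rightarrow> 'k" where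
  "loop_integral G x ws = (\<lambda>\<alpha>\<in>loops G x. iterated_integral \<alpha> ws)"

definition integral_algebra ::
  "'v pair_pre_digraph \<Rightarrow> 'v \<Rightarrow> ('k::field_char_0, 'v path_map \<Rightarrow> 'k) module" where
  "integral_algebra G x =
     (function_algebra (loops G x))
       \<lparr> carrier := generated_subalgebra (function_algebra (loops G x))
                      {loop_integral G x ws | ws. ws \<noteq> []} \<rparr>"

definition integral_unit ::
  "'v pair_pre_digraph \<Rightarrow> 'v \<Rightarrow> 'k::field_char_0 \<Rightarrow> 'v path_map \<Rightarrow> 'k" where
  "integral_unit G x c = (\<lambda>\<alpha>\<in>loops G x. c)"

definition integral_counit :: "'v \<Rightarrow> ('v path_map \<Rightarrow> 'k) \<Rightarrow> 'k" where
  "integral_counit x u = u (constant_loop x)"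

definition integral_comult ::
  "'v pair_pre_digraph \<Rightarrow> 'v \<Rightarrow> ('v path_map \<Rightarrow> 'k::field_char_0)
     \<Rightarrow> ((('v path_map \<Rightarrow> 'k) \<times> ('v path_map \<Rightarrow> 'k)) \<Rightarrow>\<^sub>0 'k) set" where
  "integral_comult G x = (let Q = integral_algebra G x in
     THE D. D \<in> extensional (carrier Q) \<and> D \<in> linear_maps Q (tensor Q Q) \<and>
       (\<forall>ws. D (loop_integral G x ws) =
          (\<Oplus>\<^bsub>tensor Q Q\<^esub>i\<in>{..length ws}.
             pure_tensor Q Q (loop_integral G x (take i ws)) (loop_integral G x (drop i ws)))))"

definition integral_antipode ::
  "'v pair_pre_digraph \<Rightarrow> 'v \<Rightarrow> ('v path_map \<Rightarrow> 'k::field_char_0) \<Rightarrow> 'v path_map \<Rightarrow> 'k" where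
  "integral_antipode G x = (let Q = integral_algebra G x in
     THE j. j \<in> extensional (carrier Q) \<and> j \<in> linear_maps Q Q \<and>
       (\<forall>ws. j (loop_integral G x ws) = (- 1) ^ length ws \<odot>\<^bsub>Q\<^esub> loop_integral G x (rev ws)))"

text \<open>
  Permutations \<open>\<sigma>\<close> of \<open>{0,\<dots>,r+s-1}\<close> whose inverse is increasing on the first \<open>r\<close> and on the
  last \<open>s\<close> indices. They are summed over as permutations, so repeated 1-forms count with
  multiplicity (unlike \<^term>\<open>shuffles\<close>, which is a set of lists).
\<close>

definition shuffle_permutations :: "nat \<Rightarrow> nat \<Rightarrow> (nat \<Rightarrow> nat) set" where
  "shuffle_permutations r s = {\<sigma>. \<sigma> permutes {..<r + s} \<and>
     strict_mono_on {..<r} (inv_into UNIV \<sigma>) \<and> strict_mono_on {r..<r + s} (inv_into UNIV \<sigma>)}"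

definition permute_word :: "(nat \<Rightarrow> nat) \<Rightarrow> 'a list \<Rightarrow> 'a list" where
  "permute_word \<sigma> ws = map (\<lambda>i. ws ! \<sigma> i) [0..<length ws]"

definition pi1_algebra ::
  "'v pair_pre_digraph \<Rightarrow> 'v \<Rightarrow> ('k::field_char_0, 'v path_map \<Rightarrow> 'k) module" where
  "pi1_algebra G x = (integral_algebra G x)
     \<lparr> carrier := {u \<in> carrier (integral_algebra G x).
         \<forall>\<alpha>\<in>loops G x. \<forall>\<alpha>'\<in>loops G x. C_homotopic G \<alpha> \<alpha>' \<longrightarrow> u \<alpha> = u \<alpha>'} \<rparr>"

end

theory Submission
  imports Defs
begin

text \<open>
  The elements of \<open>integral_algebra G x\<close> are functions on the loops at \<open>x\<close>, and its structure
  maps are pullbacks: the comultiplication along concatenation, the antipode along reversal, the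
  counit along the constant loop. Loops do not form a group under concatenation, but no
  function in the algebra notices: \<open>iterated_integral \<alpha>\<close> depends only on the list of edges of
  \<open>\<alpha>\<close>, namely as follows. Regard a function on words of 1-forms as a noncommutative power series.
  An edge on which the forms take the values \<open>a \<omega>\<close> contributes the exponential series, whose
  coefficient at \<open>\<omega>_1 ... \<omega>_r\<close> is \<open>a \<omega>_1 * ... * a \<omega>_r / r!\<close>; the integrals along \<open>\<alpha>\<close> are the
  coefficients of the product of these exponentials (\<open>iterated_integral_eq_transport\<close>).
  Concatenation of paths multiplies the series, which is the deconcatenation formula for \<open>\<Delta>\<close>;
  reversal replaces each exponential by its inverse and reverses the order, which is the formula for
  the antipode; and exponentials, hence their products, are characters of the shuffle product,
  which is the shuffle formula (\<open>iterated_integral_shuffle\<close>).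

  Over a field, tensors of functions can be evaluated at pairs of points, and a tensor is determined
  by these values (\<open>relator_span_eq\<close>). Therefore \<open>\<Delta> u\<close> is the only tensor whose value at \<open>(\<alpha>, \<beta>)\<close> is
  \<open>u (\<alpha> \<beta>)\<close>, and all Hopf algebra axioms turn into pointwise identities, such as
  \<open>u ((\<alpha> \<beta>) \<gamma>) = u (\<alpha> (\<beta> \<gamma>))\<close> for coassociativity (\<open>hopf_algebra_comult\<close>).

  For the homotopy invariant functions, what remains is that \<open>\<Delta> u\<close> lies in the tensor square of
  that subalgebra. A homotopy of one factor of a concatenation extends to the
  whole loop, so every slice \<open>u (\<bullet> \<beta>)\<close> and \<open>u (\<alpha> \<bullet>)\<close> is again invariant
  (\<open>homotopy_invariants_slice\<close>). The function \<open>(\<alpha>, \<beta>) \<mapsto> u (\<alpha> \<beta>)\<close> has finite rank, and a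
  function of finite rank is a finite sum of products of its own slices (\<open>cross_approximation\<close>).
\<close>

section \<open>Tensor products of vector spaces given by coordinates\<close>

lemma lookup_formal_scale [simp]:
  "Poly_Mapping.lookup (formal_scale c f) p = c * Poly_Mapping.lookup f p"
  by (simp add: Poly_Mapping.map.rep_eq when_def)

lemma keys_formal_scale_subset: "Poly_Mapping.keys (formal_scale c f) \<subseteq> Poly_Mapping.keys f"
  by (auto simp: in_keys_iff)

global_interpretation formal: Modules.module "formal_scale :: 'k::comm_ring_1 \<Rightarrow> ('a \<Rightarrow>\<^sub>0 'k) \<Rightarrow> _"
  by unfold_locales (auto intro!: poly_mapping_eqI simp: lookup_add algebra_simps)

definition formal_extend :: "('a \<Rightarrow> 'k::comm_ring_1) \<Rightarrow> ('a \<Rightarrow>\<^sub>0 'k) \<Rightarrow> 'k" where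
  "formal_extend \<phi> f = (\<Sum>p\<in>Poly_Mapping.keys f. Poly_Mapping.lookup f p * \<phi> p)"

lemma formal_extend_superset:
  assumes "finite A" "Poly_Mapping.keys f \<subseteq> A"
  shows "formal_extend \<phi> f = (\<Sum>p\<in>A. Poly_Mapping.lookup f p * \<phi> p)"
  unfolding formal_extend_def using assms
  by (intro sum.mono_neutral_left) (auto simp: in_keys_iff)

lemma formal_extend_zero [simp]: "formal_extend \<phi> 0 = 0"
  by (simp add: formal_extend_def)

lemma formal_extend_single [simp]: "formal_extend \<phi> (Poly_Mapping.single p c) = c * \<phi> p"
  by (subst formal_extend_superset[of "{p}"]) auto

lemma formal_extend_add: "formal_extend \<phi> (f + g) = formal_extend \<phi> f + formal_extend \<phi> g"
proof -
  let ?A = "Poly_Mapping.keys f \<union> Poly_Mapping.keys g"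
  have "finite ?A" by simp
  then show ?thesis
    using Poly_Mapping.keys_add[of f g]
    by (simp add: formal_extend_superset[of ?A] lookup_add algebra_simps sum.distrib)
qed

lemma formal_extend_scale: "formal_extend \<phi> (formal_scale c f) = c * formal_extend \<phi> f"
  by (subst (1 2) formal_extend_superset[of "Poly_Mapping.keys f"])
     (simp_all add: keys_formal_scale_subset sum_distrib_left mult.assoc)

lemma formal_extend_minus: "formal_extend \<phi> (f - g) = formal_extend \<phi> f - formal_extend \<phi> g"
  using formal_extend_add[of \<phi> "f - g" g] by simp

lemma formal_extend_sum: "formal_extend \<phi> (\<Sum>x\<in>A. f x) = (\<Sum>x\<in>A. formal_extend \<phi> (f x))"
  by (induction A rule: infinite_finite_induct) (auto simp: formal_extend_add)

lemma formal_extend_sum_list: "formal_extend \<phi> (\<Sum>x\<leftarrow>xs. f x) = (\<Sum>x\<leftarrow>xs. formal_extend \<phi> (f x))"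
  by (induction xs) (auto simp: formal_extend_add)

lemma keys_diff_closed:
  assumes "Poly_Mapping.keys f \<subseteq> S" "Poly_Mapping.keys g \<subseteq> S"
  shows "Poly_Mapping.keys (f - g :: _ \<Rightarrow>\<^sub>0 'k::comm_ring_1) \<subseteq> S"
proof
  fix p assume "p \<in> Poly_Mapping.keys (f - g)"
  then have "p \<in> Poly_Mapping.keys f \<or> p \<in> Poly_Mapping.keys g"
    by (auto simp: in_keys_iff lookup_minus)
  with assms show "p \<in> S" by blast
qed

lemma formal_sum_singles: "f = (\<Sum>p\<in>Poly_Mapping.keys f. Poly_Mapping.single p (Poly_Mapping.lookup f p))"
  by (auto intro!: poly_mapping_eqI simp: lookup_sum lookup_single when_def in_keys_iff)

definition bilinear_form ::
  "('k::comm_ring_1, 'a) module \<Rightarrow> ('k, 'b) module \<Rightarrow> ('a \<Rightarrow> 'b \<Rightarrow> 'k) \<Rightarrow> bool" where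
  "bilinear_form M N \<phi> \<longleftrightarrow>
     (\<forall>a\<in>carrier M. \<forall>b\<in>carrier N.
        (\<forall>a'\<in>carrier M. \<phi> (a \<oplus>\<^bsub>M\<^esub> a') b = \<phi> a b + \<phi> a' b) \<and>
        (\<forall>b'\<in>carrier N. \<phi> a (b \<oplus>\<^bsub>N\<^esub> b') = \<phi> a b + \<phi> a b') \<and>
        (\<forall>c. \<phi> (c \<odot>\<^bsub>M\<^esub> a) b = c * \<phi> a b \<and> \<phi> a (c \<odot>\<^bsub>N\<^esub> b) = c * \<phi> a b))"

lemma bilinear_form_vanishes_on_relators:
  assumes "bilinear_form M N \<phi>" "f \<in> formal.span (tensor_relators M N)"
  shows "formal_extend (case_prod \<phi>) f = 0"
proof -
  let ?V = "{f. formal_extend (case_prod \<phi>) f = 0}"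
  have "tensor_relators M N \<subseteq> ?V"
    using assms(1) unfolding tensor_relators_def bilinear_form_def
    by (auto simp: formal_extend_minus)
  moreover have "formal.subspace ?V"
    by (rule formal.subspaceI) (auto simp: formal_extend_add formal_extend_scale)
  ultimately show ?thesis using formal.span_minimal assms(2) by blast
qed

text \<open>
  A vector space together with linear functionals \<open>e i\<close> that jointly separate its points. Tensor
  products inherit such functionals, so equations in iterated tensor products, whose
  elements are cosets of formal sums of cosets, reduce to equations between scalars.
\<close>

locale coordinate_space =
  fixes M :: "('k::field, 'a) module" (structure) and I :: "'i set" and e :: "'i \<Rightarrow> 'a \<Rightarrow> 'k"
  assumes zero_closed: "\<zero> \<in> carrier M"
    and add_closed: "\<lbrakk>a \<in> carrier M; b \<in> carrier M\<rbrakk> \<Longrightarrow> a \<oplus> b \<in> carrier M"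
    and smult_closed: "a \<in> carrier M \<Longrightarrow> c \<odot> a \<in> carrier M"
    and coord_zero: "i \<in> I \<Longrightarrow> e i \<zero> = 0"
    and coord_add: "\<lbrakk>i \<in> I; a \<in> carrier M; b \<in> carrier M\<rbrakk> \<Longrightarrow> e i (a \<oplus> b) = e i a + e i b"
    and coord_smult: "\<lbrakk>i \<in> I; a \<in> carrier M\<rbrakk> \<Longrightarrow> e i (c \<odot> a) = c * e i a"
    and coord_eqI: "\<lbrakk>a \<in> carrier M; b \<in> carrier M; \<And>i. i \<in> I \<Longrightarrow> e i a = e i b\<rbrakk> \<Longrightarrow> a = b"
begin

lemmas coord_closed = zero_closed add_closed smult_closed
lemmas coord_simps = coord_zero coord_add coord_smult

lemma is_abelian_group: "abelian_group M"
proof (rule abelian_groupI)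
  fix a assume "a \<in> carrier M"
  then show "\<exists>b\<in>carrier M. b \<oplus> a = \<zero>"
    by (intro bexI[of _ "(- 1) \<odot> a"] coord_eqI) (auto simp: coord_simps coord_closed)
qed (auto simp: coord_closed coord_simps intro!: coord_eqI)

lemma is_module: "module ring_of_type_algebra M"
  by (intro moduleI is_abelian_group cring_from_type_algebra)
     (auto simp: ring_of_type_algebra_def coord_closed coord_simps algebra_simps intro!: coord_eqI)

sublocale abelian_group M by (rule is_abelian_group)

lemma coord_finsum:
  assumes "\<And>x. x \<in> A \<Longrightarrow> f x \<in> carrier M" "i \<in> I"
  shows "e i (\<Oplus>x\<in>A. f x) = (\<Sum>x\<in>A. e i (f x))"
  using assms(1)
proof (induction A rule: infinite_finite_induct)
  case (insert x A)
  then have "e i (f x \<oplus> (\<Oplus>x\<in>A. f x)) = e i (f x) + e i (\<Oplus>x\<in>A. f x)"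
    using assms(2) by (intro coord_add finsum_closed) auto
  with insert show ?case by (simp add: Pi_def)
qed (auto simp: coord_zero assms)

end

text \<open>
  Every tensor is a sum \<open>a\<^sub>1 \<otimes> b\<^sub>1 + ... + a\<^sub>n \<otimes> b\<^sub>n\<close> with all coefficients one, because scalars
  can be moved into the first factor. Lists of pairs are the representatives used from here on;
  their length serves as induction measure when terms are eliminated.
\<close>

definition formal_sum_list :: "('a \<times> 'b) list \<Rightarrow> ('a \<times> 'b) \<Rightarrow>\<^sub>0 'k::comm_ring_1" where
  "formal_sum_list ps = (\<Sum>p\<leftarrow>ps. Poly_Mapping.single p 1)"

definition tensor_of ::
  "('k::comm_ring_1, 'a) module \<Rightarrow> ('k, 'b) module \<Rightarrow> ('a \<times> 'b) list \<Rightarrow> (('a \<times> 'b) \<Rightarrow>\<^sub>0 'k) set" where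
  "tensor_of M N ps = tensor_class M N (formal_sum_list ps)"

text \<open>
  The functional \<open>e i \<otimes> d j\<close>.
\<close>

definition tensor_coord ::
  "('i \<Rightarrow> 'a \<Rightarrow> 'k::comm_ring_1) \<Rightarrow> ('j \<Rightarrow> 'b \<Rightarrow> 'k) \<Rightarrow> 'i \<times> 'j \<Rightarrow> (('a \<times> 'b) \<Rightarrow>\<^sub>0 'k) set \<Rightarrow> 'k" where
  "tensor_coord e d = (\<lambda>(i, j) t. the_elem (formal_extend (\<lambda>(a, b). e i a * d j b) ` t))"

lemma tensor_class_self: "f \<in> tensor_class M N f"
  by (simp add: tensor_class_def formal.span_zero)

lemma tensor_class_eq_iff:
  "tensor_class M N f = tensor_class M N g \<longleftrightarrow> f - g \<in> formal.span (tensor_relators M N)"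
proof
  assume "f - g \<in> formal.span (tensor_relators M N)"
  then have "h - f \<in> formal.span (tensor_relators M N) \<longleftrightarrow> h - g \<in> formal.span (tensor_relators M N)" for h
    using formal.span_add[of "h - f" _ "f - g"] formal.span_diff[of "h - g" _ "f - g"] by auto
  then show "tensor_class M N f = tensor_class M N g" by (simp add: tensor_class_def)
qed (use tensor_class_self[of f M N] in \<open>simp add: tensor_class_def\<close>)

lemma the_elem_image_tensor_class:
  assumes "\<And>g. g - f \<in> formal.span (tensor_relators M N) \<Longrightarrow> \<psi> g = \<psi> f"
  shows "the_elem (\<psi> ` tensor_class M N f) = \<psi> f"
proof -
  have "\<psi> g = \<psi> f" if "g \<in> tensor_class M N f" for g
    using that by (intro assms) (simp add: tensor_class_def)
  then have "\<psi> ` tensor_class M N f = {\<psi> f}"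
    using tensor_class_self[of f M N] by blast
  then show ?thesis by simp
qed

lemma formal_extend_formal_sum_list [simp]:
  "formal_extend \<phi> (formal_sum_list ps) = (\<Sum>p\<leftarrow>ps. \<phi> p)"
  by (simp add: formal_sum_list_def formal_extend_sum_list)

lemma keys_formal_sum_list: "Poly_Mapping.keys (formal_sum_list ps :: _ \<Rightarrow>\<^sub>0 'k::comm_ring_1) \<subseteq> set ps"
proof (induction ps)
  case (Cons p ps)
  then show ?case
    using Poly_Mapping.keys_add[of "Poly_Mapping.single p (1::'k)" "formal_sum_list ps"]
    by (auto simp: formal_sum_list_def split: if_splits)
qed (simp add: formal_sum_list_def)

locale tensor_coordinates =
  M: coordinate_space M I e + N: coordinate_space N J d
  for M :: "('k::field, 'a) module" and I :: "'i set" and e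
    and N :: "('k, 'b) module" and J :: "'j set" and d
begin

abbreviation "relator_span \<equiv> formal.span (tensor_relators M N)"

abbreviation "formal_coord i j \<equiv> formal_extend (\<lambda>(a, b). e i a * d j b)"

lemma coord_product_bilinear:
  "\<lbrakk>i \<in> I; j \<in> J\<rbrakk> \<Longrightarrow> bilinear_form M N (\<lambda>a b. e i a * d j b)"
  by (auto simp: bilinear_form_def M.coord_simps N.coord_simps algebra_simps)

lemma relator_span_add_left:
  assumes "a \<in> carrier M" "a' \<in> carrier M" "b \<in> carrier N"
  shows "Poly_Mapping.single (a \<oplus>\<^bsub>M\<^esub> a', b) 1 - Poly_Mapping.single (a, b) 1
           - Poly_Mapping.single (a', b) 1 \<in> relator_span"
  by (rule formal.span_base) (use assms in \<open>unfold tensor_relators_def; blast\<close>)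

lemma relator_span_add_right:
  assumes "a \<in> carrier M" "b \<in> carrier N" "b' \<in> carrier N"
  shows "Poly_Mapping.single (a, b \<oplus>\<^bsub>N\<^esub> b') 1 - Poly_Mapping.single (a, b) 1
           - Poly_Mapping.single (a, b') 1 \<in> relator_span"
  by (rule formal.span_base) (use assms in \<open>unfold tensor_relators_def; blast\<close>)

lemma relator_span_smult_left:
  assumes "a \<in> carrier M" "b \<in> carrier N"
  shows "Poly_Mapping.single (c \<odot>\<^bsub>M\<^esub> a, b) 1 - Poly_Mapping.single (a, b) c \<in> relator_span"
  by (rule formal.span_base) (use assms in \<open>unfold tensor_relators_def; blast\<close>)

lemma relator_span_smult_right:
  assumes "a \<in> carrier M" "b \<in> carrier N"
  shows "Poly_Mapping.single (a, c \<odot>\<^bsub>N\<^esub> b) 1 - Poly_Mapping.single (a, b) c \<in> relator_span"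
  by (rule formal.span_base) (use assms in \<open>unfold tensor_relators_def; blast\<close>)

lemma relator_span_zero_left: 
  assumes "b \<in> carrier N" shows "Poly_Mapping.single (\<zero>\<^bsub>M\<^esub>, b) 1 \<in> relator_span"
proof -
  have "0 \<odot>\<^bsub>M\<^esub> \<zero>\<^bsub>M\<^esub> = \<zero>\<^bsub>M\<^esub>"
    by (rule M.coord_eqI) (auto simp: M.coord_simps M.coord_closed)
  with relator_span_smult_left[OF M.zero_closed assms, of 0] show ?thesis by simp
qed

lemma relator_span_zero_right: 
  assumes "a \<in> carrier M" shows "Poly_Mapping.single (a, \<zero>\<^bsub>N\<^esub>) 1 \<in> relator_span"
proof -
  have "0 \<odot>\<^bsub>N\<^esub> \<zero>\<^bsub>N\<^esub> = \<zero>\<^bsub>N\<^esub>"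
    by (rule N.coord_eqI) (auto simp: N.coord_simps N.coord_closed)
  with relator_span_smult_right[OF assms N.zero_closed, of 0] show ?thesis by simp
qed

text \<open>
  In the tensor product, \<open>a \<otimes> b + \<Sum> r (a \<otimes> b') = 0\<close> whenever \<open>b + \<Sum> r b' = 0\<close>; the second
  relation is only known through coordinates. The proof collects the terms of the list one by one in
  the right factor \<open>b\<close>.
\<close>

lemma linear_relation_in_relator_span:
  assumes "a \<in> carrier M" "b \<in> carrier N" "set rs \<subseteq> UNIV \<times> carrier N"
    and "\<And>j. j \<in> J \<Longrightarrow> d j b + (\<Sum>(r, b')\<leftarrow>rs. r * d j b') = 0"
  shows "Poly_Mapping.single (a, b) 1 + (\<Sum>(r, b')\<leftarrow>rs. Poly_Mapping.single (a, b') r) \<in> relator_span"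
  using assms
proof (induction rs arbitrary: b)
  case Nil
  then have "b = \<zero>\<^bsub>N\<^esub>"
    by (intro N.coord_eqI) (auto simp: N.coord_simps N.coord_closed)
  with Nil show ?case by (simp add: relator_span_zero_right)
next
  case (Cons rb rs)
  obtain r b' where [simp]: "rb = (r, b')" by fastforce
  from Cons.prems have b': "b' \<in> carrier N" by auto
  let ?c = "b \<oplus>\<^bsub>N\<^esub> r \<odot>\<^bsub>N\<^esub> b'"
  let ?R = "\<Sum>(r, b')\<leftarrow>rs. Poly_Mapping.single (a, b') r"
  have *: "Poly_Mapping.single (a, ?c) 1 + ?R \<in> relator_span"
    using Cons.prems b'
    by (intro Cons.IH) (auto simp: N.coord_simps N.coord_closed algebra_simps)
  have "Poly_Mapping.single (a, ?c) 1 - Poly_Mapping.single (a, b) 1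
          - Poly_Mapping.single (a, r \<odot>\<^bsub>N\<^esub> b') 1 \<in> relator_span"
    using Cons.prems b' by (intro relator_span_add_right) (auto simp: N.coord_closed)
  from formal.span_diff[OF formal.span_diff[OF * this]
      relator_span_smult_right[OF assms(1) b', of r]]
  show ?case by (simp add: algebra_simps)
qed

text \<open>
  This is where division in the field is needed. If some coordinate \<open>e i a\<close> of the
  first left factor is nonzero, the vanishing of the coordinates \<open>(i, j)\<close> for all \<open>j\<close> expresses the
  first right factor \<open>b\<close> through the other right factors. Substituting this expression removes the
  first term and replaces every other \<open>a'\<close> by \<open>a' - (e i a' / e i a) a\<close>, without changing any
  coordinate of the sum. If all coordinates of \<open>a\<close> vanish, then \<open>a = 0\<close> and the first term can be
  dropped.
\<close>

lemma formal_sum_list_in_relator_span: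
  assumes "set ps \<subseteq> carrier M \<times> carrier N"
    and "\<And>i j. i \<in> I \<Longrightarrow> j \<in> J \<Longrightarrow> (\<Sum>(a, b)\<leftarrow>ps. e i a * d j b) = 0"
  shows "formal_sum_list ps \<in> relator_span"
  using assms
proof (induction "length ps" arbitrary: ps)
  case 0
  then show ?case by (simp add: formal_sum_list_def formal.span_zero)
next
  case (Suc n)
  then obtain a b qs where ps: "ps = (a, b) # qs" and n: "n = length qs"
    by (cases ps) auto
  with Suc.prems have ab: "a \<in> carrier M" "b \<in> carrier N" and qs: "set qs \<subseteq> carrier M \<times> carrier N"
    by auto
  show ?case
  proof (cases "\<forall>i\<in>I. e i a = 0")
    case True
    then have "a = \<zero>\<^bsub>M\<^esub>"
      using ab by (intro M.coord_eqI) (auto simp: M.coord_simps M.coord_closed)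
    moreover have "formal_sum_list qs \<in> relator_span"
      using Suc.prems True ps qs n by (intro Suc.hyps) auto
    ultimately show ?thesis
      using relator_span_zero_left[OF ab(2)] formal.span_add by (auto simp: ps formal_sum_list_def)
  next
    case False
    then obtain i where i: "i \<in> I" "e i a \<noteq> 0" by blast
    define r where "r a' = e i a' / e i a" for a'
    \<comment> \<open>One elimination step, with \<open>b\<close> substituted by its expression through the other right factors.\<close>
    define elim where "elim = (\<lambda>(a', b'). (a' \<oplus>\<^bsub>M\<^esub> (- r a') \<odot>\<^bsub>M\<^esub> a, b' :: 'b))"
    have b_rel: "d j b + (\<Sum>(a', b')\<leftarrow>qs. r a' * d j b') = 0" if "j \<in> J" for j
    proof -
      have "e i a * (d j b + (\<Sum>(a', b')\<leftarrow>qs. r a' * d j b')) = (\<Sum>(a', b')\<leftarrow>ps. e i a' * d j b')"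
        using i by (auto simp: ps r_def distrib_left sum_list_const_mult[symmetric] case_prod_beta
            intro!: arg_cong[of _ _ sum_list])
      with Suc.prems(2)[OF i(1) that] i(2) show ?thesis by simp
    qed
    have "Poly_Mapping.single (a, b) 1 + (\<Sum>(r, b')\<leftarrow>map (\<lambda>(a', b'). (r a', b')) qs.
            Poly_Mapping.single (a, b') r) \<in> relator_span"
      using ab qs b_rel
      by (intro linear_relation_in_relator_span) (auto simp: case_prod_unfold o_def)
    then have 1: "Poly_Mapping.single (a, b) 1 + (\<Sum>(a', b')\<leftarrow>qs. Poly_Mapping.single (a, b') (r a'))
        \<in> relator_span"
      by (simp add: case_prod_unfold o_def)
    have 2: "formal_sum_list (map elim qs) \<in> relator_span"
    proof (rule Suc.hyps)
      show "n = length (map elim qs)" by (simp add: n)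
      show "set (map elim qs) \<subseteq> carrier M \<times> carrier N"
        using qs ab by (auto simp: elim_def M.coord_closed)
      fix i' j assume ij: "i' \<in> I" "j \<in> J"
      have "(\<Sum>(a, b)\<leftarrow>map elim qs. e i' a * d j b) =
          (\<Sum>(a', b')\<leftarrow>qs. e i' a' * d j b') - e i' a * (\<Sum>(a', b')\<leftarrow>qs. r a' * d j b')"
        using qs ij ab
        by (induction qs) (auto simp: elim_def M.coord_simps M.coord_closed algebra_simps)
      also have "\<dots> = (\<Sum>(a', b')\<leftarrow>ps. e i' a' * d j b')"
        using b_rel[OF ij(2)] by (simp add: ps add_eq_0_iff)
      finally show "(\<Sum>(a, b)\<leftarrow>map elim qs. e i' a * d j b) = 0"
        using Suc.prems(2)[OF ij] by simp
    qed
    have 3: "formal_sum_list (map elim qs) - formal_sum_list qs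
        + (\<Sum>(a', b')\<leftarrow>qs. Poly_Mapping.single (a, b') (r a')) \<in> relator_span"
      using qs
    proof (induction qs)
      case (Cons q qs)
      obtain a' b' where [simp]: "q = (a', b')" by fastforce
      from Cons.prems have *: "a' \<in> carrier M" "b' \<in> carrier N" by auto
      have "Poly_Mapping.single (a' \<oplus>\<^bsub>M\<^esub> (- r a') \<odot>\<^bsub>M\<^esub> a, b') 1 - Poly_Mapping.single (a', b') 1
          - Poly_Mapping.single ((- r a') \<odot>\<^bsub>M\<^esub> a, b') 1 \<in> relator_span"
        using * ab by (intro relator_span_add_left) (auto simp: M.coord_closed)
      from formal.span_add[OF this relator_span_smult_left[OF ab(1) *(2), of "- r a'"]]
      have "Poly_Mapping.single (a' \<oplus>\<^bsub>M\<^esub> (- r a') \<odot>\<^bsub>M\<^esub> a, b') 1 - Poly_Mapping.single (a', b') 1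
          + Poly_Mapping.single (a, b') (r a') \<in> relator_span"
        by (simp add: Poly_Mapping.single_uminus)
      from formal.span_add[OF this Cons.IH] Cons.prems
      show ?case by (simp add: formal_sum_list_def elim_def algebra_simps)
    qed (simp add: formal_sum_list_def formal.span_zero)
    from formal.span_add[OF formal.span_diff[OF 2 3] 1]
    show ?thesis by (simp add: ps formal_sum_list_def add.commute)
  qed
qed

lemma formal_sum_list_representative:
  assumes "Poly_Mapping.keys f \<subseteq> carrier M \<times> carrier N"
  obtains ps where "set ps \<subseteq> carrier M \<times> carrier N" "f - formal_sum_list ps \<in> relator_span"
proof -
  obtain xs where xs: "set xs = Poly_Mapping.keys f" "distinct xs"
    using finite_distinct_list[of "Poly_Mapping.keys f"] by auto
  define ps where "ps = map (\<lambda>(a, b). (Poly_Mapping.lookup f (a, b) \<odot>\<^bsub>M\<^esub> a, b)) xs"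
  have f: "f = (\<Sum>p\<leftarrow>xs. Poly_Mapping.single p (Poly_Mapping.lookup f p))"
    using formal_sum_singles[of f] xs by (simp add: sum_list_distinct_conv_sum_set)
  have "(\<Sum>p\<leftarrow>xs. Poly_Mapping.single p (Poly_Mapping.lookup f p)) - formal_sum_list ps \<in> relator_span"
    unfolding ps_def using assms unfolding xs(1)[symmetric]
  proof (induction xs)
    case (Cons x xs)
    obtain a b where [simp]: "x = (a, b)" by fastforce
    from Cons.prems have *: "a \<in> carrier M" "b \<in> carrier N" by auto
    from formal.span_diff[OF Cons.IH relator_span_smult_left[OF *, of "Poly_Mapping.lookup f (a, b)"]]
    show ?case using Cons.prems by (simp add: formal_sum_list_def algebra_simps)
  qed (simp add: formal_sum_list_def formal.span_zero)
  with f have "f - formal_sum_list ps \<in> relator_span" by simp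
  moreover have "set ps \<subseteq> carrier M \<times> carrier N"
    using assms by (auto simp: ps_def xs M.coord_closed)
  ultimately show ?thesis by (rule that[rotated])
qed

text \<open>
  Coordinates detect zero in the tensor product. This replaces the span of the relators by a
  condition that can be checked pointwise.
\<close>

lemma relator_span_eq:
  "relator_span = {f. Poly_Mapping.keys f \<subseteq> carrier M \<times> carrier N \<and>
     (\<forall>i\<in>I. \<forall>j\<in>J. formal_coord i j f = 0)}" (is "_ = ?V")
proof (intro equalityI subsetI)
  fix f assume f: "f \<in> relator_span"
  let ?W = "{f :: _ \<Rightarrow>\<^sub>0 'k. Poly_Mapping.keys f \<subseteq> carrier M \<times> carrier N}"
  have "tensor_relators M N \<subseteq> ?W"
    unfolding tensor_relators_def Un_subset_iff
    by (intro conjI subsetI; elim CollectE exE conjE; hypsubst; intro CollectI keys_diff_closed)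
       (simp_all add: M.coord_closed N.coord_closed)
  moreover have "formal.subspace ?W"
  proof (rule formal.subspaceI)
    fix f g :: "('a \<times> 'b) \<Rightarrow>\<^sub>0 'k" assume "f \<in> ?W" "g \<in> ?W"
    then show "f + g \<in> ?W" using Poly_Mapping.keys_add[of f g] by blast
  next
    fix c and f :: "('a \<times> 'b) \<Rightarrow>\<^sub>0 'k" assume "f \<in> ?W"
    then show "formal_scale c f \<in> ?W" using keys_formal_scale_subset[of c f] by blast
  qed simp
  ultimately have "f \<in> ?W" using formal.span_minimal f by blast
  then show "f \<in> ?V"
    using bilinear_form_vanishes_on_relators[OF coord_product_bilinear f] by auto
next
  fix f assume f: "f \<in> ?V"
  then obtain ps where ps: "set ps \<subseteq> carrier M \<times> carrier N" "f - formal_sum_list ps \<in> relator_span"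
    using formal_sum_list_representative by auto
  have "formal_sum_list ps \<in> relator_span"
  proof (rule formal_sum_list_in_relator_span[OF ps(1)])
    fix i j assume "i \<in> I" "j \<in> J"
    with bilinear_form_vanishes_on_relators[OF coord_product_bilinear ps(2), of i j] f
    show "(\<Sum>(a, b)\<leftarrow>ps. e i a * d j b) = 0"
      by (simp add: formal_extend_minus)
  qed
  from formal.span_add[OF ps(2) this] show "f \<in> relator_span" by simp
qed

lemma tensor_class_eqI:
  assumes "Poly_Mapping.keys f \<subseteq> carrier M \<times> carrier N" "Poly_Mapping.keys g \<subseteq> carrier M \<times> carrier N"
    and "\<And>i j. \<lbrakk>i \<in> I; j \<in> J\<rbrakk> \<Longrightarrow> formal_coord i j f = formal_coord i j g"
  shows "tensor_class M N f = tensor_class M N g"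
  unfolding tensor_class_eq_iff relator_span_eq
  using assms keys_diff_closed[OF assms(1,2)] by (auto simp: formal_extend_minus)

lemma mem_tensor_class:
  assumes "Poly_Mapping.keys f \<subseteq> carrier M \<times> carrier N" "g \<in> tensor_class M N f"
  shows "Poly_Mapping.keys g \<subseteq> carrier M \<times> carrier N"
    and "\<lbrakk>i \<in> I; j \<in> J\<rbrakk> \<Longrightarrow> formal_coord i j g = formal_coord i j f"
proof -
  have "g - f \<in> relator_span" using assms(2) by (simp add: tensor_class_def)
  then have *: "Poly_Mapping.keys (g - f) \<subseteq> carrier M \<times> carrier N"
      "\<forall>i\<in>I. \<forall>j\<in>J. formal_coord i j (g - f) = 0"
    unfolding relator_span_eq by auto
  show "Poly_Mapping.keys g \<subseteq> carrier M \<times> carrier N"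
    using Poly_Mapping.keys_add[of "g - f" f] *(1) assms(1) by auto
  show "formal_coord i j g = formal_coord i j f" if "i \<in> I" "j \<in> J"
    using *(2) that by (simp add: formal_extend_minus)
qed

lemma tensor_coord_class:
  assumes "i \<in> I" "j \<in> J"
  shows "tensor_coord e d (i, j) (tensor_class M N f) = formal_coord i j f"
  unfolding tensor_coord_def prod.case
proof (rule the_elem_image_tensor_class)
  fix g assume "g - f \<in> relator_span"
  from bilinear_form_vanishes_on_relators[OF coord_product_bilinear[OF assms] this]
  show "formal_coord i j g = formal_coord i j f" by (simp add: formal_extend_minus)
qed

lemma carrier_tensor:
  "carrier (tensor M N) = tensor_class M N ` {f. Poly_Mapping.keys f \<subseteq> carrier M \<times> carrier N}"
  by (simp add: tensor_def)

lemma UN_tensor_class: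
  assumes "\<And>g. g \<in> tensor_class M N f \<Longrightarrow> T g = S"
  shows "(\<Union>g\<in>tensor_class M N f. T g) = S"
  using tensor_class_self by (intro SUP_eq_const assms) blast

lemma tensor_add:
  "s \<oplus>\<^bsub>tensor M N\<^esub> t = (\<Union>f\<in>s. \<Union>g\<in>t. tensor_class M N (f + g))"
  by (simp add: tensor_def)

lemma tensor_smult: "c \<odot>\<^bsub>tensor M N\<^esub> t = (\<Union>f\<in>t. tensor_class M N (formal_scale c f))"
  by (simp add: tensor_def)

lemma tensor_mult:
  "s \<otimes>\<^bsub>tensor M N\<^esub> t = (\<Union>f\<in>s. \<Union>g\<in>t. tensor_class M N
     (\<Sum>p\<in>Poly_Mapping.keys f. \<Sum>q\<in>Poly_Mapping.keys g.
        Poly_Mapping.single (fst p \<otimes>\<^bsub>M\<^esub> fst q, snd p \<otimes>\<^bsub>N\<^esub> snd q)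
          (Poly_Mapping.lookup f p * Poly_Mapping.lookup g q)))"
  by (simp add: tensor_def)

lemma tensor_add_class:
  assumes f: "Poly_Mapping.keys f \<subseteq> carrier M \<times> carrier N" and g: "Poly_Mapping.keys g \<subseteq> carrier M \<times> carrier N"
  shows "tensor_class M N f \<oplus>\<^bsub>tensor M N\<^esub> tensor_class M N g = tensor_class M N (f + g)"
proof -
  have "tensor_class M N (f' + g') = tensor_class M N (f + g)"
    if "f' \<in> tensor_class M N f" "g' \<in> tensor_class M N g" for f' g'
    using mem_tensor_class[OF f that(1)] mem_tensor_class[OF g that(2)] f g
    by (intro tensor_class_eqI order.trans[OF Poly_Mapping.keys_add])
       (auto simp: formal_extend_add)
  then show ?thesis unfolding tensor_add by (intro UN_tensor_class)
qed

lemma tensor_smult_class: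
  assumes f: "Poly_Mapping.keys f \<subseteq> carrier M \<times> carrier N"
  shows "c \<odot>\<^bsub>tensor M N\<^esub> tensor_class M N f = tensor_class M N (formal_scale c f)"
proof -
  have "tensor_class M N (formal_scale c f') = tensor_class M N (formal_scale c f)"
    if "f' \<in> tensor_class M N f" for f'
    using mem_tensor_class[OF f that] f
    by (intro tensor_class_eqI order.trans[OF keys_formal_scale_subset])
       (auto simp: formal_extend_scale)
  then show ?thesis unfolding tensor_smult by (intro UN_tensor_class)
qed

lemma tensor_zero: "\<zero>\<^bsub>tensor M N\<^esub> = tensor_class M N 0"
  by (simp add: tensor_def)

sublocale tensor: coordinate_space "tensor M N" "I \<times> J" "tensor_coord e d"
proof (unfold_locales, goal_cases)
  case 1
  show ?case by (auto simp: carrier_tensor tensor_zero)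
next
  case (2 a b)
  then show ?case
    using Poly_Mapping.keys_add by (fastforce simp: carrier_tensor tensor_add_class)
next
  case (3 a c)
  then show ?case
    using keys_formal_scale_subset by (fastforce simp: carrier_tensor tensor_smult_class)
next
  case (7 a b)
  from 7(1,2) obtain f g where
    f: "Poly_Mapping.keys f \<subseteq> carrier M \<times> carrier N" "a = tensor_class M N f" and
    g: "Poly_Mapping.keys g \<subseteq> carrier M \<times> carrier N" "b = tensor_class M N g"
    by (auto simp: carrier_tensor)
  have "tensor_class M N f = tensor_class M N g"
  proof (rule tensor_class_eqI[OF f(1) g(1)])
    fix i j assume "i \<in> I" "j \<in> J"
    with 7(3)[of "(i, j)"] show "formal_coord i j f = formal_coord i j g"
      by (simp add: f g tensor_coord_class)
  qed
  with f g show ?case by simp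
qed (auto simp: carrier_tensor tensor_zero tensor_add_class tensor_smult_class tensor_coord_class
    formal_extend_add formal_extend_scale)

lemma tensor_of_closed: "set ps \<subseteq> carrier M \<times> carrier N \<Longrightarrow> tensor_of M N ps \<in> carrier (tensor M N)"
  unfolding tensor_of_def carrier_tensor using keys_formal_sum_list by blast

lemma tensor_coord_tensor_of:
  "\<lbrakk>i \<in> I; j \<in> J\<rbrakk> \<Longrightarrow> tensor_coord e d (i, j) (tensor_of M N ps) = (\<Sum>(a, b)\<leftarrow>ps. e i a * d j b)"
  by (simp add: tensor_of_def tensor_coord_class)

lemma tensorE:
  assumes "t \<in> carrier (tensor M N)"
  obtains ps where "set ps \<subseteq> carrier M \<times> carrier N" "t = tensor_of M N ps"
proof -
  from assms obtain f where f: "t = tensor_class M N f" "Poly_Mapping.keys f \<subseteq> carrier M \<times> carrier N"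
    by (auto simp: carrier_tensor)
  from formal_sum_list_representative[OF f(2)] f(1) that show ?thesis
    by (metis tensor_class_eq_iff tensor_of_def)
qed

lemma pure_tensor_eq: "pure_tensor M N a b = tensor_of M N [(a, b)]"
  by (simp add: pure_tensor_def tensor_of_def formal_sum_list_def)

lemma pure_tensor_closed: "\<lbrakk>a \<in> carrier M; b \<in> carrier N\<rbrakk> \<Longrightarrow> pure_tensor M N a b \<in> carrier (tensor M N)"
  by (simp add: pure_tensor_eq tensor_of_closed)

lemma tensor_coord_pure:
  "\<lbrakk>i \<in> I; j \<in> J\<rbrakk> \<Longrightarrow> tensor_coord e d (i, j) (pure_tensor M N a b) = e i a * d j b"
  by (simp add: pure_tensor_eq tensor_coord_tensor_of)

text \<open>
  The product of two classes is independent of their representatives because multiplicativity of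
  the coordinates passes from the factors to formal sums.
\<close>

lemma tensor_coord_mult:
  assumes M_mult: "\<And>a a'. \<lbrakk>a \<in> carrier M; a' \<in> carrier M\<rbrakk> \<Longrightarrow> a \<otimes>\<^bsub>M\<^esub> a' \<in> carrier M"
      "\<And>i a a'. \<lbrakk>i \<in> I; a \<in> carrier M; a' \<in> carrier M\<rbrakk> \<Longrightarrow> e i (a \<otimes>\<^bsub>M\<^esub> a') = e i a * e i a'"
    and N_mult: "\<And>b b'. \<lbrakk>b \<in> carrier N; b' \<in> carrier N\<rbrakk> \<Longrightarrow> b \<otimes>\<^bsub>N\<^esub> b' \<in> carrier N"
      "\<And>j b b'. \<lbrakk>j \<in> J; b \<in> carrier N; b' \<in> carrier N\<rbrakk> \<Longrightarrow> d j (b \<otimes>\<^bsub>N\<^esub> b') = d j b * d j b'"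
    and s: "s \<in> carrier (tensor M N)" and t: "t \<in> carrier (tensor M N)"
  shows "s \<otimes>\<^bsub>tensor M N\<^esub> t \<in> carrier (tensor M N)"
    and "\<lbrakk>i \<in> I; j \<in> J\<rbrakk> \<Longrightarrow> tensor_coord e d (i, j) (s \<otimes>\<^bsub>tensor M N\<^esub> t)
           = tensor_coord e d (i, j) s * tensor_coord e d (i, j) t"
proof -
  define h where "h f g = (\<Sum>p\<in>Poly_Mapping.keys f. \<Sum>q\<in>Poly_Mapping.keys g.
      Poly_Mapping.single (fst p \<otimes>\<^bsub>M\<^esub> fst q, snd p \<otimes>\<^bsub>N\<^esub> snd q)
        (Poly_Mapping.lookup f p * Poly_Mapping.lookup g q))" for f g :: "('a \<times> 'b) \<Rightarrow>\<^sub>0 'k"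
  from s t obtain f g where
    f: "Poly_Mapping.keys f \<subseteq> carrier M \<times> carrier N" "s = tensor_class M N f" and
    g: "Poly_Mapping.keys g \<subseteq> carrier M \<times> carrier N" "t = tensor_class M N g"
    by (auto simp: carrier_tensor)
  have keys: "Poly_Mapping.keys (h f g) \<subseteq> carrier M \<times> carrier N"
    if "Poly_Mapping.keys f \<subseteq> carrier M \<times> carrier N" "Poly_Mapping.keys g \<subseteq> carrier M \<times> carrier N"
    for f g
    unfolding h_def using that M_mult(1) N_mult(1)
    by (intro order.trans[OF keys_sum] UN_least) (auto simp: subset_iff split: if_splits)
  have coord: "formal_coord i j (h f g) = formal_coord i j f * formal_coord i j g"
    if "Poly_Mapping.keys f \<subseteq> carrier M \<times> carrier N" "Poly_Mapping.keys g \<subseteq> carrier M \<times> carrier N"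
      "i \<in> I" "j \<in> J" for f g i j
  proof -
    have "formal_coord i j (h f g) = (\<Sum>p\<in>Poly_Mapping.keys f. \<Sum>q\<in>Poly_Mapping.keys g.
        (Poly_Mapping.lookup f p * (e i (fst p) * d j (snd p))) *
        (Poly_Mapping.lookup g q * (e i (fst q) * d j (snd q))))"
      unfolding h_def formal_extend_sum using that
      by (intro sum.cong) (auto simp: subset_iff M_mult(2) N_mult(2) algebra_simps)
    then show ?thesis by (simp add: formal_extend_def sum_product case_prod_beta)
  qed
  have "tensor_class M N (h f' g') = tensor_class M N (h f g)"
    if "f' \<in> tensor_class M N f" "g' \<in> tensor_class M N g" for f' g'
    using mem_tensor_class[OF f(1) that(1)] mem_tensor_class[OF g(1) that(2)] f g
    by (intro tensor_class_eqI keys) (auto simp: coord)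
  then have *: "s \<otimes>\<^bsub>tensor M N\<^esub> t = tensor_class M N (h f g)"
    unfolding f g tensor_mult h_def by (intro UN_tensor_class)
  then show "s \<otimes>\<^bsub>tensor M N\<^esub> t \<in> carrier (tensor M N)"
    using keys f g by (auto simp: carrier_tensor)
  show "tensor_coord e d (i, j) (s \<otimes>\<^bsub>tensor M N\<^esub> t)
      = tensor_coord e d (i, j) s * tensor_coord e d (i, j) t" if "i \<in> I" "j \<in> J"
    using that f(1) g(1) unfolding * unfolding f(2) g(2) by (simp add: tensor_coord_class coord)
qed

text \<open>
  Composing \<open>\<beta>\<close> with a coordinate of \<open>P\<close> gives a bilinear form, which kills the relators. Hence
  all representatives of a class have the same image, whose coordinates can be computed from any
  list of pairs.
\<close>

lemma tensor_lift_tensor_of: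
  assumes P: "coordinate_space P K c"
    and closed: "\<And>a b. \<lbrakk>a \<in> carrier M; b \<in> carrier N\<rbrakk> \<Longrightarrow> \<beta> a b \<in> carrier P"
    and bilinear: "\<And>k. k \<in> K \<Longrightarrow> bilinear_form M N (\<lambda>a b. c k (\<beta> a b))"
    and ps: "set ps \<subseteq> carrier M \<times> carrier N"
  shows "tensor_lift P \<beta> (tensor_of M N ps) \<in> carrier P"
    and "k \<in> K \<Longrightarrow> c k (tensor_lift P \<beta> (tensor_of M N ps)) = (\<Sum>(a, b)\<leftarrow>ps. c k (\<beta> a b))"
proof -
  interpret P: coordinate_space P K c by fact
  define \<psi> where "\<psi> f = (\<Oplus>\<^bsub>P\<^esub>p\<in>Poly_Mapping.keys f.
      Poly_Mapping.lookup f p \<odot>\<^bsub>P\<^esub> \<beta> (fst p) (snd p))" for f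
  have \<psi>_closed: "\<psi> f \<in> carrier P" if "Poly_Mapping.keys f \<subseteq> carrier M \<times> carrier N" for f
    unfolding \<psi>_def using that by (intro P.finsum_closed) (auto intro!: P.smult_closed closed)
  have \<psi>_coord: "c k (\<psi> f) = formal_extend (\<lambda>(a, b). c k (\<beta> a b)) f"
    if "Poly_Mapping.keys f \<subseteq> carrier M \<times> carrier N" "k \<in> K" for f k
  proof -
    have "c k (\<psi> f) = (\<Sum>p\<in>Poly_Mapping.keys f.
        c k (Poly_Mapping.lookup f p \<odot>\<^bsub>P\<^esub> \<beta> (fst p) (snd p)))"
      unfolding \<psi>_def using that by (intro P.coord_finsum) (auto intro!: P.smult_closed closed)
    also have "\<dots> = formal_extend (\<lambda>(a, b). c k (\<beta> a b)) f"
      unfolding formal_extend_def using that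
      by (intro sum.cong) (auto simp: subset_iff intro!: P.coord_smult closed)
    finally show ?thesis .
  qed
  let ?f = "formal_sum_list ps :: _ \<Rightarrow>\<^sub>0 'k"
  have f: "Poly_Mapping.keys ?f \<subseteq> carrier M \<times> carrier N"
    using keys_formal_sum_list ps by blast
  have "\<psi> g = \<psi> ?f" if "g - ?f \<in> relator_span" for g
  proof (rule P.coord_eqI)
    have g: "Poly_Mapping.keys g \<subseteq> carrier M \<times> carrier N"
      using that by (intro mem_tensor_class[OF f]) (simp add: tensor_class_def)
    then show "\<psi> g \<in> carrier P" "\<psi> ?f \<in> carrier P" using f \<psi>_closed by auto
    fix k assume "k \<in> K"
    with bilinear_form_vanishes_on_relators[OF bilinear that, of k] f g
    show "c k (\<psi> g) = c k (\<psi> ?f)" by (simp add: \<psi>_coord formal_extend_minus)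
  qed
  then have *: "tensor_lift P \<beta> (tensor_of M N ps) = \<psi> ?f"
    unfolding tensor_lift_def tensor_of_def \<psi>_def by (rule the_elem_image_tensor_class)
  show "tensor_lift P \<beta> (tensor_of M N ps) \<in> carrier P"
    using \<psi>_closed[OF f] by (simp add: *)
  show "c k (tensor_lift P \<beta> (tensor_of M N ps)) = (\<Sum>(a, b)\<leftarrow>ps. c k (\<beta> a b))" if "k \<in> K"
    using that by (simp add: * \<psi>_coord[OF f])
qed

end

section \<open>Hopf algebras of functions\<close>

lemma (in tensor_coordinates) tensor_map_tensor_of:
  assumes cod: "tensor_coordinates M' I' e' N' J' d'"
    and f: "f \<in> linear_maps M M'" and g: "g \<in> linear_maps N N'"
    and ps: "set ps \<subseteq> carrier M \<times> carrier N"
  shows "tensor_map M' N' f g (tensor_of M N ps) \<in> carrier (tensor M' N')"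
    and "\<lbrakk>i \<in> I'; j \<in> J'\<rbrakk> \<Longrightarrow> tensor_coord e' d' (i, j) (tensor_map M' N' f g (tensor_of M N ps))
           = (\<Sum>(a, b)\<leftarrow>ps. e' i (f a) * d' j (g b))"
proof -
  interpret cod: tensor_coordinates M' I' e' N' J' d' by fact
  have fg_closed: "f a \<in> carrier M'" "g b \<in> carrier N'" if "a \<in> carrier M" "b \<in> carrier N" for a b
    using f g that by (auto simp: linear_maps_def)
  have bilinear: "bilinear_form M N (\<lambda>a b. tensor_coord e' d' ij (pure_tensor M' N' (f a) (g b)))"
    if ij: "ij \<in> I' \<times> J'" for ij
    using f g ij fg_closed
    by (auto simp: bilinear_form_def linear_maps_def Pi_iff cod.tensor_coord_pure
        cod.M.coord_simps cod.N.coord_simps algebra_simps)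
  note lift = tensor_lift_tensor_of[OF cod.tensor.coordinate_space_axioms
      cod.pure_tensor_closed[OF fg_closed] bilinear ps, folded tensor_map_def]
  show "tensor_map M' N' f g (tensor_of M N ps) \<in> carrier (tensor M' N')"
    by (rule lift(1))
  show "tensor_coord e' d' (i, j) (tensor_map M' N' f g (tensor_of M N ps))
      = (\<Sum>(a, b)\<leftarrow>ps. e' i (f a) * d' j (g b))" if "i \<in> I'" "j \<in> J'"
  proof -
    have "tensor_coord e' d' (i, j) (tensor_map M' N' f g (tensor_of M N ps))
        = (\<Sum>(a, b)\<leftarrow>ps. tensor_coord e' d' (i, j) (pure_tensor M' N' (f a) (g b)))"
      using that by (intro lift(2)) auto
    with that show ?thesis by (simp add: cod.tensor_coord_pure)
  qed
qed

text \<open>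
  Reassociating a tensor only rebrackets its coordinates.
\<close>

lemma tensor_assoc_coord:
  assumes M: "coordinate_space M I e" and N: "coordinate_space N J d" and P: "coordinate_space P K c"
    and s: "s \<in> carrier (tensor (tensor M N) P)"
  shows "tensor_assoc M N P s \<in> carrier (tensor M (tensor N P))"
    and "\<lbrakk>i \<in> I; j \<in> J; k \<in> K\<rbrakk> \<Longrightarrow>
      tensor_coord e (tensor_coord d c) (i, (j, k)) (tensor_assoc M N P s)
        = tensor_coord (tensor_coord e d) c ((i, j), k) s"
proof -
  interpret MN: tensor_coordinates M I e N J d
    using M N by (rule tensor_coordinates.intro)
  interpret NP: tensor_coordinates N J d P K c
    using N P by (rule tensor_coordinates.intro)
  interpret MN_P: tensor_coordinates "tensor M N" "I \<times> J" "tensor_coord e d" P K c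
    by unfold_locales
  interpret M_NP: tensor_coordinates M I e "tensor N P" "J \<times> K" "tensor_coord d c"
    by unfold_locales
  let ?T = "tensor M (tensor N P)"
  define inner where "inner t z = tensor_lift ?T
      (\<lambda>a b. pure_tensor M (tensor N P) a (pure_tensor N P b z)) t" for t z
  have inner: "inner t z \<in> carrier ?T \<and> (\<forall>i\<in>I. \<forall>j\<in>J. \<forall>k\<in>K.
      tensor_coord e (tensor_coord d c) (i, (j, k)) (inner t z) = tensor_coord e d (i, j) t * c k z)"
    if t: "t \<in> carrier (tensor M N)" and z: "z \<in> carrier P" for t z
  proof -
    obtain qs where qs: "set qs \<subseteq> carrier M \<times> carrier N" "t = tensor_of M N qs"
      using MN.tensorE[OF t] by blast
    have closed: "pure_tensor M (tensor N P) a (pure_tensor N P b z) \<in> carrier ?T"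
      if "a \<in> carrier M" "b \<in> carrier N" for a b
      using that z by (intro M_NP.pure_tensor_closed NP.pure_tensor_closed)
    have bilinear: "bilinear_form M N (\<lambda>a b. tensor_coord e (tensor_coord d c) ijk
        (pure_tensor M (tensor N P) a (pure_tensor N P b z)))" if "ijk \<in> I \<times> J \<times> K" for ijk
      using that z by (auto simp: bilinear_form_def M_NP.tensor_coord_pure NP.tensor_coord_pure
          MN.M.coord_simps MN.N.coord_simps algebra_simps)
    note lift = MN.tensor_lift_tensor_of[OF M_NP.tensor.coordinate_space_axioms closed bilinear qs(1),
        folded qs(2)]
    show ?thesis
      using lift by (auto simp: inner_def qs(2) MN.tensor_coord_tensor_of M_NP.tensor_coord_pure
          NP.tensor_coord_pure case_prod_unfold sum_list_mult_const[symmetric] mult.assoc)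
  qed
  obtain ps where ps: "set ps \<subseteq> carrier (tensor M N) \<times> carrier P" "s = tensor_of (tensor M N) P ps"
    using MN_P.tensorE[OF s] by blast
  have bilinear: "bilinear_form (tensor M N) P
      (\<lambda>t z. tensor_coord e (tensor_coord d c) ijk (inner t z))" if "ijk \<in> I \<times> J \<times> K" for ijk
    using that inner by (auto simp: bilinear_form_def MN.tensor.coord_simps MN.tensor.coord_closed
        NP.N.coord_simps NP.N.coord_closed algebra_simps)
  have inner_closed: "inner t z \<in> carrier ?T" if "t \<in> carrier (tensor M N)" "z \<in> carrier P" for t z
    using inner that by blast
  have assoc: "tensor_assoc M N P s = tensor_lift ?T inner (tensor_of (tensor M N) P ps)"
    by (simp add: tensor_assoc_def inner_def[abs_def] ps(2))
  note lift = MN_P.tensor_lift_tensor_of[OF M_NP.tensor.coordinate_space_axioms inner_closed bilinear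
      ps(1), folded assoc]
  show "tensor_assoc M N P s \<in> carrier ?T"
    by (rule lift(1))
  show "tensor_coord e (tensor_coord d c) (i, (j, k)) (tensor_assoc M N P s)
      = tensor_coord (tensor_coord e d) c ((i, j), k) s" if ijk: "i \<in> I" "j \<in> J" "k \<in> K"
  proof -
    have "tensor_coord e (tensor_coord d c) (i, (j, k)) (tensor_assoc M N P s) =
        (\<Sum>(t, z)\<leftarrow>ps. tensor_coord e (tensor_coord d c) (i, (j, k)) (inner t z))"
      using ijk by (intro lift(2)) auto
    also have "\<dots> = (\<Sum>(t, z)\<leftarrow>ps. tensor_coord e d (i, j) t * c k z)"
    proof (intro arg_cong[where f = sum_list] map_cong refl)
      fix tz assume "tz \<in> set ps"
      then have "fst tz \<in> carrier (tensor M N)" "snd tz \<in> carrier P" using ps(1) by auto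
      with inner[OF this] ijk
      show "(case tz of (t, z) \<Rightarrow> tensor_coord e (tensor_coord d c) (i, (j, k)) (inner t z)) =
          (case tz of (t, z) \<Rightarrow> tensor_coord e d (i, j) t * c k z)"
        by (simp add: case_prod_beta)
    qed
    also have "\<dots> = tensor_coord (tensor_coord e d) c ((i, j), k) (tensor_of (tensor M N) P ps)"
      using ijk by (intro MN_P.tensor_coord_tensor_of[symmetric]) auto
    finally show ?thesis unfolding ps(2) .
  qed
qed

abbreviation (input) eval_at :: "'p \<Rightarrow> ('p \<Rightarrow> 'k) \<Rightarrow> 'k" where
  "eval_at p u \<equiv> u p"

text \<open>
  An algebra of functions on \<open>L\<close> with pointwise operations. The evaluations at the points of \<open>L\<close> are
  separating coordinates, so tensors of such functions are determined by their values on \<open>L \<times> L\<close>.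
\<close>

locale function_subalgebra =
  fixes A :: "('k::field, 'p \<Rightarrow> 'k) module" (structure) and L :: "'p set" and C :: "('p \<Rightarrow> 'k) set"
  assumes A_eq: "A = (function_algebra L)\<lparr>carrier := C\<rparr>"
    and extensional: "u \<in> C \<Longrightarrow> u \<in> extensional L"
    and one_mem: "(\<lambda>p\<in>L. 1) \<in> C"
    and add_mem: "\<lbrakk>u \<in> C; v \<in> C\<rbrakk> \<Longrightarrow> (\<lambda>p\<in>L. u p + v p) \<in> C"
    and smult_mem: "u \<in> C \<Longrightarrow> (\<lambda>p\<in>L. c * u p) \<in> C"
    and mult_mem: "\<lbrakk>u \<in> C; v \<in> C\<rbrakk> \<Longrightarrow> (\<lambda>p\<in>L. u p * v p) \<in> C"
begin

lemma A_simps: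
  "carrier A = C" "\<one> = (\<lambda>p\<in>L. 1)" "\<zero> = (\<lambda>p\<in>L. 0)"
  "u \<otimes> v = (\<lambda>p\<in>L. u p * v p)" "u \<oplus> v = (\<lambda>p\<in>L. u p + v p)" "c \<odot> u = (\<lambda>p\<in>L. c * u p)"
  by (simp_all add: A_eq function_algebra_def)

lemma zero_mem: "(\<lambda>p\<in>L. 0) \<in> C"
  using smult_mem[OF one_mem, of 0] by (simp cong: restrict_cong)

lemma mem_eqI: "\<lbrakk>u \<in> C; v \<in> C; \<And>p. p \<in> L \<Longrightarrow> u p = v p\<rbrakk> \<Longrightarrow> u = v"
  using extensional extensionalityI by metis

sublocale tensor_coordinates A L eval_at A L eval_at
  by unfold_locales (auto simp: A_simps zero_mem add_mem smult_mem intro: mem_eqI)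

lemma carrier_A: "carrier A = C"
  by (simp add: A_simps)

lemma op_closed:
  "\<one> \<in> C" "\<lbrakk>u \<in> C; v \<in> C\<rbrakk> \<Longrightarrow> u \<oplus> v \<in> C" "\<lbrakk>u \<in> C; v \<in> C\<rbrakk> \<Longrightarrow> u \<otimes> v \<in> C" "u \<in> C \<Longrightarrow> c \<odot> u \<in> C"
  by (simp_all add: A_simps one_mem add_mem mult_mem smult_mem)

lemma op_eval:
  assumes "p \<in> L"
  shows "\<one> p = 1" "(u \<oplus> v) p = u p + v p" "(u \<otimes> v) p = u p * v p" "(c \<odot> u) p = c * u p"
  using assms by (simp_all add: A_simps)

lemma is_ring: "ring A"
proof (rule ringI)
  show "abelian_group A" by (rule M.is_abelian_group)
  show "Group.monoid A"
    by (rule monoidI) (auto simp: carrier_A op_closed op_eval intro!: mem_eqI)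
qed (auto simp: carrier_A op_closed op_eval algebra_simps intro!: mem_eqI)

lemma tensor_mult_eval:
  assumes "s \<in> carrier (tensor A A)" "t \<in> carrier (tensor A A)"
  shows "s \<otimes>\<^bsub>tensor A A\<^esub> t \<in> carrier (tensor A A)"
    and "\<lbrakk>p \<in> L; q \<in> L\<rbrakk> \<Longrightarrow> tensor_coord eval_at eval_at (p, q) (s \<otimes>\<^bsub>tensor A A\<^esub> t)
      = tensor_coord eval_at eval_at (p, q) s * tensor_coord eval_at eval_at (p, q) t"
  using assms by (intro tensor_coord_mult; simp add: carrier_A op_closed op_eval)+

text \<open>
  A function \<open>T\<close> of finite rank is a finite sum of products of functions from any algebra \<open>C\<close> that
  contains its slices, no matter from which functions \<open>a\<close> and \<open>b\<close> the given presentation is built.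
  If \<open>T p0 q0 = c\<close> is nonzero, then subtracting \<open>T p q0 * T p0 q / c\<close>, a product of slices, leaves a
  function that vanishes for \<open>p = p0\<close> and for \<open>q = q0\<close>; its slices still lie in \<open>C\<close>, and its
  rank is smaller by one.
\<close>

lemma cross_approximation:
  assumes "\<And>p q. \<lbrakk>p \<in> L; q \<in> L\<rbrakk> \<Longrightarrow> T p q = (\<Sum>(a, b)\<leftarrow>ps. a p * b q)"
    and "\<And>q. q \<in> L \<Longrightarrow> (\<lambda>p\<in>L. T p q) \<in> C" and "\<And>p. p \<in> L \<Longrightarrow> (\<lambda>q\<in>L. T p q) \<in> C"
  shows "\<exists>qs. set qs \<subseteq> C \<times> C \<and> (\<forall>p\<in>L. \<forall>q\<in>L. T p q = (\<Sum>(a, b)\<leftarrow>qs. a p * b q))"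
  using assms
proof (induction "length ps" arbitrary: ps T)
  case 0
  then show ?case by (intro exI[of _ "[]"]) auto
next
  case (Suc n)
  note rep = Suc.prems(1) and left = Suc.prems(2) and right = Suc.prems(3)
  show ?case
  proof (cases "\<forall>p\<in>L. \<forall>q\<in>L. T p q = 0")
    case True
    then show ?thesis by (intro exI[of _ "[]"]) auto
  next
    case False
    then obtain p0 q0 where p0: "p0 \<in> L" and q0: "q0 \<in> L" and nz: "T p0 q0 \<noteq> 0" by blast
    define c where "c = T p0 q0"
    have "\<exists>(a, b)\<in>set ps. a p0 \<noteq> 0"
    proof (rule ccontr)
      assume "\<not> (\<exists>(a, b)\<in>set ps. a p0 \<noteq> 0)"
      then have "(\<Sum>(a, b)\<leftarrow>ps. a p0 * b q0) = 0"
        by (induction ps) auto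
      with rep[OF p0 q0] nz show False by simp
    qed
    then obtain a b xs ys where ps: "ps = xs @ (a, b) # ys" and a: "a p0 \<noteq> 0"
      using split_list by fastforce
    define rs where "rs = xs @ ys"
    have T: "T p q = a p * b q + (\<Sum>(a', b')\<leftarrow>rs. a' p * b' q)" if "p \<in> L" "q \<in> L" for p q
      using rep[OF that] by (simp add: ps rs_def)
    \<comment> \<open>The residual of \<open>T\<close> after one step of the approximation.\<close>
    define T' where "T' p q = T p q - T p q0 * (T p0 q / c)" for p q
    \<comment> \<open>A presentation of the residual with one term less: the term \<open>(a, b)\<close> is eliminated by means of \<open>a p0 \<noteq> 0\<close>.\<close>
    define rs' where "rs' = map (\<lambda>(a', b').
        (\<lambda>p. a' p - a' p0 / a p0 * a p, \<lambda>q. b' q - b' q0 / c * T p0 q)) rs"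
    have "\<exists>qs. set qs \<subseteq> C \<times> C \<and> (\<forall>p\<in>L. \<forall>q\<in>L. T' p q = (\<Sum>(a, b)\<leftarrow>qs. a p * b q))"
    proof (rule Suc.hyps(1)[of rs'])
      show "n = length rs'" using Suc.hyps(2) by (simp add: rs'_def rs_def ps)
      fix p q assume p: "p \<in> L" and q: "q \<in> L"
      define U where "U q = (\<Sum>(a', b')\<leftarrow>rs. (a' p - a' p0 / a p0 * a p) * b' q)" for q
      have U: "U q = T p q - a p * T p0 q / a p0" if "q \<in> L" for q
      proof -
        have "U q = (\<Sum>(a', b')\<leftarrow>rs. a' p * b' q) - a p / a p0 * (\<Sum>(a', b')\<leftarrow>rs. a' p0 * b' q)"
          unfolding U_def by (induction rs) (auto simp: algebra_simps)
        with T[OF p that] T[OF p0 that] a show ?thesis by (simp add: field_simps)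
      qed
      have "(\<Sum>(a, b)\<leftarrow>rs'. a p * b q) = U q - T p0 q / c * U q0"
        unfolding U_def rs'_def
        by (induction rs) (auto simp: algebra_simps add_divide_distrib diff_divide_distrib)
      also have "\<dots> = T' p q"
        using nz a by (simp add: U[OF q] U[OF q0] T'_def flip: c_def) (simp add: field_simps)
      finally show "T' p q = (\<Sum>(a, b)\<leftarrow>rs'. a p * b q)" by simp
    next
      fix q assume q: "q \<in> L"
      have "(\<lambda>p\<in>L. T' p q) = (\<lambda>p\<in>L. (\<lambda>p\<in>L. T p q) p + (\<lambda>p\<in>L. - (T p0 q / c) * (\<lambda>p\<in>L. T p q0) p) p)"
        by (auto simp: T'_def)
      also have "\<dots> \<in> C" by (intro add_mem smult_mem left q q0)
      finally show "(\<lambda>p\<in>L. T' p q) \<in> C" .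
    next
      fix p assume p: "p \<in> L"
      have "(\<lambda>q\<in>L. T' p q) = (\<lambda>q\<in>L. (\<lambda>q\<in>L. T p q) q + (\<lambda>q\<in>L. - (T p q0 / c) * (\<lambda>q\<in>L. T p0 q) q) q)"
        by (auto simp: T'_def)
      also have "\<dots> \<in> C" by (intro add_mem smult_mem right p p0)
      finally show "(\<lambda>q\<in>L. T' p q) \<in> C" .
    qed
    then obtain qs where qs: "set qs \<subseteq> C \<times> C"
      "\<forall>p\<in>L. \<forall>q\<in>L. T' p q = (\<Sum>(a, b)\<leftarrow>qs. a p * b q)" by blast
    let ?u = "\<lambda>p\<in>L. T p q0" and ?v = "\<lambda>q\<in>L. (1 / c) * (\<lambda>q\<in>L. T p0 q) q"
    have "?u \<in> C" "?v \<in> C" by (rule left[OF q0], rule smult_mem[OF right[OF p0]])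
    then show ?thesis
      using qs by (intro exI[of _ "(?u, ?v) # qs"]) (auto simp: T'_def diff_eq_eq add.commute)
  qed
qed

end

text \<open>
  The points of \<open>L\<close> form a group as far as the functions in \<open>C\<close> can see: the group laws are imposed on
  values of functions, because loops satisfy them only in this sense. The factorization axiom says that the
  pullback of \<open>u\<close> along the multiplication, a function of two variables, lies in the tensor square of \<open>C\<close>.
\<close>

locale function_hopf_algebra = function_subalgebra A L C
  for A :: "('k::field, 'p \<Rightarrow> 'k) module" (structure) and L :: "'p set" and C :: "('p \<Rightarrow> 'k) set" +
  fixes mul :: "'p \<Rightarrow> 'p \<Rightarrow> 'p" and inverse_of :: "'p \<Rightarrow> 'p" and unit_of :: 'p
  assumes mul_mem: "\<lbrakk>p \<in> L; q \<in> L\<rbrakk> \<Longrightarrow> mul p q \<in> L"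
    and inverse_mem: "p \<in> L \<Longrightarrow> inverse_of p \<in> L"
    and unit_mem: "unit_of \<in> L"
    and factorization: "u \<in> C \<Longrightarrow>
      \<exists>ps. set ps \<subseteq> C \<times> C \<and> (\<forall>p\<in>L. \<forall>q\<in>L. u (mul p q) = (\<Sum>(a, b)\<leftarrow>ps. a p * b q))"
    and inverse_pullback: "u \<in> C \<Longrightarrow> (\<lambda>p\<in>L. u (inverse_of p)) \<in> C"
    and mul_assoc: "\<lbrakk>u \<in> C; p \<in> L; q \<in> L; r \<in> L\<rbrakk> \<Longrightarrow> u (mul (mul p q) r) = u (mul p (mul q r))"
    and mul_unit_left: "\<lbrakk>u \<in> C; p \<in> L\<rbrakk> \<Longrightarrow> u (mul unit_of p) = u p"
    and mul_unit_right: "\<lbrakk>u \<in> C; p \<in> L\<rbrakk> \<Longrightarrow> u (mul p unit_of) = u p"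
    and mul_inverse_left: "\<lbrakk>u \<in> C; p \<in> L\<rbrakk> \<Longrightarrow> u (mul (inverse_of p) p) = u unit_of"
    and mul_inverse_right: "\<lbrakk>u \<in> C; p \<in> L\<rbrakk> \<Longrightarrow> u (mul p (inverse_of p)) = u unit_of"
begin

definition comult :: "('p \<Rightarrow> 'k) \<Rightarrow> ((('p \<Rightarrow> 'k) \<times> ('p \<Rightarrow> 'k)) \<Rightarrow>\<^sub>0 'k) set" where
  "comult u = (THE t. t \<in> carrier (tensor A A) \<and>
     (\<forall>p\<in>L. \<forall>q\<in>L. tensor_coord eval_at eval_at (p, q) t = u (mul p q)))"

lemma comult_unique:
  assumes "t \<in> carrier (tensor A A)"
    and "\<And>p q. \<lbrakk>p \<in> L; q \<in> L\<rbrakk> \<Longrightarrow> tensor_coord eval_at eval_at (p, q) t = u (mul p q)"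
  shows "comult u = t"
  unfolding comult_def
proof (rule the_equality)
  fix s assume "s \<in> carrier (tensor A A) \<and>
     (\<forall>p\<in>L. \<forall>q\<in>L. tensor_coord eval_at eval_at (p, q) s = u (mul p q))"
  with assms show "s = t" by (intro tensor.coord_eqI) auto
qed (use assms in auto)

lemma comultE:
  assumes "u \<in> C"
  obtains ps where "set ps \<subseteq> C \<times> C" "comult u = tensor_of A A ps"
    "\<And>p q. \<lbrakk>p \<in> L; q \<in> L\<rbrakk> \<Longrightarrow> (\<Sum>(a, b)\<leftarrow>ps. a p * b q) = u (mul p q)"
proof -
  obtain ps where ps: "set ps \<subseteq> C \<times> C"
    "\<forall>p\<in>L. \<forall>q\<in>L. u (mul p q) = (\<Sum>(a, b)\<leftarrow>ps. a p * b q)"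
    using factorization[OF assms] by blast
  then have "comult u = tensor_of A A ps"
    by (intro comult_unique tensor_of_closed) (auto simp: A_simps tensor_coord_tensor_of)
  with ps show ?thesis by (intro that) auto
qed

lemma comult_closed: "u \<in> C \<Longrightarrow> comult u \<in> carrier (tensor A A)"
  by (erule comultE) (simp add: tensor_of_closed A_simps)

lemma comult_coord:
  "\<lbrakk>u \<in> C; p \<in> L; q \<in> L\<rbrakk> \<Longrightarrow> tensor_coord eval_at eval_at (p, q) (comult u) = u (mul p q)"
  by (erule comultE) (simp add: tensor_coord_tensor_of)

lemma comult_linear: "comult \<in> linear_maps A (tensor A A)"
  unfolding linear_maps_def
proof (intro CollectI conjI ballI allI Pi_I)
  fix u assume u: "u \<in> carrier A"
  then show "comult u \<in> carrier (tensor A A)" by (simp add: comult_closed A_simps)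
  fix c
  show "comult (c \<odot> u) = c \<odot>\<^bsub>tensor A A\<^esub> comult u"
    using u by (intro comult_unique tensor.coord_closed)
      (auto simp: A_simps comult_closed tensor.coord_simps comult_coord mul_mem)
  fix v assume v: "v \<in> carrier A"
  show "comult (u \<oplus> v) = comult u \<oplus>\<^bsub>tensor A A\<^esub> comult v"
    using u v by (intro comult_unique tensor.coord_closed)
      (auto simp: A_simps comult_closed tensor.coord_simps comult_coord mul_mem)
qed

lemma comult_hom: "comult \<in> ring_hom A (tensor A A)"
proof (rule ring_hom_memI)
  fix u v assume u: "u \<in> carrier A" and v: "v \<in> carrier A"
  then show "comult u \<in> carrier (tensor A A)" "comult (u \<oplus> v) = comult u \<oplus>\<^bsub>tensor A A\<^esub> comult v"
    using comult_linear by (auto simp: linear_maps_def)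
  show "comult (u \<otimes> v) = comult u \<otimes>\<^bsub>tensor A A\<^esub> comult v"
    using u v by (intro comult_unique tensor_mult_eval(1))
      (auto simp: carrier_A op_closed op_eval comult_closed comult_coord mul_mem tensor_mult_eval(2))
next
  have "\<one>\<^bsub>tensor A A\<^esub> = pure_tensor A A \<one> \<one>" by (simp add: tensor_def)
  then show "comult \<one> = \<one>\<^bsub>tensor A A\<^esub>"
    by (intro comult_unique) (auto simp: A_simps one_mem pure_tensor_closed tensor_coord_pure mul_mem)
qed

text \<open>
  The common core of the counit and antipode axioms. In each of them a bilinear map evaluates the
  left tensor factor at \<open>l p\<close> and the right one at \<open>r p\<close>, so that composition with the
  comultiplication evaluates \<open>u\<close> at the product of \<open>l p\<close> and \<open>r p\<close>.
\<close>

lemma comult_lift: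
  assumes u: "u \<in> C"
    and closed: "\<And>a b. \<lbrakk>a \<in> C; b \<in> C\<rbrakk> \<Longrightarrow> \<beta> a b \<in> C"
    and bilinear: "\<And>p. p \<in> L \<Longrightarrow> bilinear_form A A (\<lambda>a b. \<beta> a b p)"
    and product: "\<And>a b p. \<lbrakk>a \<in> C; b \<in> C; p \<in> L\<rbrakk> \<Longrightarrow> \<beta> a b p = a (l p) * b (r p)"
    and lr: "\<And>p. p \<in> L \<Longrightarrow> l p \<in> L \<and> r p \<in> L"
    and v: "v \<in> C" "\<And>p. p \<in> L \<Longrightarrow> u (mul (l p) (r p)) = v p"
  shows "tensor_lift A \<beta> (comult u) = v"
proof -
  obtain ps where ps: "set ps \<subseteq> C \<times> C" "comult u = tensor_of A A ps"
    "\<And>p q. \<lbrakk>p \<in> L; q \<in> L\<rbrakk> \<Longrightarrow> (\<Sum>(a, b)\<leftarrow>ps. a p * b q) = u (mul p q)"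
    using comultE[OF u] by blast
  note lift = tensor_lift_tensor_of[OF M.coordinate_space_axioms, unfolded A_simps,
      OF closed bilinear ps(1), folded ps(2)]
  show ?thesis
  proof (rule mem_eqI)
    fix p assume p: "p \<in> L"
    have "tensor_lift A \<beta> (comult u) p = (\<Sum>(a, b)\<leftarrow>ps. \<beta> a b p)"
      using p by (intro lift(2)) auto
    also have "\<dots> = (\<Sum>(a, b)\<leftarrow>ps. a (l p) * b (r p))"
      using ps(1) product p by (intro arg_cong[where f = sum_list] map_cong) auto
    also have "\<dots> = v p" using ps(3) lr[OF p] v(2)[OF p] by simp
    finally show "tensor_lift A \<beta> (comult u) p = v p" .
  qed (use v lift(1) in auto)
qed

lemma coassociative:
  assumes u: "u \<in> C"
  shows "tensor_assoc A A A (tensor_map (tensor A A) A comult (\<lambda>b. b) (comult u))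
    = tensor_map A (tensor A A) (\<lambda>b. b) comult (comult u)"
proof -
  interpret AA_A: tensor_coordinates "tensor A A" "L \<times> L" "tensor_coord eval_at eval_at" A L eval_at
    by unfold_locales
  interpret A_AA: tensor_coordinates A L eval_at "tensor A A" "L \<times> L" "tensor_coord eval_at eval_at"
    by unfold_locales
  obtain ps where ps: "set ps \<subseteq> carrier A \<times> carrier A" "comult u = tensor_of A A ps"
    "\<And>p q. \<lbrakk>p \<in> L; q \<in> L\<rbrakk> \<Longrightarrow> (\<Sum>(a, b)\<leftarrow>ps. a p * b q) = u (mul p q)"
    using comultE[OF u] unfolding A_simps by blast
  have id: "(\<lambda>b. b) \<in> linear_maps A A" by (simp add: linear_maps_def)
  note left = tensor_map_tensor_of[OF AA_A.tensor_coordinates_axioms comult_linear id ps(1), folded ps(2)]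
  note right = tensor_map_tensor_of[OF A_AA.tensor_coordinates_axioms id comult_linear ps(1), folded ps(2)]
  note assoc = tensor_assoc_coord[OF M.coordinate_space_axioms M.coordinate_space_axioms
      M.coordinate_space_axioms left(1)]
  show ?thesis
  proof (rule A_AA.tensor.coord_eqI)
    fix pqr assume "pqr \<in> L \<times> L \<times> L"
    then obtain p q r where pqr: "pqr = (p, q, r)" "p \<in> L" "q \<in> L" "r \<in> L" by auto
    have "tensor_coord eval_at (tensor_coord eval_at eval_at) (p, q, r)
        (tensor_assoc A A A (tensor_map (tensor A A) A comult (\<lambda>b. b) (comult u)))
      = (\<Sum>(a, b)\<leftarrow>ps. tensor_coord eval_at eval_at (p, q) (comult a) * b r)"
      using pqr by (simp add: assoc(2) left(2))
    also have "\<dots> = (\<Sum>(a, b)\<leftarrow>ps. a (mul p q) * b r)"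
      using pqr ps(1) by (intro arg_cong[where f = sum_list] map_cong) (auto simp: comult_coord A_simps)
    also have "\<dots> = u (mul (mul p q) r)"
      using pqr by (simp add: ps(3) mul_mem)
    also have "\<dots> = (\<Sum>(a, b)\<leftarrow>ps. a p * b (mul q r))"
      using pqr by (simp add: ps(3) mul_mem mul_assoc u)
    also have "\<dots> = (\<Sum>(a, b)\<leftarrow>ps. a p * tensor_coord eval_at eval_at (q, r) (comult b))"
      using pqr ps(1) by (intro arg_cong[where f = sum_list] map_cong) (auto simp: comult_coord A_simps)
    also have "\<dots> = tensor_coord eval_at (tensor_coord eval_at eval_at) (p, q, r)
        (tensor_map A (tensor A A) (\<lambda>b. b) comult (comult u))"
      using pqr by (simp add: right(2))
    finally show "tensor_coord eval_at (tensor_coord eval_at eval_at) pqr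
        (tensor_assoc A A A (tensor_map (tensor A A) A comult (\<lambda>b. b) (comult u)))
      = tensor_coord eval_at (tensor_coord eval_at eval_at) pqr
        (tensor_map A (tensor A A) (\<lambda>b. b) comult (comult u))"
      by (simp add: pqr)
  qed (use assoc right in auto)
qed

theorem hopf_algebra_comult:
  assumes S: "\<And>u. u \<in> C \<Longrightarrow> S u = (\<lambda>p\<in>L. u (inverse_of p))"
  shows "hopf_algebra A (\<lambda>c. \<lambda>p\<in>L. c) comult (\<lambda>u. u unit_of) S"
proof (intro hopf_algebra.intro hopf_algebra_axioms.intro M.is_module is_ring comult_linear comult_hom)
  have const_mem: "(\<lambda>p\<in>L. c) \<in> C" for c
    using smult_mem[OF one_mem, of c] by (simp cong: restrict_cong)
  show "(\<lambda>u. u unit_of) \<in> ring_hom A ring_of_type_algebra"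
    by (rule ring_hom_memI) (auto simp: A_simps ring_of_type_algebra_def unit_mem)
  show "S \<in> linear_maps A A"
    by (auto simp: linear_maps_def A_simps S inverse_pullback add_mem smult_mem inverse_mem)
  fix u assume "u \<in> carrier A"
  then have u: "u \<in> C" by (simp add: A_simps)
  then show "tensor_assoc A A A (tensor_map (tensor A A) A comult (\<lambda>b. b) (comult u))
    = tensor_map A (tensor A A) (\<lambda>b. b) comult (comult u)" by (rule coassociative)
  show "tensor_lift A (\<lambda>b c. b unit_of \<odot> c) (comult u) = u"
    by (rule comult_lift[where l = "\<lambda>p. unit_of" and r = "\<lambda>p. p"])
       (auto simp: u carrier_A op_closed op_eval unit_mem mul_unit_left bilinear_form_def algebra_simps)
  show "tensor_lift A (\<lambda>b c. c unit_of \<odot> b) (comult u) = u"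
    by (rule comult_lift[where l = "\<lambda>p. p" and r = "\<lambda>p. unit_of"])
       (auto simp: u carrier_A op_closed op_eval unit_mem mul_unit_right bilinear_form_def algebra_simps)
  show "tensor_lift A (\<lambda>b c. S b \<otimes> c) (comult u) = (\<lambda>p\<in>L. u unit_of)"
    by (rule comult_lift[where l = inverse_of and r = "\<lambda>p. p"])
       (auto simp: u carrier_A op_closed op_eval S inverse_pullback const_mem inverse_mem
         mul_inverse_left bilinear_form_def algebra_simps)
  show "tensor_lift A (\<lambda>b c. b \<otimes> S c) (comult u) = (\<lambda>p\<in>L. u unit_of)"
    by (rule comult_lift[where l = "\<lambda>p. p" and r = inverse_of])
       (auto simp: u carrier_A op_closed op_eval S inverse_pullback const_mem inverse_mem
         mul_inverse_right bilinear_form_def algebra_simps)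
qed (auto simp: A_simps mult_mem smult_mem unit_mem algebra_simps)

end

section \<open>Shuffles and the convolution of word functions\<close>

text \<open>
  The product of noncommutative power series, where \<open>F w\<close> is the coefficient of \<open>F\<close> at the word \<open>w\<close>.
\<close>

definition convolve :: "('w list \<Rightarrow> 'k::comm_ring_1) \<Rightarrow> ('w list \<Rightarrow> 'k) \<Rightarrow> 'w list \<Rightarrow> 'k" where
  "convolve F G w = (\<Sum>i\<le>length w. F (take i w) * G (drop i w))"

definition word_unit :: "'w list \<Rightarrow> 'k::comm_ring_1" where
  "word_unit w = (if w = [] then 1 else 0)"

lemma convolve_Nil [simp]: "convolve F G [] = F [] * G []"
  by (simp add: convolve_def)

lemma convolve_Cons: "convolve F G (a # w) = F [] * G (a # w) + convolve (\<lambda>v. F (a # v)) G w"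
  by (simp add: convolve_def sum.atMost_Suc_shift del: sum.atMost_Suc)

lemma convolve_add_left: "convolve (\<lambda>v. F v + F' v) G w = convolve F G w + convolve F' G w"
  by (simp add: convolve_def algebra_simps sum.distrib)

lemma convolve_scale_left: "convolve (\<lambda>v. c * F v) G w = c * convolve F G w"
  by (simp add: convolve_def sum_distrib_left mult.assoc)

lemma convolve_assoc: "convolve (convolve F G) H = convolve F (convolve G H)"
proof
  show "convolve (convolve F G) H w = convolve F (convolve G H) w" for w
  proof (induction w arbitrary: F)
    case (Cons a w)
    show ?case
      by (simp add: convolve_Cons convolve_add_left convolve_scale_left Cons.IH algebra_simps)
  qed simp
qed

lemma convolve_zero_left: "convolve (\<lambda>v. 0) G w = 0"
  by (simp add: convolve_def)

lemma convolve_unit_left [simp]: "convolve word_unit G = G"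
proof
  show "convolve word_unit G w = G w" for w
    by (cases w) (simp_all add: convolve_Cons word_unit_def convolve_zero_left)
qed

lemma convolve_unit_right [simp]: "convolve F word_unit = F"
proof
  show "convolve F word_unit w = F w" for w
    by (induction w arbitrary: F) (simp_all add: convolve_Cons word_unit_def)
qed

text \<open>
  Reversing words, with the sign of their length, is an antiautomorphism of power series.
\<close>

lemma convolve_reverse:
  "convolve (\<lambda>v. (- 1) ^ length v * G (rev v)) (\<lambda>v. (- 1) ^ length v * F (rev v)) w
     = (- 1) ^ length w * convolve F G (rev w)"
proof -
  have "convolve F G (rev w) = (\<Sum>i\<le>length w. F (rev (drop i w)) * G (rev (take i w)))"
    unfolding convolve_def
    by (rule sum.reindex_bij_witness[of _ "\<lambda>i. length w - i" "\<lambda>i. length w - i"])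
       (auto simp: take_rev drop_rev)
  moreover have "((- 1) ^ i * G (rev (take i w))) * ((- 1) ^ (length w - i) * F (rev (drop i w))) =
      (- 1) ^ length w * (F (rev (drop i w)) * G (rev (take i w)))" if "i \<le> length w" for i
  proof -
    have "(- 1 :: 'a) ^ length w = (- 1) ^ i * (- 1) ^ (length w - i)"
      using that by (simp flip: power_add)
    then show ?thesis by (simp add: ac_simps)
  qed
  ultimately show ?thesis
    by (simp add: convolve_def sum_distrib_left min_absorb2)
qed

text \<open>
  The sum of \<open>F\<close> over all shuffles of two words. In contrast to a sum over the set \<open>shuffles u v\<close>,
  a word that arises from several shuffles is counted as often as it arises.
\<close>

fun shuffle_sum :: "('w list \<Rightarrow> 'k::comm_ring_1) \<Rightarrow> 'w list \<Rightarrow> 'w list \<Rightarrow> 'k" where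
  "shuffle_sum F [] v = F v"
| "shuffle_sum F (a # u) [] = F (a # u)"
| "shuffle_sum F (a # u) (b # v) =
     shuffle_sum (\<lambda>w. F (a # w)) u (b # v) + shuffle_sum (\<lambda>w. F (b # w)) (a # u) v"

lemma shuffle_sum_Nil2 [simp]: "shuffle_sum F u [] = F u"
  by (cases u) auto

lemma shuffle_sum_add: "shuffle_sum (\<lambda>w. F w + G w) u v = shuffle_sum F u v + shuffle_sum G u v"
proof (induction F u v arbitrary: G rule: shuffle_sum.induct)
  case (3 F a u b v)
  then show ?case by (simp only: shuffle_sum.simps add.assoc add.left_commute)
qed simp_all

lemma shuffle_sum_scale: "shuffle_sum (\<lambda>w. c * F w) u v = c * shuffle_sum F u v"
  by (induction F u v rule: shuffle_sum.induct) (simp_all add: distrib_left)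

text \<open>
  Cutting a shuffle of \<open>u\<close> and \<open>v\<close> into two pieces cuts both \<open>u\<close> and \<open>v\<close>, and each piece is a
  shuffle of the corresponding pieces of \<open>u\<close> and \<open>v\<close>. In other words, deconcatenation is
  multiplicative for the shuffle product.
\<close>

lemma shuffle_sum_convolve:
  "shuffle_sum (convolve F G) u v = (\<Sum>i\<le>length u. \<Sum>j\<le>length v.
     shuffle_sum F (take i u) (take j v) * shuffle_sum G (drop i u) (drop j v))"
proof (induction F u v rule: shuffle_sum.induct)
  case (3 F a u b v)
  let ?U = "a # u" and ?V = "b # v"
  let ?T = "\<lambda>F i j u v. shuffle_sum F (take i u) (take j v) * shuffle_sum G (drop i u) (drop j v)"
  have "shuffle_sum (convolve F G) ?U ?V = F [] * shuffle_sum G ?U ?V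
      + (\<Sum>i\<le>length u. \<Sum>j\<le>length ?V. ?T (\<lambda>w. F (a # w)) i j u ?V)
      + (\<Sum>i\<le>length ?U. \<Sum>j\<le>length v. ?T (\<lambda>w. F (b # w)) i j ?U v)"
    by (simp only: shuffle_sum.simps convolve_Cons shuffle_sum_add shuffle_sum_scale 3 distrib_left)
       (simp add: algebra_simps)
  also have "\<dots> = (\<Sum>i\<le>length ?U. \<Sum>j\<le>length ?V. ?T F i j ?U ?V)"
    by (simp add: sum.atMost_Suc_shift sum.distrib algebra_simps del: sum.atMost_Suc)
  finally show ?case .
qed (simp_all add: convolve_def)

definition shuffle_character :: "('w list \<Rightarrow> 'k::comm_ring_1) \<Rightarrow> bool" where
  "shuffle_character F \<longleftrightarrow> F [] = 1 \<and> (\<forall>u v. shuffle_sum F u v = F u * F v)"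

lemma shuffle_character_unit: "shuffle_character (word_unit :: 'w list \<Rightarrow> 'k::comm_ring_1)"
proof -
  have "shuffle_sum (\<lambda>w. 0 :: 'k) u v = 0" for u v :: "'w list"
    using shuffle_sum_scale[of "0 :: 'k" "\<lambda>_. 0" u v] by simp
  then have "shuffle_sum word_unit u v = (word_unit u * word_unit v :: 'k)" for u v :: "'w list"
    by (cases u; cases v) (simp_all add: word_unit_def)
  then show ?thesis by (simp add: shuffle_character_def word_unit_def)
qed

lemma shuffle_character_convolve:
  assumes "shuffle_character F" "shuffle_character G"
  shows "shuffle_character (convolve F G)"
  using assms unfolding shuffle_character_def
  by (auto simp: shuffle_sum_convolve convolve_def sum_product ac_simps)

text \<open>
  The exponential of the series that takes the values \<open>a\<close> on words of length one and vanishes on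
  all others; this is the contribution of one edge to the iterated integrals.
\<close>

definition exp_word :: "('w \<Rightarrow> 'k::field_char_0) \<Rightarrow> 'w list \<Rightarrow> 'k" where
  "exp_word a w = (\<Prod>x\<leftarrow>w. a x) / fact (length w)"

text \<open>
  All \<open>(length u + length v) choose (length u)\<close> shuffles contain the same letters. An arbitrary
  weight \<open>h\<close> of the length is carried along because prefixing a letter shifts the length.
\<close>

lemma shuffle_sum_length_weight:
  "shuffle_sum (\<lambda>w. h (length w) * (\<Prod>x\<leftarrow>w. a x)) u v =
     of_nat ((length u + length v) choose length u) * h (length u + length v)
       * ((\<Prod>x\<leftarrow>u. a x) * (\<Prod>x\<leftarrow>v. a x))"
proof (induction u arbitrary: h v)
  case (Cons x u)
  note IHu = Cons.IH
  show ?case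
  proof (induction v arbitrary: h)
    case (Cons y v)
    have 1: "shuffle_sum (\<lambda>w. h (length (x # w)) * (\<Prod>z\<leftarrow>x # w. a z)) u (y # v) =
        a x * shuffle_sum (\<lambda>w. h (Suc (length w)) * (\<Prod>z\<leftarrow>w. a z)) u (y # v)"
      by (subst shuffle_sum_scale[symmetric]) (simp add: ac_simps)
    have 2: "shuffle_sum (\<lambda>w. h (length (y # w)) * (\<Prod>z\<leftarrow>y # w. a z)) (x # u) v =
        a y * shuffle_sum (\<lambda>w. h (Suc (length w)) * (\<Prod>z\<leftarrow>w. a z)) (x # u) v"
      by (subst shuffle_sum_scale[symmetric]) (simp add: ac_simps)
    show ?case
      unfolding shuffle_sum.simps 1 2 IHu[of "\<lambda>n. h (Suc n)"] Cons.IH[of "\<lambda>n. h (Suc n)"]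
      by (simp add: algebra_simps)
  qed simp
qed simp

text \<open>
  The binomial number of shuffles is cancelled by the factorials in the denominators.
\<close>

lemma shuffle_character_exp_word: "shuffle_character (exp_word a)"
proof -
  have "shuffle_sum (exp_word a) u v = exp_word a u * exp_word a v" for u v
  proof -
    have "shuffle_sum (exp_word a) u v =
        shuffle_sum (\<lambda>w. (1 / fact (length w)) * (\<Prod>x\<leftarrow>w. a x)) u v"
      by (simp add: exp_word_def[abs_def])
    also have "\<dots> = exp_word a u * exp_word a v"
      by (subst shuffle_sum_length_weight[of "\<lambda>n. 1 / fact n"])
         (simp add: exp_word_def binomial_fact field_simps)
    finally show ?thesis .
  qed
  then show ?thesis by (simp add: shuffle_character_def exp_word_def)
qed

lemma exp_word_uminus: "exp_word (\<lambda>x. - a x) w = (- 1) ^ length w * exp_word a (rev w)"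
proof -
  have "(\<Prod>x\<leftarrow>w. - a x) = (- 1) ^ length w * (\<Prod>x\<leftarrow>w. a x)"
    by (induction w) auto
  moreover have "(\<Prod>x\<leftarrow>rev w. a x) = (\<Prod>x\<leftarrow>w. a x)"
    by (induction w) auto
  ultimately show ?thesis by (simp add: exp_word_def)
qed

text \<open>
  The coefficient at a nonempty word is a multiple of the alternating sum of binomial coefficients.
\<close>

lemma convolve_exp_word_inverse: "convolve (exp_word (\<lambda>x. - a x)) (exp_word a) = word_unit"
proof
  fix w
  have "exp_word (\<lambda>x. - a x) (take i w) * exp_word a (drop i w) =
      (\<Prod>x\<leftarrow>w. a x) / fact (length w) * ((- 1) ^ i * of_nat (length w choose i))"
    if "i \<le> length w" for i
  proof -
    have "(\<Prod>x\<leftarrow>w. a x) = (\<Prod>x\<leftarrow>take i w. a x) * (\<Prod>x\<leftarrow>drop i w. a x)"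
      by (metis append_take_drop_id map_append prod_list.append)
    moreover have "(\<Prod>x\<leftarrow>take i w. - a x) = (- 1) ^ i * (\<Prod>x\<leftarrow>take i w. a x)"
      using that by (induction w arbitrary: i) (auto simp: take_Cons split: nat.splits)
    ultimately show ?thesis
      using that by (simp add: exp_word_def binomial_fact min_absorb2 field_simps)
  qed
  then have "convolve (exp_word (\<lambda>x. - a x)) (exp_word a) w =
      (\<Prod>x\<leftarrow>w. a x) / fact (length w) * (\<Sum>i\<le>length w. (- 1) ^ i * of_nat (length w choose i))"
    by (simp add: convolve_def sum_distrib_left)
  also have "\<dots> = word_unit w"
    using choose_alternating_sum[of "length w", where ?'a = 'b] by (auto simp: word_unit_def)
  finally show "convolve (exp_word (\<lambda>x. - a x)) (exp_word a) w = word_unit w" .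
qed

text \<open>
  The ordered product of the exponentials of the edges of a path, a discrete version of parallel
  transport.
\<close>

fun transport :: "('w \<Rightarrow> 'k::field_char_0) list \<Rightarrow> 'w list \<Rightarrow> 'k" where
  "transport [] = word_unit"
| "transport (a # as) = convolve (exp_word a) (transport as)"

lemma transport_append: "transport (as @ bs) = convolve (transport as) (transport bs)"
  by (induction as) (auto simp: convolve_assoc)

lemma shuffle_character_transport: "shuffle_character (transport as)"
  by (induction as)
     (simp_all add: shuffle_character_unit shuffle_character_convolve shuffle_character_exp_word)

definition reverse_edges :: "('w \<Rightarrow> 'k::field_char_0) list \<Rightarrow> ('w \<Rightarrow> 'k) list" where
  "reverse_edges as = rev (map (\<lambda>a x. - a x) as)"

lemma reverse_edges_involution [simp]: "reverse_edges (reverse_edges as) = as"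
  by (simp add: reverse_edges_def rev_map o_def)

lemma transport_reverse_edges: "transport (reverse_edges as) w = (- 1) ^ length w * transport as (rev w)"
proof (induction as arbitrary: w)
  case Nil
  then show ?case by (simp add: reverse_edges_def word_unit_def)
next
  case (Cons a as)
  have "transport (reverse_edges (a # as)) w =
      convolve (transport (reverse_edges as)) (exp_word (\<lambda>x. - a x)) w"
    by (simp add: reverse_edges_def transport_append)
  also have "\<dots> = convolve (\<lambda>v. (- 1) ^ length v * transport as (rev v))
      (\<lambda>v. (- 1) ^ length v * exp_word a (rev v)) w"
    using Cons.IH by (simp add: convolve_def exp_word_uminus)
  also have "\<dots> = (- 1) ^ length w * transport (a # as) (rev w)"
    by (simp add: convolve_reverse)
  finally show ?case .
qed

lemma transport_reverse_cancel: "transport (reverse_edges as @ as) = word_unit"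
proof (induction as)
  case (Cons a as)
  have "reverse_edges (a # as) @ a # as = reverse_edges as @ [\<lambda>x. - a x] @ [a] @ as"
    by (simp add: reverse_edges_def)
  then have "transport (reverse_edges (a # as) @ a # as) =
      convolve (transport (reverse_edges as)) (convolve (convolve (exp_word (\<lambda>x. - a x)) (exp_word a)) (transport as))"
    by (simp add: transport_append convolve_assoc)
  also have "\<dots> = word_unit"
    using Cons.IH by (simp add: convolve_exp_word_inverse transport_append)
  finally show ?case .
qed (simp add: reverse_edges_def)

lemma transport_cancel_reverse: "transport (as @ reverse_edges as) = word_unit"
  using transport_reverse_cancel[of "reverse_edges as"] by simp

definition sorted_indices :: "nat \<Rightarrow> nat \<Rightarrow> nat list set" where
  "sorted_indices n r = {ts. length ts = r \<and> sorted ts \<and> set ts \<subseteq> {1..n}}"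

lemma finite_sorted_indices: "finite (sorted_indices n r)"
  by (rule finite_subset[OF _ finite_lists_length_eq[of "{1..n}" r]]) (auto simp: sorted_indices_def)

lemma sorted_append_replicate_Max:
  assumes "sorted ts" "set ts \<subseteq> {1..Suc n}"
  shows "ts = filter (\<lambda>t. t \<le> n) ts @ replicate (length ts - length (filter (\<lambda>t. t \<le> n) ts)) (Suc n)"
  using assms
proof (induction ts)
  case (Cons t ts)
  show ?case
  proof (cases "t \<le> n")
    case True
    with Cons show ?thesis by simp
  next
    case False
    with Cons.prems have "\<forall>s\<in>set (t # ts). s = Suc n" by fastforce
    then have "t # ts = replicate (length (t # ts)) (Suc n)"
      by (metis replicate_length_same)
    moreover have "filter (\<lambda>t. t \<le> n) (t # ts) = []"
      using \<open>\<forall>s\<in>set (t # ts). s = Suc n\<close> by (auto simp: filter_empty_conv)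
    ultimately show ?thesis by simp
  qed
qed simp

lemma count_list_replicate: "count_list (replicate m x) x = m"
  by (induction m) auto

text \<open>
  A nondecreasing tuple of indices at most \<open>n + 1\<close> consists of a tuple of indices at most \<open>n\<close> followed
  by a block of entries \<open>n + 1\<close>. The number of entries in this block determines where the word is cut, and
  the factorial of their number is the denominator in the exponential of the last edge.
\<close>

lemma sum_sorted_indices_eq_transport:
  fixes p :: "nat \<Rightarrow> 'w \<Rightarrow> 'k::field_char_0"
  shows "(\<Sum>ts\<in>sorted_indices n (length w).
      (\<Prod>i<length w. p (ts ! i) (w ! i)) / (\<Prod>k\<in>set ts. fact (count_list ts k)))
    = transport (map p [1..<Suc n]) w"
proof (induction n arbitrary: w)
  case 0
  have "sorted_indices 0 (length w) = (if w = [] then {[]} else {})"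
    by (auto simp: sorted_indices_def)
  then show ?case by (simp add: word_unit_def)
next
  case (Suc n)
  define T where "T ts w = (\<Prod>i<length w. p (ts ! i) (w ! i)) / (\<Prod>k\<in>set ts. fact (count_list ts k))"
    for ts w
  have T: "T ts w = prod_list (map2 p ts w) / (\<Prod>k\<in>set ts. fact (count_list ts k))"
    if "length ts = length w" for ts w
    using that by (simp add: T_def prod.list_conv_set_nth atLeast0LessThan)
  have T_split: "T (ts @ replicate (length w - i) (Suc n)) w =
      T ts (take i w) * exp_word (p (Suc n)) (drop i w)"
    if i: "i \<le> length w" and ts: "ts \<in> sorted_indices n i" for i ts
  proof -
    let ?r = "replicate (length w - i) (Suc n)"
    have len: "length ts = i" and notin: "Suc n \<notin> set ts"
      using ts by (auto simp: sorted_indices_def)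
    have "map2 p (ts @ ?r) w = map2 p (ts @ ?r) (take i w @ drop i w)" by simp
    also have "\<dots> = map2 p ts (take i w) @ map (p (Suc n)) (drop i w)"
      using i len by (subst zip_append) (simp_all add: zip_replicate1)
    finally have 1: "prod_list (map2 p (ts @ ?r) w) =
        prod_list (map2 p ts (take i w)) * (\<Prod>x\<leftarrow>drop i w. p (Suc n) x)" by simp
    have count: "count_list (ts @ ?r) k = count_list ts k" if "k \<in> set ts" for k
      using that notin by (auto simp: count_list_0_iff)
    have "(\<Prod>k\<in>set (ts @ ?r). fact (count_list (ts @ ?r) k)) =
        (\<Prod>k\<in>set ts. fact (count_list ts k)) * (fact (length w - i) :: 'k)"
    proof (cases "i = length w")
      case False
      then have "set (ts @ ?r) = insert (Suc n) (set ts)" using i by auto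
      moreover have "count_list (ts @ ?r) (Suc n) = length w - i"
        using notin by (simp add: count_list_0_iff count_list_replicate)
      ultimately show ?thesis using notin count by (simp add: mult.commute)
    qed simp
    with 1 i len show ?thesis by (simp add: T exp_word_def)
  qed
  have "(\<Sum>ts\<in>sorted_indices (Suc n) (length w). T ts w) =
      (\<Sum>(i, ts)\<in>(SIGMA i:{..length w}. sorted_indices n i).
         T (ts @ replicate (length w - i) (Suc n)) w)"
  proof (rule sum.reindex_bij_witness[of _
        "\<lambda>(i, ts). ts @ replicate (length w - i) (Suc n)"
        "\<lambda>ts. (length (filter (\<lambda>t. t \<le> n) ts), filter (\<lambda>t. t \<le> n) ts)"])
    fix ts assume ts: "ts \<in> sorted_indices (Suc n) (length w)"
    then have sts: "sorted ts" "set ts \<subseteq> {1..Suc n}" "length ts = length w"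
      by (auto simp: sorted_indices_def)
    show "(case (length (filter (\<lambda>t. t \<le> n) ts), filter (\<lambda>t. t \<le> n) ts) of
        (i, ts) \<Rightarrow> ts @ replicate (length w - i) (Suc n)) = ts"
      using sorted_append_replicate_Max[OF sts(1,2)] sts(3) by simp
    then show "(case (length (filter (\<lambda>t. t \<le> n) ts), filter (\<lambda>t. t \<le> n) ts) of
        (i, ts) \<Rightarrow> T (ts @ replicate (length w - i) (Suc n)) w) = T ts w"
      by simp
    show "(length (filter (\<lambda>t. t \<le> n) ts), filter (\<lambda>t. t \<le> n) ts)
        \<in> (SIGMA i:{..length w}. sorted_indices n i)"
      using sts by (auto simp: sorted_indices_def intro: sorted_filter[where f = id, simplified]
          order.trans[OF length_filter_le])
  next
    fix its assume "its \<in> (SIGMA i:{..length w}. sorted_indices n i)"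
    then obtain i ts where its: "its = (i, ts)" "i \<le> length w" "length ts = i" "sorted ts"
        "set ts \<subseteq> {1..n}"
      by (auto simp: sorted_indices_def)
    then have "filter (\<lambda>t. t \<le> n) ts = ts" by (auto intro!: filter_True)
    with its show "(length (filter (\<lambda>t. t \<le> n) (case its of (i, ts) \<Rightarrow> ts @ replicate (length w - i) (Suc n))),
        filter (\<lambda>t. t \<le> n) (case its of (i, ts) \<Rightarrow> ts @ replicate (length w - i) (Suc n))) = its"
      by simp
    show "(case its of (i, ts) \<Rightarrow> ts @ replicate (length w - i) (Suc n))
        \<in> sorted_indices (Suc n) (length w)"
      using its by (auto simp: sorted_indices_def sorted_append)
  qed
  also have "\<dots> = (\<Sum>i\<le>length w. \<Sum>ts\<in>sorted_indices n i.
      T (ts @ replicate (length w - i) (Suc n)) w)"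
    by (rule sum.Sigma[symmetric]) (auto simp: finite_sorted_indices)
  also have "\<dots> = (\<Sum>i\<le>length w. (\<Sum>ts\<in>sorted_indices n i. T ts (take i w))
      * exp_word (p (Suc n)) (drop i w))"
    by (intro sum.cong refl) (simp add: T_split sum_distrib_right)
  also have "\<dots> = convolve (transport (map p [1..<Suc n])) (exp_word (p (Suc n))) w"
    unfolding convolve_def
  proof (intro sum.cong refl arg_cong2[where f = "(*)"])
    fix i assume "i \<in> {..length w}"
    then show "(\<Sum>ts\<in>sorted_indices n i. T ts (take i w)) = transport (map p [1..<Suc n]) (take i w)"
      using Suc.IH[of "take i w"] by (simp add: T_def min_absorb2)
  qed
  also have "\<dots> = transport (map p [1..<Suc (Suc n)]) w"
    by (simp add: transport_append)
  finally show ?case by (simp add: T_def)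
qed

text \<open>
  For distinct letters all shuffles differ, so the set of shuffles loses no multiplicities. Words with
  repeated letters are obtained by relabelling with \<open>f\<close>.
\<close>

lemma sum_shuffles_eq_shuffle_sum:
  assumes "distinct xs" "distinct ys" "set xs \<inter> set ys = {}"
  shows "(\<Sum>l\<in>shuffles xs ys. F (map f l)) = shuffle_sum F (map f xs) (map f ys)"
  using assms
proof (induction xs ys arbitrary: F rule: shuffles.induct)
  case (3 x xs y ys)
  have "(\<Sum>l\<in>shuffles (x # xs) (y # ys). F (map f l)) =
      (\<Sum>l\<in>(#) x ` shuffles xs (y # ys). F (map f l)) + (\<Sum>l\<in>(#) y ` shuffles (x # xs) ys. F (map f l))"
    using 3 by (subst shuffles.simps, intro sum.union_disjoint) auto
  also have "\<dots> = (\<Sum>l\<in>shuffles xs (y # ys). F (f x # map f l)) + (\<Sum>l\<in>shuffles (x # xs) ys. F (f y # map f l))"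
    by (simp add: sum.reindex)
  also have "\<dots> = shuffle_sum F (map f (x # xs)) (map f (y # ys))"
    using 3 "3.IH"(1)[of "\<lambda>w. F (f x # w)"] "3.IH"(2)[of "\<lambda>w. F (f y # w)"] by simp
  finally show ?case .
qed simp_all

lemma sorted_wrt_filter_iff:
  "sorted_wrt R (filter P l) \<longleftrightarrow> sorted_wrt (\<lambda>x y. P x \<longrightarrow> P y \<longrightarrow> R x y) l"
  by (induction l) auto

text \<open>
  A permutation \<open>\<sigma>\<close> is identified with the list of its values. Its inverse gives the positions of
  the letters, so monotonicity of the inverse on \<open>{..<r}\<close> says that the letters below \<open>r\<close>
  occur in the list in increasing order, and similarly for the letters from \<open>r\<close> on.
\<close>

lemma bij_betw_shuffle_permutations:
  "bij_betw (\<lambda>\<sigma>. map \<sigma> [0..<r + s]) (shuffle_permutations r s) (shuffles [0..<r] [r..<r + s])"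
proof (rule bij_betwI')
  fix \<sigma> \<tau> assume "\<sigma> \<in> shuffle_permutations r s" "\<tau> \<in> shuffle_permutations r s"
  then have perm: "\<sigma> permutes {..<r + s}" "\<tau> permutes {..<r + s}"
    by (auto simp: shuffle_permutations_def)
  show "(map \<sigma> [0..<r + s] = map \<tau> [0..<r + s]) \<longleftrightarrow> \<sigma> = \<tau>"
  proof
    assume eq: "map \<sigma> [0..<r + s] = map \<tau> [0..<r + s]"
    show "\<sigma> = \<tau>"
    proof
      fix i show "\<sigma> i = \<tau> i"
        using eq perm by (cases "i < r + s") (auto simp: permutes_def)
    qed
  qed simp
next
  fix \<sigma> assume "\<sigma> \<in> shuffle_permutations r s"
  then have perm: "\<sigma> permutes {..<r + s}" and mono: "strict_mono_on {..<r} (inv_into UNIV \<sigma>)"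
      "strict_mono_on {r..<r + s} (inv_into UNIV \<sigma>)"
    by (auto simp: shuffle_permutations_def)
  let ?l = "map \<sigma> [0..<r + s]"
  have l_set: "set ?l = {..<r + s}"
    using permutes_image[OF perm] by (simp add: atLeast0LessThan)
  have l_sorted: "sorted_wrt (<) (filter P ?l)"
    if "strict_mono_on S (inv_into UNIV \<sigma>)" "\<And>i. i < r + s \<Longrightarrow> P i \<Longrightarrow> i \<in> S" for P S
    unfolding sorted_wrt_filter_iff unfolding sorted_wrt_iff_nth_less
  proof (intro allI impI)
    fix i j assume "i < j" "j < length ?l" "P (?l ! i)" "P (?l ! j)"
    then have ij: "i < j" "i < r + s" "j < r + s" "P (\<sigma> i)" "P (\<sigma> j)" by auto
    then have in_S: "\<sigma> i \<in> S" "\<sigma> j \<in> S"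
      using that(2) permutes_in_image[OF perm] by auto
    have "\<not> \<sigma> j \<le> \<sigma> i"
    proof
      assume "\<sigma> j \<le> \<sigma> i"
      then have "inv_into UNIV \<sigma> (\<sigma> j) \<le> inv_into UNIV \<sigma> (\<sigma> i)"
        using strict_mono_on_leD[OF that(1)] in_S by blast
      then show False using ij permutes_inverses[OF perm] by simp
    qed
    then show "?l ! i < ?l ! j" using ij by simp
  qed
  have 1: "filter (\<lambda>i. i < r) ?l = [0..<r]"
    by (rule strict_sorted_equal)
       (use l_sorted[OF mono(1), of "\<lambda>i. i < r"] l_set in auto)
  have 2: "filter (\<lambda>i. \<not> i < r) ?l = [r..<r + s]"
    by (rule strict_sorted_equal)
       (use l_sorted[OF mono(2), of "\<lambda>i. \<not> i < r"] l_set in auto)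
  show "?l \<in> shuffles [0..<r] [r..<r + s]"
    using partition_in_shuffles[of ?l "\<lambda>i. i < r"] unfolding 1 2 .
next
  fix l assume l: "l \<in> shuffles [0..<r] [r..<r + s]"
  have len: "length l = r + s" and l_set: "set l = {..<r + s}" and l_dist: "distinct l"
    using length_shuffles[OF l] set_shuffles[OF l]
    by (simp, fastforce, intro distinct_disjoint_shuffles[OF _ _ _ l]) auto
  have filter_eq: "filter (\<lambda>i. i < r) l = [0..<r]" "filter (\<lambda>i. \<not> i < r) l = [r..<r + s]"
  proof -
    have *: "set [0..<r] \<inter> set [r..<r + s] = {}" by auto
    have "filter (\<lambda>i. i < r) l = filter (\<lambda>i. i \<in> set [0..<r]) l"
      by (intro filter_cong) auto
    then show "filter (\<lambda>i. i < r) l = [0..<r]"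
      using filter_shuffles_disjoint1(1)[OF * l] by simp
    have "filter (\<lambda>i. \<not> i < r) l = filter (\<lambda>i. i \<notin> set [0..<r]) l"
      by (intro filter_cong) auto
    then show "filter (\<lambda>i. \<not> i < r) l = [r..<r + s]"
      using filter_shuffles_disjoint1(2)[OF * l] by simp
  qed
  define \<sigma> where "\<sigma> i = (if i < r + s then l ! i else i)" for i
  have "bij_betw \<sigma> {..<r + s} {..<r + s}"
  proof -
    have "bij_betw ((!) l) {..<r + s} {..<r + s}"
      by (rule bij_betw_nth) (simp_all add: l_dist len l_set)
    then show ?thesis by (subst bij_betw_cong[where g = "(!) l"]) (simp_all add: \<sigma>_def)
  qed
  then have perm: "\<sigma> permutes {..<r + s}"
    by (rule bij_imp_permutes) (auto simp: \<sigma>_def)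
  have map_eq: "map \<sigma> [0..<r + s] = l"
    by (rule nth_equalityI) (auto simp: len \<sigma>_def)
  have mono: "strict_mono_on S (inv_into UNIV \<sigma>)"
    if "sorted_wrt (<) (filter P l)" "\<And>i. i \<in> S \<Longrightarrow> i < r + s \<and> P i" for P S
  proof (rule strict_mono_onI)
    fix a b assume ab: "a \<in> S" "b \<in> S" "a < b"
    let ?i = "inv_into UNIV \<sigma> a" and ?j = "inv_into UNIV \<sigma> b"
    have ij: "?i < r + s" "?j < r + s" "\<sigma> ?i = a" "\<sigma> ?j = b"
      using that(2) ab permutes_in_image[OF permutes_inv[OF perm]] permutes_inverses[OF perm] by auto
    then have l_ij: "l ! ?i = a" "l ! ?j = b" by (auto simp: \<sigma>_def)
    have "\<not> ?j < ?i"
    proof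
      assume "?j < ?i"
      then have "P (l ! ?j) \<longrightarrow> P (l ! ?i) \<longrightarrow> l ! ?j < l ! ?i"
        using that(1) ij len unfolding sorted_wrt_filter_iff unfolding sorted_wrt_iff_nth_less by auto
      then show False using that(2) ab l_ij by auto
    qed
    moreover have "?i \<noteq> ?j" using ij ab by auto
    ultimately show "?i < ?j" by simp
  qed
  have "\<sigma> \<in> shuffle_permutations r s"
    unfolding shuffle_permutations_def
    using perm mono[of "\<lambda>i. i < r" "{..<r}"] mono[of "\<lambda>i. \<not> i < r" "{r..<r + s}"]
    by (auto simp: filter_eq)
  with map_eq show "\<exists>\<sigma>\<in>shuffle_permutations r s. l = map \<sigma> [0..<r + s]" by auto
qed

lemma sum_shuffle_permutations:
  "(\<Sum>\<sigma>\<in>shuffle_permutations (length u) (length v). F (permute_word \<sigma> (u @ v))) = shuffle_sum F u v"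
proof -
  let ?r = "length u" and ?s = "length v"
  have "permute_word \<sigma> (u @ v) = map ((!) (u @ v)) (map \<sigma> [0..<?r + ?s])" for \<sigma>
    by (simp add: permute_word_def)
  then have "(\<Sum>\<sigma>\<in>shuffle_permutations ?r ?s. F (permute_word \<sigma> (u @ v))) =
      (\<Sum>l\<in>shuffles [0..<?r] [?r..<?r + ?s]. F (map ((!) (u @ v)) l))"
    using sum.reindex_bij_betw[OF bij_betw_shuffle_permutations,
        of "\<lambda>l. F (map ((!) (u @ v)) l)"] by simp
  also have "\<dots> = shuffle_sum F (map ((!) (u @ v)) [0..<?r]) (map ((!) (u @ v)) [?r..<?r + ?s])"
    by (rule sum_shuffles_eq_shuffle_sum) auto
  also have "map ((!) (u @ v)) [0..<?r] = u"
    by (rule nth_equalityI) (auto simp: nth_append)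
  also have "map ((!) (u @ v)) [?r..<?r + ?s] = v"
    by (rule nth_equalityI) (auto simp: nth_append)
  finally show ?thesis .
qed

section \<open>Concatenation, reversal and homotopy of path maps\<close>

definition path_concat :: "'v path_map \<Rightarrow> 'v path_map \<Rightarrow> 'v path_map" where
  "path_concat \<alpha> \<beta> = (let n = path_length \<alpha>; m = path_length \<beta> in
     \<lparr> path_length = n + m,
       path_line = \<lparr> pverts = {..n + m},
         parcs = {(i, j). (i, j) \<in> parcs (path_line \<alpha>) \<or>
           n \<le> i \<and> n \<le> j \<and> (i - n, j - n) \<in> parcs (path_line \<beta>)} \<rparr>,
       path_fun = (\<lambda>i\<in>{..n + m}. if i \<le> n then path_fun \<alpha> i else path_fun \<beta> (i - n)) \<rparr>)"

definition path_reverse :: "'v path_map \<Rightarrow> 'v path_map" where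
  "path_reverse \<alpha> = (let n = path_length \<alpha> in
     \<lparr> path_length = n,
       path_line = \<lparr> pverts = {..n},
         parcs = {(i, j). i \<le> n \<and> j \<le> n \<and> (n - i, n - j) \<in> parcs (path_line \<alpha>)} \<rparr>,
       path_fun = (\<lambda>i\<in>{..n}. path_fun \<alpha> (n - i)) \<rparr>)"

lemma digraph_map_arc:
  "\<lbrakk>digraph_map G H f; (u, v) \<in> parcs G\<rbrakk> \<Longrightarrow> f u = f v \<or> (f u, f v) \<in> parcs H"
  unfolding digraph_map_def by blast

lemma line_digraph_arc:
  assumes "line_digraph n I" "(i, j) \<in> parcs I"
  shows "i \<le> n" "j \<le> n" "j = Suc i \<or> i = Suc j"
  using assms unfolding line_digraph_def by force+

lemma line_digraphI:
  assumes "pverts I = {..n}"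
    and adjacent: "\<And>i j. (i, j) \<in> parcs I \<Longrightarrow> i \<le> n \<and> j \<le> n \<and> (j = Suc i \<or> i = Suc j)"
    and "\<And>i. i < n \<Longrightarrow> ((i, Suc i) \<in> parcs I) \<noteq> ((Suc i, i) \<in> parcs I)"
  shows "line_digraph n I"
proof -
  have "parcs I \<subseteq> (\<Union>i<n. {(i, Suc i), (Suc i, i)})"
  proof clarify
    fix i j assume "(i, j) \<in> parcs I"
    from adjacent[OF this] show "(i, j) \<in> (\<Union>i<n. {(i, Suc i), (Suc i, i)})"
      by (intro UN_I[of "min i j"]) auto
  qed
  with assms(1,3) show ?thesis by (simp add: line_digraph_def)
qed

lemma line_digraph_opposite:
  assumes "line_digraph n I" "i < n"
  shows "(Suc i, i) \<in> parcs I \<longleftrightarrow> (i, Suc i) \<notin> parcs I"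
  using assms unfolding line_digraph_def by blast

lemma path_map_arc:
  assumes "\<alpha> \<in> path_maps G" "(i, j) \<in> parcs (path_line \<alpha>)"
  shows "path_fun \<alpha> i = path_fun \<alpha> j \<or> (path_fun \<alpha> i, path_fun \<alpha> j) \<in> parcs G"
  using assms unfolding path_maps_def digraph_map_def by blast

lemma path_map_vertex:
  assumes "\<alpha> \<in> path_maps G" "i \<le> path_length \<alpha>"
  shows "path_fun \<alpha> i \<in> pverts G"
  using assms unfolding path_maps_def digraph_map_def line_digraph_def by auto

lemma path_map_line: "\<alpha> \<in> path_maps G \<Longrightarrow> line_digraph (path_length \<alpha>) (path_line \<alpha>)"
  by (simp add: path_maps_def)

lemma path_map_pverts: "\<alpha> \<in> path_maps G \<Longrightarrow> pverts (path_line \<alpha>) = {..path_length \<alpha>}"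
  by (simp add: path_maps_def line_digraph_def)

lemma path_mapI:
  assumes "line_digraph (path_length \<alpha>) (path_line \<alpha>)"
    and "\<And>i. i \<le> path_length \<alpha> \<Longrightarrow> path_fun \<alpha> i \<in> pverts G"
    and "\<And>i j. (i, j) \<in> parcs (path_line \<alpha>) \<Longrightarrow>
       path_fun \<alpha> i = path_fun \<alpha> j \<or> (path_fun \<alpha> i, path_fun \<alpha> j) \<in> parcs G"
    and "path_fun \<alpha> \<in> extensional {..path_length \<alpha>}"
  shows "\<alpha> \<in> path_maps G"
  using assms unfolding path_maps_def digraph_map_def by (auto simp: line_digraph_def)

lemma path_concat_simps:
  "path_length (path_concat \<alpha> \<beta>) = path_length \<alpha> + path_length \<beta>"
  "pverts (path_line (path_concat \<alpha> \<beta>)) = {..path_length \<alpha> + path_length \<beta>}"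
  "(i, j) \<in> parcs (path_line (path_concat \<alpha> \<beta>)) \<longleftrightarrow> (i, j) \<in> parcs (path_line \<alpha>) \<or>
     path_length \<alpha> \<le> i \<and> path_length \<alpha> \<le> j \<and>
     (i - path_length \<alpha>, j - path_length \<alpha>) \<in> parcs (path_line \<beta>)"
  by (auto simp: path_concat_def Let_def)

lemma path_concat_fun_left: "i \<le> path_length \<alpha> \<Longrightarrow> path_fun (path_concat \<alpha> \<beta>) i = path_fun \<alpha> i"
  by (simp add: path_concat_def Let_def)

lemma path_concat_fun_right:
  "\<lbrakk>path_end \<alpha> = path_start \<beta>; j \<le> path_length \<beta>\<rbrakk> \<Longrightarrow>
    path_fun (path_concat \<alpha> \<beta>) (path_length \<alpha> + j) = path_fun \<beta> j"
  by (auto simp: path_concat_def Let_def path_end_def path_start_def)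

lemma path_concat_fun_right':
  "\<lbrakk>path_end \<alpha> = path_start \<beta>; path_length \<alpha> \<le> i; i \<le> path_length \<alpha> + path_length \<beta>\<rbrakk> \<Longrightarrow>
    path_fun (path_concat \<alpha> \<beta>) i = path_fun \<beta> (i - path_length \<alpha>)"
  using path_concat_fun_right[of \<alpha> \<beta> "i - path_length \<alpha>"] by simp

lemma path_start_concat [simp]: "path_start (path_concat \<alpha> \<beta>) = path_start \<alpha>"
  by (simp add: path_start_def path_concat_fun_left)

lemma path_end_concat:
  "path_end \<alpha> = path_start \<beta> \<Longrightarrow> path_end (path_concat \<alpha> \<beta>) = path_end \<beta>"
  by (simp add: path_end_def[of "path_concat \<alpha> \<beta>"] path_concat_simps path_concat_fun_right)
     (simp add: path_end_def)

lemma line_digraph_concat: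
  assumes I: "line_digraph n I" and J: "line_digraph m J"
    and "pverts K = {..n + m}"
    and K: "\<And>i j. (i, j) \<in> parcs K \<longleftrightarrow> (i, j) \<in> parcs I \<or> n \<le> i \<and> n \<le> j \<and> (i - n, j - n) \<in> parcs J"
  shows "line_digraph (n + m) K"
proof (rule line_digraphI)
  show "i \<le> n + m \<and> j \<le> n + m \<and> (j = Suc i \<or> i = Suc j)" if "(i, j) \<in> parcs K" for i j
    using that[unfolded K] line_digraph_arc[OF I, of i j] line_digraph_arc[OF J, of "i - n" "j - n"]
    by auto
  show "((i, Suc i) \<in> parcs K) \<noteq> ((Suc i, i) \<in> parcs K)" if "i < n + m" for i
  proof (cases "i < n")
    case True
    then show ?thesis using line_digraph_opposite[OF I] by (auto simp: K)
  next
    case False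
    then have "(i, Suc i) \<notin> parcs I" "(Suc i, i) \<notin> parcs I"
      using line_digraph_arc[OF I] by fastforce+
    with False show ?thesis
      using line_digraph_opposite[OF J, of "i - n"] that by (auto simp: K Suc_diff_le)
  qed
qed fact

lemma path_concat_closed:
  assumes \<alpha>: "\<alpha> \<in> path_maps G" and \<beta>: "\<beta> \<in> path_maps G" and ends: "path_end \<alpha> = path_start \<beta>"
  shows "path_concat \<alpha> \<beta> \<in> path_maps G"
proof (rule path_mapI)
  let ?n = "path_length \<alpha>" and ?m = "path_length \<beta>"
  note lines = path_map_line[OF \<alpha>] path_map_line[OF \<beta>]
  show "line_digraph (path_length (path_concat \<alpha> \<beta>)) (path_line (path_concat \<alpha> \<beta>))"
    using line_digraph_concat[OF lines] by (simp add: path_concat_simps)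
  fix i
  show "path_fun (path_concat \<alpha> \<beta>) i \<in> pverts G" if "i \<le> path_length (path_concat \<alpha> \<beta>)"
    using that path_map_vertex[OF \<alpha>, of i] path_map_vertex[OF \<beta>, of "i - ?n"]
    by (cases "i \<le> ?n") (auto simp: path_concat_simps path_concat_fun_left path_concat_fun_right'[OF ends])
  fix j assume "(i, j) \<in> parcs (path_line (path_concat \<alpha> \<beta>))"
  then consider "(i, j) \<in> parcs (path_line \<alpha>)"
    | "?n \<le> i" "?n \<le> j" "(i - ?n, j - ?n) \<in> parcs (path_line \<beta>)"
    by (auto simp: path_concat_simps)
  then show "path_fun (path_concat \<alpha> \<beta>) i = path_fun (path_concat \<alpha> \<beta>) j \<or>
      (path_fun (path_concat \<alpha> \<beta>) i, path_fun (path_concat \<alpha> \<beta>) j) \<in> parcs G"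
  proof cases
    case 1
    with line_digraph_arc[OF lines(1) 1] path_map_arc[OF \<alpha> 1] show ?thesis
      by (simp add: path_concat_fun_left)
  next
    case 2
    with line_digraph_arc[OF lines(2) 2(3)] path_map_arc[OF \<beta> 2(3)] show ?thesis
      by (simp add: path_concat_fun_right'[OF ends])
  qed
next
  show "path_fun (path_concat \<alpha> \<beta>) \<in> extensional {..path_length (path_concat \<alpha> \<beta>)}"
    by (simp add: path_concat_def Let_def)
qed

lemma path_reverse_simps:
  "path_length (path_reverse \<alpha>) = path_length \<alpha>"
  "pverts (path_line (path_reverse \<alpha>)) = {..path_length \<alpha>}"
  "(i, j) \<in> parcs (path_line (path_reverse \<alpha>)) \<longleftrightarrow> i \<le> path_length \<alpha> \<and> j \<le> path_length \<alpha> \<and>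
     (path_length \<alpha> - i, path_length \<alpha> - j) \<in> parcs (path_line \<alpha>)"
  by (auto simp: path_reverse_def Let_def)

lemma path_reverse_fun:
  "i \<le> path_length \<alpha> \<Longrightarrow> path_fun (path_reverse \<alpha>) i = path_fun \<alpha> (path_length \<alpha> - i)"
  by (simp add: path_reverse_def Let_def)

lemma path_reverse_ends [simp]:
  "path_start (path_reverse \<alpha>) = path_end \<alpha>" "path_end (path_reverse \<alpha>) = path_start \<alpha>"
  by (simp_all add: path_start_def path_end_def path_reverse_fun path_reverse_simps)

lemma line_digraph_reverse:
  assumes I: "line_digraph n I" and "pverts K = {..n}"
    and K: "\<And>i j. (i, j) \<in> parcs K \<longleftrightarrow> i \<le> n \<and> j \<le> n \<and> (n - i, n - j) \<in> parcs I"
  shows "line_digraph n K"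
proof (rule line_digraphI)
  show "i \<le> n \<and> j \<le> n \<and> (j = Suc i \<or> i = Suc j)" if "(i, j) \<in> parcs K" for i j
    using that[unfolded K] line_digraph_arc(3)[OF I, of "n - i" "n - j"] by auto
  show "((i, Suc i) \<in> parcs K) \<noteq> ((Suc i, i) \<in> parcs K)" if "i < n" for i
    using line_digraph_opposite[OF I, of "n - Suc i"] that by (auto simp: K Suc_diff_Suc)
qed fact

lemma path_reverse_closed:
  assumes \<alpha>: "\<alpha> \<in> path_maps G"
  shows "path_reverse \<alpha> \<in> path_maps G"
proof (rule path_mapI)
  show "line_digraph (path_length (path_reverse \<alpha>)) (path_line (path_reverse \<alpha>))"
    using line_digraph_reverse[OF path_map_line[OF \<alpha>]] by (simp add: path_reverse_simps)
  fix i
  show "path_fun (path_reverse \<alpha>) i \<in> pverts G" if "i \<le> path_length (path_reverse \<alpha>)"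
    using that path_map_vertex[OF \<alpha>, of "path_length \<alpha> - i"]
    by (simp add: path_reverse_simps path_reverse_fun)
  fix j assume "(i, j) \<in> parcs (path_line (path_reverse \<alpha>))"
  then have ij: "i \<le> path_length \<alpha>" "j \<le> path_length \<alpha>"
    "(path_length \<alpha> - i, path_length \<alpha> - j) \<in> parcs (path_line \<alpha>)"
    by (auto simp: path_reverse_simps)
  from path_map_arc[OF \<alpha> ij(3)] ij(1,2)
  show "path_fun (path_reverse \<alpha>) i = path_fun (path_reverse \<alpha>) j \<or>
      (path_fun (path_reverse \<alpha>) i, path_fun (path_reverse \<alpha>) j) \<in> parcs G"
    by (simp add: path_reverse_fun)
next
  show "path_fun (path_reverse \<alpha>) \<in> extensional {..path_length (path_reverse \<alpha>)}"
    by (simp add: path_reverse_def Let_def)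
qed

lemma path_concat_loops: "\<lbrakk>\<alpha> \<in> loops G x; \<beta> \<in> loops G x\<rbrakk> \<Longrightarrow> path_concat \<alpha> \<beta> \<in> loops G x"
  by (simp add: loops_def path_concat_closed path_end_concat)

lemma path_reverse_loops: "\<alpha> \<in> loops G x \<Longrightarrow> path_reverse \<alpha> \<in> loops G x"
  by (simp add: loops_def path_reverse_closed)

lemma constant_loop_loops: "x \<in> pverts G \<Longrightarrow> constant_loop x \<in> loops G x"
  by (auto simp: loops_def constant_loop_def path_maps_def path_start_def path_end_def
      line_digraph_def digraph_map_def)

lemma shrinking_map_le: "\<lbrakk>shrinking_map n I m J h; i \<le> n\<rbrakk> \<Longrightarrow> h i \<le> m"
  unfolding shrinking_map_def by auto

lemma shrinking_map_arc:
  "\<lbrakk>shrinking_map n I m J h; (i, j) \<in> parcs I\<rbrakk> \<Longrightarrow> h i = h j \<or> (h i, h j) \<in> parcs J"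
  unfolding shrinking_map_def digraph_map_def by blast

lemma shrinking_mapI:
  assumes "line_digraph n I" "line_digraph m J" "m \<le> n" "h 0 = 0" "h n = m"
    and mono: "\<And>i j. \<lbrakk>i \<le> j; j \<le> n\<rbrakk> \<Longrightarrow> h i \<le> h j"
    and "\<And>i j. (i, j) \<in> parcs I \<Longrightarrow> h i = h j \<or> (h i, h j) \<in> parcs J"
  shows "shrinking_map n I m J h"
  using assms(1-5,7) mono mono[of _ n] unfolding shrinking_map_def digraph_map_def
  by (auto simp: line_digraph_def)

definition pointwise_adjacent ::
  "'v pair_pre_digraph \<Rightarrow> nat \<Rightarrow> (nat \<Rightarrow> 'v) \<Rightarrow> (nat \<Rightarrow> 'v) \<Rightarrow> bool" where
  "pointwise_adjacent G n f g \<longleftrightarrow> (\<forall>i\<le>n. f i = g i \<or> (f i, g i) \<in> parcs G)"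

text \<open>
  On the arcs of the two lines, a map on the cylinder restricts to the given path maps and is a
  digraph map for that reason. Only the arcs between \<open>i\<close> and \<open>h i\<close> impose a condition.
\<close>

lemma one_step_homotopic_iff:
  "one_step_homotopic G \<alpha> \<beta> \<longleftrightarrow>
     \<alpha> \<in> path_maps G \<and> \<beta> \<in> path_maps G \<and>
     path_start \<alpha> = path_start \<beta> \<and> path_end \<alpha> = path_end \<beta> \<and>
     (\<exists>h. shrinking_map (path_length \<alpha>) (path_line \<alpha>) (path_length \<beta>) (path_line \<beta>) h \<and>
        (pointwise_adjacent G (path_length \<alpha>) (path_fun \<alpha>) (path_fun \<beta> \<circ> h) \<or>
         pointwise_adjacent G (path_length \<alpha>) (path_fun \<beta> \<circ> h) (path_fun \<alpha>)))"
  (is "?L \<longleftrightarrow> ?R")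
proof
  assume ?L
  then obtain h F where paths: "\<alpha> \<in> path_maps G" "\<beta> \<in> path_maps G"
      "path_start \<alpha> = path_start \<beta>" "path_end \<alpha> = path_end \<beta>"
    and h: "shrinking_map (path_length \<alpha>) (path_line \<alpha>) (path_length \<beta>) (path_line \<beta>) h"
    and F: "digraph_map (cylinder (path_line \<alpha>) (path_line \<beta>) h) G F \<or>
         digraph_map (inverse_cylinder (path_line \<alpha>) (path_line \<beta>) h) G F"
      "\<forall>i\<le>path_length \<alpha>. F (Inl i) = path_fun \<alpha> i" "\<forall>j\<le>path_length \<beta>. F (Inr j) = path_fun \<beta> j"
    unfolding one_step_homotopic_def by blast
  have vertex: "i \<in> pverts (path_line \<alpha>)" if "i \<le> path_length \<alpha>" for i
    using path_map_pverts[OF paths(1)] that by simp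
  have F_eq: "F (Inl i) = path_fun \<alpha> i" "F (Inr (h i)) = (path_fun \<beta> \<circ> h) i"
    if "i \<le> path_length \<alpha>" for i
    using that F(2,3) shrinking_map_le[OF h that] by simp_all
  from F(1) have "pointwise_adjacent G (path_length \<alpha>) (path_fun \<alpha>) (path_fun \<beta> \<circ> h) \<or>
      pointwise_adjacent G (path_length \<alpha>) (path_fun \<beta> \<circ> h) (path_fun \<alpha>)"
  proof (elim disjE)
    assume *: "digraph_map (cylinder (path_line \<alpha>) (path_line \<beta>) h) G F"
    have "F (Inl i) = F (Inr (h i)) \<or> (F (Inl i), F (Inr (h i))) \<in> parcs G"
      if "i \<le> path_length \<alpha>" for i
      using digraph_map_arc[OF *, of "Inl i" "Inr (h i)"] vertex[OF that] by (simp add: cylinder_def)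
    then show ?thesis by (simp add: pointwise_adjacent_def F_eq)
  next
    assume *: "digraph_map (inverse_cylinder (path_line \<alpha>) (path_line \<beta>) h) G F"
    have "F (Inr (h i)) = F (Inl i) \<or> (F (Inr (h i)), F (Inl i)) \<in> parcs G"
      if "i \<le> path_length \<alpha>" for i
      using digraph_map_arc[OF *, of "Inr (h i)" "Inl i"] vertex[OF that]
      by (simp add: inverse_cylinder_def)
    then show ?thesis by (simp add: pointwise_adjacent_def F_eq)
  qed
  with paths h show ?R by blast
next
  assume ?R
  then obtain h where paths: "\<alpha> \<in> path_maps G" "\<beta> \<in> path_maps G"
      "path_start \<alpha> = path_start \<beta>" "path_end \<alpha> = path_end \<beta>"
    and h: "shrinking_map (path_length \<alpha>) (path_line \<alpha>) (path_length \<beta>) (path_line \<beta>) h"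
    and adj: "pointwise_adjacent G (path_length \<alpha>) (path_fun \<alpha>) (path_fun \<beta> \<circ> h) \<or>
      pointwise_adjacent G (path_length \<alpha>) (path_fun \<beta> \<circ> h) (path_fun \<alpha>)"
    by blast
  have vertices: "pverts (path_line \<alpha>) = {..path_length \<alpha>}" "pverts (path_line \<beta>) = {..path_length \<beta>}"
    using path_map_pverts paths by auto
  let ?F = "case_sum (path_fun \<alpha>) (path_fun \<beta>)"
  have "digraph_map (cylinder (path_line \<alpha>) (path_line \<beta>) h) G ?F"
    if "pointwise_adjacent G (path_length \<alpha>) (path_fun \<alpha>) (path_fun \<beta> \<circ> h)"
    using that path_map_vertex[OF paths(1)] path_map_vertex[OF paths(2)]
    by (auto simp: digraph_map_def cylinder_def vertices pointwise_adjacent_def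
        dest: path_map_arc[OF paths(1)] path_map_arc[OF paths(2)])
  moreover have "digraph_map (inverse_cylinder (path_line \<alpha>) (path_line \<beta>) h) G ?F"
    if "pointwise_adjacent G (path_length \<alpha>) (path_fun \<beta> \<circ> h) (path_fun \<alpha>)"
    using that path_map_vertex[OF paths(1)] path_map_vertex[OF paths(2)]
    by (auto simp: digraph_map_def inverse_cylinder_def vertices pointwise_adjacent_def
        dest: path_map_arc[OF paths(1)] path_map_arc[OF paths(2)])
  moreover have "(\<forall>i\<le>path_length \<alpha>. ?F (Inl i) = path_fun \<alpha> i) \<and>
      (\<forall>j\<le>path_length \<beta>. ?F (Inr j) = path_fun \<beta> j)" by simp
  ultimately show ?L unfolding one_step_homotopic_def using paths h adj by blast
qed

lemma one_step_homotopicI: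
  assumes "\<alpha> \<in> path_maps G" "\<beta> \<in> path_maps G" "path_start \<alpha> = path_start \<beta>" "path_end \<alpha> = path_end \<beta>"
    and "path_length \<beta> \<le> path_length \<alpha>" "h 0 = 0" "h (path_length \<alpha>) = path_length \<beta>"
    and "\<And>i j. \<lbrakk>i \<le> j; j \<le> path_length \<alpha>\<rbrakk> \<Longrightarrow> h i \<le> h j"
    and "\<And>i j. (i, j) \<in> parcs (path_line \<alpha>) \<Longrightarrow> h i = h j \<or> (h i, h j) \<in> parcs (path_line \<beta>)"
    and "pointwise_adjacent G (path_length \<alpha>) (path_fun \<alpha>) (path_fun \<beta> \<circ> h) \<or>
      pointwise_adjacent G (path_length \<alpha>) (path_fun \<beta> \<circ> h) (path_fun \<alpha>)"
  shows "one_step_homotopic G \<alpha> \<beta>"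
  unfolding one_step_homotopic_iff
  using assms path_map_line shrinking_mapI[of "path_length \<alpha>" "path_line \<alpha>" "path_length \<beta>" "path_line \<beta>" h]
  by blast

lemma pointwise_adjacent_cong:
  assumes "pointwise_adjacent G n f g"
    and "\<And>i. i \<le> m \<Longrightarrow> f' i = g' i \<or> (\<exists>j\<le>n. f' i = f j \<and> g' i = g j)"
  shows "pointwise_adjacent G m f' g'"
  using assms unfolding pointwise_adjacent_def by metis

text \<open>
  The shrinking map is extended by the translation between the two copies of the line of \<open>\<gamma>\<close>,
  on which the homotopy is constant.
\<close>

lemma one_step_homotopic_concat_right:
  assumes hom: "one_step_homotopic G \<alpha> \<beta>" and \<gamma>: "\<gamma> \<in> path_maps G" and ends: "path_end \<alpha> = path_start \<gamma>"
  shows "one_step_homotopic G (path_concat \<alpha> \<gamma>) (path_concat \<beta> \<gamma>)"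
proof -
  from hom obtain h where paths: "\<alpha> \<in> path_maps G" "\<beta> \<in> path_maps G"
      "path_start \<alpha> = path_start \<beta>" "path_end \<alpha> = path_end \<beta>"
    and h: "shrinking_map (path_length \<alpha>) (path_line \<alpha>) (path_length \<beta>) (path_line \<beta>) h"
    and adj: "pointwise_adjacent G (path_length \<alpha>) (path_fun \<alpha>) (path_fun \<beta> \<circ> h) \<or>
      pointwise_adjacent G (path_length \<alpha>) (path_fun \<beta> \<circ> h) (path_fun \<alpha>)"
    unfolding one_step_homotopic_iff by blast
  let ?n = "path_length \<alpha>" and ?m = "path_length \<beta>" and ?k = "path_length \<gamma>"
  define h' where "h' i = (if i \<le> ?n then h i else ?m + (i - ?n))" for i
  have h_ends: "h 0 = 0" "h ?n = ?m" "?m \<le> ?n"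
    and h_mono: "\<And>i j. \<lbrakk>i \<le> j; j \<le> ?n\<rbrakk> \<Longrightarrow> h i \<le> h j"
    using h by (auto simp: shrinking_map_def)
  have h'_right: "h' i = ?m + (i - ?n)" if "?n \<le> i" for i
    using that h_ends by (auto simp: h'_def)
  have ends': "path_end \<beta> = path_start \<gamma>" using ends paths by simp
  have fun_eq: "i \<le> ?n \<and> path_fun (path_concat \<alpha> \<gamma>) i = path_fun \<alpha> i \<and>
        path_fun (path_concat \<beta> \<gamma>) (h' i) = path_fun \<beta> (h i)
      \<or> path_fun (path_concat \<alpha> \<gamma>) i = path_fun (path_concat \<beta> \<gamma>) (h' i)"
    if "i \<le> ?n + ?k" for i
  proof (cases "i \<le> ?n")
    case True
    then show ?thesis
      using shrinking_map_le[OF h True] by (simp add: h'_def path_concat_fun_left)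
  next
    case False
    with that path_concat_fun_right[OF ends', of "i - ?n"] show ?thesis
      by (simp add: h'_right path_concat_fun_right'[OF ends])
  qed
  show ?thesis
  proof (rule one_step_homotopicI[where h = h'])
    show "path_concat \<alpha> \<gamma> \<in> path_maps G" "path_concat \<beta> \<gamma> \<in> path_maps G"
      using path_concat_closed paths \<gamma> ends ends' by auto
    show "path_start (path_concat \<alpha> \<gamma>) = path_start (path_concat \<beta> \<gamma>)"
      "path_end (path_concat \<alpha> \<gamma>) = path_end (path_concat \<beta> \<gamma>)"
      using paths ends ends' by (simp_all add: path_end_concat)
    show "path_length (path_concat \<beta> \<gamma>) \<le> path_length (path_concat \<alpha> \<gamma>)" "h' 0 = 0"
      "h' (path_length (path_concat \<alpha> \<gamma>)) = path_length (path_concat \<beta> \<gamma>)"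
      using h_ends h'_right by (auto simp: path_concat_simps h'_def)
    show "h' i \<le> h' j" if "i \<le> j" "j \<le> path_length (path_concat \<alpha> \<gamma>)" for i j
    proof (cases "j \<le> ?n")
      case True
      with that show ?thesis by (simp add: h'_def h_mono)
    next
      case False
      with that show ?thesis using shrinking_map_le[OF h, of i] by (auto simp: h'_def)
    qed
    show "h' i = h' j \<or> (h' i, h' j) \<in> parcs (path_line (path_concat \<beta> \<gamma>))"
      if "(i, j) \<in> parcs (path_line (path_concat \<alpha> \<gamma>))" for i j
    proof -
      from that consider "(i, j) \<in> parcs (path_line \<alpha>)"
        | "?n \<le> i" "?n \<le> j" "(i - ?n, j - ?n) \<in> parcs (path_line \<gamma>)"
        by (auto simp: path_concat_simps)
      then show ?thesis
      proof cases
        case 1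
        with line_digraph_arc[OF path_map_line[OF paths(1)] 1] shrinking_map_arc[OF h 1]
        show ?thesis by (auto simp: h'_def path_concat_simps)
      next
        case 2
        moreover obtain k l where "i = ?n + k" "j = ?n + l"
          using 2(1,2) le_Suc_ex by blast
        ultimately show ?thesis by (simp add: h'_right path_concat_simps)
      qed
    qed
    show "pointwise_adjacent G (path_length (path_concat \<alpha> \<gamma>)) (path_fun (path_concat \<alpha> \<gamma>))
          (path_fun (path_concat \<beta> \<gamma>) \<circ> h') \<or>
        pointwise_adjacent G (path_length (path_concat \<alpha> \<gamma>)) (path_fun (path_concat \<beta> \<gamma>) \<circ> h')
          (path_fun (path_concat \<alpha> \<gamma>))"
      using adj
    proof (elim disjE)
      assume "pointwise_adjacent G ?n (path_fun \<alpha>) (path_fun \<beta> \<circ> h)"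
      then show ?thesis
        by (intro disjI1, elim pointwise_adjacent_cong) (use fun_eq in \<open>force simp: path_concat_simps\<close>)
    next
      assume "pointwise_adjacent G ?n (path_fun \<beta> \<circ> h) (path_fun \<alpha>)"
      then show ?thesis
        by (intro disjI2, elim pointwise_adjacent_cong) (use fun_eq in \<open>force simp: path_concat_simps\<close>)
    qed
  qed
qed

lemma one_step_homotopic_reverse:
  assumes hom: "one_step_homotopic G \<alpha> \<beta>"
  shows "one_step_homotopic G (path_reverse \<alpha>) (path_reverse \<beta>)"
proof -
  from hom obtain h where paths: "\<alpha> \<in> path_maps G" "\<beta> \<in> path_maps G"
      "path_start \<alpha> = path_start \<beta>" "path_end \<alpha> = path_end \<beta>"
    and h: "shrinking_map (path_length \<alpha>) (path_line \<alpha>) (path_length \<beta>) (path_line \<beta>) h"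
    and adj: "pointwise_adjacent G (path_length \<alpha>) (path_fun \<alpha>) (path_fun \<beta> \<circ> h) \<or>
      pointwise_adjacent G (path_length \<alpha>) (path_fun \<beta> \<circ> h) (path_fun \<alpha>)"
    unfolding one_step_homotopic_iff by blast
  let ?n = "path_length \<alpha>" and ?m = "path_length \<beta>"
  define h' where "h' i = ?m - h (?n - i)" for i
  have h_ends: "h 0 = 0" "h ?n = ?m" "?m \<le> ?n"
    and h_mono: "\<And>i j. \<lbrakk>i \<le> j; j \<le> ?n\<rbrakk> \<Longrightarrow> h i \<le> h j"
    using h by (auto simp: shrinking_map_def)
  have fun_eq: "path_fun (path_reverse \<alpha>) i = path_fun \<alpha> (?n - i)"
    "path_fun (path_reverse \<beta>) (h' i) = path_fun \<beta> (h (?n - i))" if "i \<le> ?n" for i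
    using that shrinking_map_le[OF h, of "?n - i"] by (simp_all add: h'_def path_reverse_fun)
  show ?thesis
  proof (rule one_step_homotopicI[where h = h'])
    show "path_reverse \<alpha> \<in> path_maps G" "path_reverse \<beta> \<in> path_maps G"
      using path_reverse_closed paths by auto
    show "path_start (path_reverse \<alpha>) = path_start (path_reverse \<beta>)"
      "path_end (path_reverse \<alpha>) = path_end (path_reverse \<beta>)"
      using paths by simp_all
    show "path_length (path_reverse \<beta>) \<le> path_length (path_reverse \<alpha>)" "h' 0 = 0"
      "h' (path_length (path_reverse \<alpha>)) = path_length (path_reverse \<beta>)"
      using h_ends by (auto simp: path_reverse_simps h'_def)
    show "h' i \<le> h' j" if "i \<le> j" "j \<le> path_length (path_reverse \<alpha>)" for i j
      using that h_mono[of "?n - j" "?n - i"] by (simp add: h'_def path_reverse_simps diff_le_mono2)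
    show "h' i = h' j \<or> (h' i, h' j) \<in> parcs (path_line (path_reverse \<beta>))"
      if "(i, j) \<in> parcs (path_line (path_reverse \<alpha>))" for i j
    proof -
      from that have ij: "i \<le> ?n" "j \<le> ?n" "(?n - i, ?n - j) \<in> parcs (path_line \<alpha>)"
        by (auto simp: path_reverse_simps)
      with shrinking_map_arc[OF h ij(3)] shrinking_map_le[OF h, of "?n - i"]
        shrinking_map_le[OF h, of "?n - j"]
      show ?thesis by (auto simp: h'_def path_reverse_simps)
    qed
    show "pointwise_adjacent G (path_length (path_reverse \<alpha>)) (path_fun (path_reverse \<alpha>))
          (path_fun (path_reverse \<beta>) \<circ> h') \<or>
        pointwise_adjacent G (path_length (path_reverse \<alpha>)) (path_fun (path_reverse \<beta>) \<circ> h')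
          (path_fun (path_reverse \<alpha>))"
      using adj
    proof (elim disjE)
      assume "pointwise_adjacent G ?n (path_fun \<alpha>) (path_fun \<beta> \<circ> h)"
      then show ?thesis
        by (intro disjI1) (simp add: pointwise_adjacent_def path_reverse_simps fun_eq)
    next
      assume "pointwise_adjacent G ?n (path_fun \<beta> \<circ> h) (path_fun \<alpha>)"
      then show ?thesis
        by (intro disjI2) (simp add: pointwise_adjacent_def path_reverse_simps fun_eq)
    qed
  qed
qed

text \<open>
  Intermediate paths of a homotopy between loops at \<open>x\<close> are loops at \<open>x\<close>, since every step preserves
  the endpoints.
\<close>

lemma C_homotopic_map:
  assumes step: "\<And>\<alpha> \<beta>. \<lbrakk>\<alpha> \<in> loops G x; \<beta> \<in> loops G x; one_step_homotopic G \<alpha> \<beta>\<rbrakk> \<Longrightarrow>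
      one_step_homotopic G (f \<alpha>) (f \<beta>)"
    and "\<alpha> \<in> loops G x" "C_homotopic G \<alpha> \<beta>"
  shows "C_homotopic G (f \<alpha>) (f \<beta>)"
proof -
  from assms(3) have "\<beta> \<in> loops G x \<and> C_homotopic G (f \<alpha>) (f \<beta>)"
    unfolding C_homotopic_def
  proof (induction rule: equivclp_induct)
    case base
    show ?case using assms(2) by simp
  next
    case (step y z)
    then have "z \<in> loops G x" by (auto simp: one_step_homotopic_def loops_def)
    with step have "one_step_homotopic G (f y) (f z) \<or> one_step_homotopic G (f z) (f y)"
      using assms(1) by blast
    with step \<open>z \<in> loops G x\<close> show ?case
      by (meson equivclp_into_equivclp)
  qed
  then show ?thesis by blast
qed

lemma C_homotopic_concat_right:
  assumes "\<alpha> \<in> loops G x" "\<gamma> \<in> loops G x" "C_homotopic G \<alpha> \<beta>"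
  shows "C_homotopic G (path_concat \<alpha> \<gamma>) (path_concat \<beta> \<gamma>)"
  by (rule C_homotopic_map[OF _ assms(1,3)])
     (use assms(2) in \<open>auto simp: loops_def intro: one_step_homotopic_concat_right\<close>)

lemma C_homotopic_reverse:
  assumes "\<alpha> \<in> loops G x" "C_homotopic G \<alpha> \<beta>"
  shows "C_homotopic G (path_reverse \<alpha>) (path_reverse \<beta>)"
  by (rule C_homotopic_map[OF _ assms]) (rule one_step_homotopic_reverse)

section \<open>Iterated integrals along paths\<close>

definition path_edges :: "'v path_map \<Rightarrow> (('v, 'k::field_char_0) one_form \<Rightarrow> 'k) list" where
  "path_edges \<alpha> = map (\<lambda>t \<omega>. form_pairing \<omega> \<alpha> t) [1..<Suc (path_length \<alpha>)]"

lemma iterated_integral_eq_transport: "iterated_integral \<alpha> ws = transport (path_edges \<alpha>) ws"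
  using sum_sorted_indices_eq_transport[where p = "\<lambda>t \<omega>. form_pairing \<omega> \<alpha> t"
      and n = "path_length \<alpha>" and w = ws]
  by (simp add: iterated_integral_def path_edges_def sorted_indices_def del: upt_Suc)

lemma form_pairing_Suc:
  "form_pairing \<omega> \<alpha> (Suc k) =
     (if path_fun \<alpha> k = path_fun \<alpha> (Suc k) then 0
      else if (k, Suc k) \<in> parcs (path_line \<alpha>) then \<omega> (path_fun \<alpha> k, path_fun \<alpha> (Suc k))
      else - \<omega> (path_fun \<alpha> (Suc k), path_fun \<alpha> k))"
  by (simp add: form_pairing_def)

lemma length_path_edges [simp]: "length (path_edges \<alpha>) = path_length \<alpha>"
  by (simp add: path_edges_def)

lemma nth_path_edges:
  "k < path_length \<alpha> \<Longrightarrow> path_edges \<alpha> ! k = (\<lambda>\<omega>. form_pairing \<omega> \<alpha> (Suc k))"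
  by (simp add: path_edges_def del: upt_Suc)

lemma path_edges_concat:
  assumes \<alpha>: "\<alpha> \<in> path_maps G" and \<beta>: "\<beta> \<in> path_maps G" and ends: "path_end \<alpha> = path_start \<beta>"
  shows "path_edges (path_concat \<alpha> \<beta>) = path_edges \<alpha> @ path_edges \<beta>"
proof (rule nth_equalityI)
  show "length (path_edges (path_concat \<alpha> \<beta>)) = length (path_edges \<alpha> @ path_edges \<beta>)"
    by (simp add: path_concat_simps)
  fix k assume "k < length (path_edges (path_concat \<alpha> \<beta>))"
  then have k: "k < path_length \<alpha> + path_length \<beta>" by (simp add: path_concat_simps)
  show "path_edges (path_concat \<alpha> \<beta>) ! k = (path_edges \<alpha> @ path_edges \<beta>) ! k"
  proof (cases "k < path_length \<alpha>")
    case True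
    then show ?thesis
      using k by (auto simp: nth_append nth_path_edges path_concat_simps form_pairing_Suc
          path_concat_fun_left fun_eq_iff)
  next
    case False
    then obtain l where l: "k = path_length \<alpha> + l" "l < path_length \<beta>"
      using k le_Suc_ex[of "path_length \<alpha>" k] by auto
    have "(k, Suc k) \<notin> parcs (path_line \<alpha>)"
      using line_digraph_arc(2)[OF path_map_line[OF \<alpha>], of k "Suc k"] False by auto
    then show ?thesis
      using l path_concat_fun_right[OF ends, of l] path_concat_fun_right[OF ends, of "Suc l"]
      by (auto simp: nth_append nth_path_edges path_concat_simps form_pairing_Suc fun_eq_iff)
  qed
qed

lemma path_edges_reverse:
  fixes G :: "'v pair_pre_digraph"
  assumes \<alpha>: "\<alpha> \<in> path_maps G"
  shows "path_edges (path_reverse \<alpha>) =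
    reverse_edges (path_edges \<alpha> :: (('v, 'k::field_char_0) one_form \<Rightarrow> 'k) list)"
proof (rule nth_equalityI)
  let ?es = "path_edges (path_reverse \<alpha>) :: (('v, 'k) one_form \<Rightarrow> 'k) list"
  show "length ?es = length (reverse_edges (path_edges \<alpha>))"
    by (simp add: path_reverse_simps reverse_edges_def)
  fix k assume "k < length ?es"
  then have k: "k < path_length \<alpha>" by (simp add: path_reverse_simps)
  define l where "l = path_length \<alpha> - Suc k"
  have l: "l < path_length \<alpha>" "path_length \<alpha> - k = Suc l" "path_length \<alpha> - Suc k = l"
    using k by (auto simp: l_def)
  have "form_pairing \<omega> (path_reverse \<alpha>) (Suc k) = - form_pairing \<omega> \<alpha> (Suc l)"
    for \<omega> :: "('v, 'k) one_form"
    using k l line_digraph_opposite[OF path_map_line[OF \<alpha>] l(1)]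
    by (simp add: form_pairing_Suc path_reverse_fun path_reverse_simps)
  then show "?es ! k = reverse_edges (path_edges \<alpha>) ! k"
    using k l by (simp add: nth_path_edges path_reverse_simps reverse_edges_def rev_nth)
qed

lemma reverse_edges_append: "reverse_edges (as @ bs) = reverse_edges bs @ reverse_edges as"
  by (simp add: reverse_edges_def)

lemma path_edges_constant_loop: "path_edges (constant_loop x) = []"
  by (simp add: path_edges_def constant_loop_def)

text \<open>
  The linear span of the iterated integrals. As shuffles express products of integrals by
  sums of integrals, this span is the whole algebra that they generate. It provides an
  induction principle without a case for products, which is what is needed to compare linear maps.
\<close>

inductive_set integral_span ::
  "'v pair_pre_digraph \<Rightarrow> 'v \<Rightarrow> ('v path_map \<Rightarrow> 'k::field_char_0) set" for G x where
  integral: "loop_integral G x ws \<in> integral_span G x"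
| add: "\<lbrakk>u \<in> integral_span G x; v \<in> integral_span G x\<rbrakk> \<Longrightarrow>
    (\<lambda>\<alpha>\<in>loops G x. u \<alpha> + v \<alpha>) \<in> integral_span G x"
| smult: "u \<in> integral_span G x \<Longrightarrow> (\<lambda>\<alpha>\<in>loops G x. c * u \<alpha>) \<in> integral_span G x"

lemma integral_span_extensional: "u \<in> integral_span G x \<Longrightarrow> u \<in> extensional (loops G x)"
  by (induction rule: integral_span.induct) (simp_all add: loop_integral_def del: restrict_apply)

lemma integral_span_restrict:
  assumes "v \<in> integral_span G x" "\<And>\<alpha>. \<alpha> \<in> loops G x \<Longrightarrow> f \<alpha> = v \<alpha>"
  shows "(\<lambda>\<alpha>\<in>loops G x. f \<alpha>) \<in> integral_span G x"
proof -
  have "(\<lambda>\<alpha>\<in>loops G x. f \<alpha>) = v"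
    using integral_span_extensional[OF assms(1)] assms(2)
    by (intro extensionalityI[of _ "loops G x"]) auto
  with assms(1) show ?thesis by simp
qed

lemma shuffle_sum_in_integral_span:
  fixes F :: "'v path_map \<Rightarrow> 'w list \<Rightarrow> 'k::field_char_0"
  assumes "\<And>w. (\<lambda>\<alpha>\<in>loops G x. F \<alpha> w) \<in> integral_span G x"
  shows "(\<lambda>\<alpha>\<in>loops G x. shuffle_sum (F \<alpha>) u v) \<in> integral_span G x"
  using assms
proof (induction u arbitrary: F v)
  case (Cons a u)
  note IHu = Cons.IH
  show ?case using Cons.prems
  proof (induction v arbitrary: F)
    case (Cons b v)
    let ?u = "\<lambda>\<alpha>\<in>loops G x. shuffle_sum (\<lambda>w. F \<alpha> (a # w)) u (b # v)"
    let ?v = "\<lambda>\<alpha>\<in>loops G x. shuffle_sum (\<lambda>w. F \<alpha> (b # w)) (a # u) v"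
    have "?u \<in> integral_span G x" "?v \<in> integral_span G x"
      by (rule IHu Cons.IH, rule Cons.prems)+
    moreover have "(\<lambda>\<alpha>\<in>loops G x. shuffle_sum (F \<alpha>) (a # u) (b # v)) = (\<lambda>\<alpha>\<in>loops G x. ?u \<alpha> + ?v \<alpha>)"
      by (rule restrict_ext) simp
    ultimately show ?case by (simp only: integral_span.add)
  qed simp
qed simp

lemma iterated_integral_shuffle:
  fixes u v :: "('v, 'k::field_char_0) one_form list"
  shows "iterated_integral \<alpha> u * iterated_integral \<alpha> v = shuffle_sum (iterated_integral \<alpha>) u v"
proof -
  have "iterated_integral \<alpha> = (transport (path_edges \<alpha>) :: ('v, 'k) one_form list \<Rightarrow> 'k)"
    by (simp add: iterated_integral_eq_transport fun_eq_iff)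
  then have "shuffle_character (iterated_integral \<alpha> :: ('v, 'k) one_form list \<Rightarrow> 'k)"
    by (simp add: shuffle_character_transport)
  then show ?thesis by (simp add: shuffle_character_def)
qed

lemma integral_span_mult:
  assumes "u \<in> integral_span G x" "v \<in> integral_span G x"
  shows "(\<lambda>\<alpha>\<in>loops G x. u \<alpha> * v \<alpha>) \<in> integral_span G x"
  using assms(1)
proof induction
  case (integral ws)
  show ?case using assms(2)
  proof induction
    case (integral vs)
    have "(\<lambda>\<alpha>\<in>loops G x. shuffle_sum (iterated_integral \<alpha>) ws vs) \<in> integral_span G x"
      using integral_span.integral[of G x]
      by (intro shuffle_sum_in_integral_span) (simp add: loop_integral_def)
    also have "(\<lambda>\<alpha>\<in>loops G x. shuffle_sum (iterated_integral \<alpha>) ws vs) =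
        (\<lambda>\<alpha>\<in>loops G x. loop_integral G x ws \<alpha> * loop_integral G x vs \<alpha>)"
      by (rule restrict_ext) (simp add: loop_integral_def iterated_integral_shuffle)
    finally show ?case .
  next
    case (add u v)
  show ?case by (rule integral_span_restrict[OF integral_span.add[OF add.IH]]) (simp add: distrib_left)
  next
    case (smult u c)
    show ?case by (rule integral_span_restrict[OF integral_span.smult[OF smult.IH, of c]]) (simp add: ac_simps)
  qed
next
  case (add u v)
  show ?case by (rule integral_span_restrict[OF integral_span.add[OF add.IH]]) (simp add: distrib_right)
next
  case (smult u c)
  show ?case by (rule integral_span_restrict[OF integral_span.smult[OF smult.IH, of c]]) (simp add: ac_simps)
qed

lemma loop_integral_Nil: "loop_integral G x [] = (\<lambda>\<alpha>\<in>loops G x. 1)"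
  by (simp add: loop_integral_def iterated_integral_eq_transport shuffle_character_transport[unfolded shuffle_character_def])

lemma generated_subalgebra_eq_integral_span:
  fixes G :: "'v pair_pre_digraph"
  shows "generated_subalgebra (function_algebra (loops G x)) {loop_integral G x ws | ws. ws \<noteq> []} =
    (integral_span G x :: ('v path_map \<Rightarrow> 'k::field_char_0) set)" (is "generated_subalgebra ?F ?B = _")
proof -
  have "(\<lambda>\<alpha>\<in>loops G x. 1 :: 'k) \<in> integral_span G x"
    using integral_span.integral[of G x "[] :: ('v, 'k) one_form list"] by (simp only: loop_integral_Nil)
  note one = this
  have "u \<in> integral_span G x" if "u \<in> generated_subalgebra ?F ?B" for u
    using that
    by (induction rule: generated_subalgebra.induct)
       (auto simp: function_algebra_def one simp del: restrict_apply
         intro: integral_span.intros integral_span_mult)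
  moreover have "u \<in> generated_subalgebra ?F ?B" if "u \<in> integral_span G x" for u
    using that
  proof induction
    case (integral ws)
    show ?case
    proof (cases "ws = []")
      case True
      then have "loop_integral G x ws = \<one>\<^bsub>?F\<^esub>"
        by (simp add: function_algebra_def loop_integral_Nil)
      then show ?thesis by (simp only: generated_subalgebra.one)
    qed (auto intro: generated_subalgebra.generator)
  next
    case (add u v)
    have "(\<lambda>\<alpha>\<in>loops G x. u \<alpha> + v \<alpha>) = u \<oplus>\<^bsub>?F\<^esub> v"
      by (simp add: function_algebra_def)
    with generated_subalgebra.add[OF add.IH] show ?case by (simp only:)
  next
    case (smult u c)
    have "(\<lambda>\<alpha>\<in>loops G x. c * u \<alpha>) = c \<odot>\<^bsub>?F\<^esub> u"
      by (simp add: function_algebra_def)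
    with generated_subalgebra.smult[OF smult.IH] show ?case by (simp only:)
  qed
  ultimately show ?thesis by blast
qed

lemma integral_algebra_eq: "integral_algebra G x = (function_algebra (loops G x))\<lparr>carrier := integral_span G x\<rparr>"
  by (simp add: integral_algebra_def generated_subalgebra_eq_integral_span)

lemma function_subalgebra_integral:
  "function_subalgebra (integral_algebra G x) (loops G x) (integral_span G x)"
proof
  show "integral_algebra G x = (function_algebra (loops G x))\<lparr>carrier := integral_span G x\<rparr>"
    by (rule integral_algebra_eq)
  show "(\<lambda>p\<in>loops G x. 1) \<in> integral_span G x"
    unfolding loop_integral_Nil[symmetric] by (rule integral_span.integral)
qed (auto intro: integral_span_extensional integral_span.intros integral_span_mult)

text \<open>
  Two loops with the same transport cannot be distinguished by integrals. This is the sense in which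
  reversal is an inverse: the transport of a loop followed by its reverse is that of the constant
  loop, although the two loops are different in general.
\<close>

lemma integral_span_determined:
  assumes "u \<in> integral_span G x" "\<alpha> \<in> loops G x" "\<beta> \<in> loops G x"
    and "transport (path_edges \<alpha>) = (transport (path_edges \<beta>) :: _ \<Rightarrow> 'k::field_char_0)"
  shows "u \<alpha> = (u \<beta> :: 'k)"
  using assms by (induction rule: integral_span.induct)
    (auto simp: loop_integral_def iterated_integral_eq_transport)

lemma integral_span_linear_eq:
  assumes "f \<in> linear_maps (integral_algebra G x) N" "g \<in> linear_maps (integral_algebra G x) N"
    and "\<And>ws. f (loop_integral G x ws) = g (loop_integral G x ws)"
    and "u \<in> integral_span G x"
  shows "f u = g u"
  using assms(4)
proof induction
  case (integral ws)
  show ?case by (rule assms(3))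
next
  interpret Q: function_subalgebra "integral_algebra G x" "loops G x" "integral_span G x"
    by (rule function_subalgebra_integral)
  case (add u v)
  with assms(1,2) show ?case
    by (simp add: linear_maps_def Q.carrier_A flip: Q.A_simps(5))
next
  interpret Q: function_subalgebra "integral_algebra G x" "loops G x" "integral_span G x"
    by (rule function_subalgebra_integral)
  case (smult u c)
  with assms(1,2) show ?case
    by (simp add: linear_maps_def Q.carrier_A flip: Q.A_simps(6))
qed

lemma path_edges_concat_loops:
  "\<lbrakk>\<alpha> \<in> loops G x; \<beta> \<in> loops G x\<rbrakk> \<Longrightarrow> path_edges (path_concat \<alpha> \<beta>) = path_edges \<alpha> @ path_edges \<beta>"
  by (rule path_edges_concat[of _ G]) (auto simp: loops_def)

lemma path_edges_reverse_loops:
  "\<alpha> \<in> loops G x \<Longrightarrow> path_edges (path_reverse \<alpha>) = reverse_edges (path_edges \<alpha>)"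
  by (rule path_edges_reverse[of _ G]) (auto simp: loops_def)

text \<open>
  For a single integral this is deconcatenation of words: the integral along a concatenation is a
  coefficient of the product of the two transports.
\<close>

lemma integral_span_factorization:
  assumes "u \<in> integral_span G x"
  shows "\<exists>ps. set ps \<subseteq> integral_span G x \<times> integral_span G x \<and>
    (\<forall>\<alpha>\<in>loops G x. \<forall>\<beta>\<in>loops G x. u (path_concat \<alpha> \<beta>) = (\<Sum>(a, b)\<leftarrow>ps. a \<alpha> * b \<beta>))"
  using assms
proof induction
  case (integral ws)
  let ?ps = "map (\<lambda>i. (loop_integral G x (take i ws), loop_integral G x (drop i ws))) [0..<Suc (length ws)]"
  have "loop_integral G x ws (path_concat \<alpha> \<beta>) = (\<Sum>(a, b)\<leftarrow>?ps. a \<alpha> * b \<beta>)"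
    if "\<alpha> \<in> loops G x" "\<beta> \<in> loops G x" for \<alpha> \<beta>
  proof -
    have "loop_integral G x ws (path_concat \<alpha> \<beta>) =
        (\<Sum>i\<le>length ws. transport (path_edges \<alpha>) (take i ws) * transport (path_edges \<beta>) (drop i ws))"
      using that by (simp add: loop_integral_def path_concat_loops iterated_integral_eq_transport
          path_edges_concat_loops transport_append convolve_def)
    also have "\<dots> = (\<Sum>i\<leftarrow>[0..<Suc (length ws)].
        loop_integral G x (take i ws) \<alpha> * loop_integral G x (drop i ws) \<beta>)"
      using that by (simp add: interv_sum_list_conv_sum_set_nat atLeast0LessThan lessThan_Suc_atMost
          loop_integral_def iterated_integral_eq_transport del: upt_Suc)
    finally show ?thesis by (simp add: o_def del: upt_Suc)
  qed
  then show ?case by (intro exI[of _ ?ps]) (auto intro: integral_span.integral)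
next
  case (add u v)
  from add.IH obtain ps qs where
    "set ps \<subseteq> integral_span G x \<times> integral_span G x" "set qs \<subseteq> integral_span G x \<times> integral_span G x"
    "\<forall>\<alpha>\<in>loops G x. \<forall>\<beta>\<in>loops G x. u (path_concat \<alpha> \<beta>) = (\<Sum>(a, b)\<leftarrow>ps. a \<alpha> * b \<beta>)"
    "\<forall>\<alpha>\<in>loops G x. \<forall>\<beta>\<in>loops G x. v (path_concat \<alpha> \<beta>) = (\<Sum>(a, b)\<leftarrow>qs. a \<alpha> * b \<beta>)" by blast
  then show ?case by (intro exI[of _ "ps @ qs"]) (auto simp: path_concat_loops)
next
  case (smult u c)
  then obtain ps where ps: "set ps \<subseteq> integral_span G x \<times> integral_span G x"
    "\<forall>\<alpha>\<in>loops G x. \<forall>\<beta>\<in>loops G x. u (path_concat \<alpha> \<beta>) = (\<Sum>(a, b)\<leftarrow>ps. a \<alpha> * b \<beta>)" by blast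
  let ?qs = "map (\<lambda>(a, b). (\<lambda>\<alpha>\<in>loops G x. c * a \<alpha>, b)) ps"
  have "(\<Sum>(a, b)\<leftarrow>?qs. a \<alpha> * b \<beta>) = c * (\<Sum>(a, b)\<leftarrow>ps. a \<alpha> * b \<beta>)" if "\<alpha> \<in> loops G x" for \<alpha> \<beta>
    using that by (induction ps) (auto simp: algebra_simps)
  with ps show ?case
    by (intro exI[of _ ?qs]) (auto simp: path_concat_loops intro: integral_span.smult)
qed

lemma integral_span_reverse:
  assumes "u \<in> integral_span G x"
  shows "(\<lambda>\<alpha>\<in>loops G x. u (path_reverse \<alpha>)) \<in> integral_span G x"
  using assms
proof induction
  case (integral ws)
  show ?case
    by (rule integral_span_restrict[OF integral_span.smult[OF
          integral_span.integral[of G x "rev ws"], of "(- 1) ^ length ws"]])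
       (simp add: loop_integral_def path_reverse_loops iterated_integral_eq_transport
        path_edges_reverse_loops transport_reverse_edges)
next
  case (add u v)
  show ?case
    by (rule integral_span_restrict[OF integral_span.add[OF add.IH]]) (simp add: path_reverse_loops)
next
  case (smult u c)
  show ?case
    by (rule integral_span_restrict[OF integral_span.smult[OF smult.IH, of c]])
       (simp add: path_reverse_loops)
qed

lemma function_hopf_algebra_integral:
  assumes "x \<in> pverts G"
  shows "function_hopf_algebra (integral_algebra G x) (loops G x) (integral_span G x)
    path_concat path_reverse (constant_loop x)"
proof (intro function_hopf_algebra.intro function_subalgebra_integral function_hopf_algebra_axioms.intro)
  note const = constant_loop_loops[OF assms]
  show "constant_loop x \<in> loops G x" by (rule const)
  fix u :: "'a path_map \<Rightarrow> 'b" assume u: "u \<in> integral_span G x"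
  fix p assume p: "p \<in> loops G x"
  note simps = path_concat_loops path_reverse_loops path_edges_concat_loops[of _ G x]
    path_edges_reverse_loops[of _ G x] path_edges_constant_loop
  show "u (path_concat (constant_loop x) p) = u p" "u (path_concat p (constant_loop x)) = u p"
    using p const by (intro integral_span_determined[OF u]; simp add: simps)+
  show "u (path_concat (path_reverse p) p) = u (constant_loop x)"
    "u (path_concat p (path_reverse p)) = u (constant_loop x)"
    using p const by (intro integral_span_determined[OF u];
        simp add: simps transport_reverse_cancel transport_cancel_reverse)+
  fix q r assume "q \<in> loops G x" "r \<in> loops G x"
  with p show "u (path_concat (path_concat p q) r) = u (path_concat p (path_concat q r))"
    by (intro integral_span_determined[OF u]) (simp_all add: simps)
qed (auto intro: path_concat_loops path_reverse_loops integral_span_factorization integral_span_reverse)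

section \<open>Homotopy invariant integrals\<close>

definition homotopy_invariants ::
  "'v pair_pre_digraph \<Rightarrow> 'v \<Rightarrow> ('v path_map \<Rightarrow> 'k::field_char_0) set" where
  "homotopy_invariants G x = {u \<in> integral_span G x.
     \<forall>\<alpha>\<in>loops G x. \<forall>\<beta>\<in>loops G x. C_homotopic G \<alpha> \<beta> \<longrightarrow> u \<alpha> = u \<beta>}"

lemma homotopy_invariantsI:
  assumes "u \<in> integral_span G x"
    and "\<And>\<alpha> \<beta>. \<lbrakk>\<alpha> \<in> loops G x; \<beta> \<in> loops G x; C_homotopic G \<alpha> \<beta>\<rbrakk> \<Longrightarrow> u \<alpha> = u \<beta>"
  shows "u \<in> homotopy_invariants G x"
  using assms by (auto simp: homotopy_invariants_def)

lemma homotopy_invariantsD: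
  assumes "u \<in> homotopy_invariants G x"
  shows "u \<in> integral_span G x"
    and "\<lbrakk>\<alpha> \<in> loops G x; \<beta> \<in> loops G x; C_homotopic G \<alpha> \<beta>\<rbrakk> \<Longrightarrow> u \<alpha> = u \<beta>"
  using assms by (auto simp: homotopy_invariants_def)

lemma function_subalgebra_pi1:
  "function_subalgebra (pi1_algebra G x) (loops G x) (homotopy_invariants G x)"
proof -
  interpret Q: function_subalgebra "integral_algebra G x" "loops G x" "integral_span G x"
    by (rule function_subalgebra_integral)
  show ?thesis
  proof
    show "pi1_algebra G x = (function_algebra (loops G x))\<lparr>carrier := homotopy_invariants G x\<rparr>"
      by (simp add: pi1_algebra_def integral_algebra_eq homotopy_invariants_def)
  qed (auto simp: homotopy_invariants_def Q.one_mem
      intro: Q.extensional Q.add_mem Q.smult_mem Q.mult_mem)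
qed

lemma homotopy_invariants_reverse:
  assumes u: "u \<in> homotopy_invariants G x"
  shows "(\<lambda>\<alpha>\<in>loops G x. u (path_reverse \<alpha>)) \<in> homotopy_invariants G x"
proof (rule homotopy_invariantsI)
  show "(\<lambda>\<alpha>\<in>loops G x. u (path_reverse \<alpha>)) \<in> integral_span G x"
    using integral_span_reverse homotopy_invariantsD(1)[OF u] .
  fix \<alpha> \<beta> assume "\<alpha> \<in> loops G x" "\<beta> \<in> loops G x" "C_homotopic G \<alpha> \<beta>"
  then show "(\<lambda>\<alpha>\<in>loops G x. u (path_reverse \<alpha>)) \<alpha> = (\<lambda>\<alpha>\<in>loops G x. u (path_reverse \<alpha>)) \<beta>"
    using homotopy_invariantsD(2)[OF u _ _ C_homotopic_reverse, of \<alpha> \<beta>] by (simp add: path_reverse_loops)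
qed

text \<open>
  A slice is a linear combination of the factors of one side in a factorization of the function
  \<open>(\<alpha>, \<beta>) \<mapsto> u (\<alpha> \<beta>)\<close>, and hence an integral. Invariance in the first argument holds because homotopies can be
  concatenated with a fixed loop on the right. A fixed loop on the left is moved to the right by
  reversing: \<open>u\<close> does not distinguish \<open>\<gamma> \<alpha>\<close> from the reverse of the concatenation of the reverses
  of \<open>\<alpha>\<close> and \<open>\<gamma>\<close>.
\<close>

lemma homotopy_invariants_slice:
  assumes u: "u \<in> homotopy_invariants G x" and \<gamma>: "\<gamma> \<in> loops G x"
  shows "(\<lambda>\<alpha>\<in>loops G x. u (path_concat \<alpha> \<gamma>)) \<in> homotopy_invariants G x"
    and "(\<lambda>\<alpha>\<in>loops G x. u (path_concat \<gamma> \<alpha>)) \<in> homotopy_invariants G x"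
proof -
  interpret Q: function_subalgebra "integral_algebra G x" "loops G x" "integral_span G x"
    by (rule function_subalgebra_integral)
  note u_span = homotopy_invariantsD(1)[OF u]
  obtain ps where ps: "set ps \<subseteq> integral_span G x \<times> integral_span G x"
    "\<forall>\<alpha>\<in>loops G x. \<forall>\<beta>\<in>loops G x. u (path_concat \<alpha> \<beta>) = (\<Sum>(a, b)\<leftarrow>ps. a \<alpha> * b \<beta>)"
    using integral_span_factorization[OF u_span] by blast
  have lin: "(\<lambda>\<alpha>\<in>loops G x. \<Sum>(a, c)\<leftarrow>cs. c * a \<alpha>) \<in> integral_span G x"
    if "fst ` set cs \<subseteq> integral_span G x" for cs
    using that
  proof (induction cs)
    case (Cons ac cs)
    have "fst ac \<in> integral_span G x" using Cons.prems by auto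
    moreover have "(\<lambda>\<alpha>\<in>loops G x. \<Sum>(a, c)\<leftarrow>cs. c * a \<alpha>) \<in> integral_span G x"
      by (rule Cons.IH) (use Cons.prems in auto)
    ultimately have "(\<lambda>\<alpha>\<in>loops G x. (\<lambda>\<alpha>\<in>loops G x. snd ac * fst ac \<alpha>) \<alpha> +
        (\<lambda>\<alpha>\<in>loops G x. \<Sum>(a, c)\<leftarrow>cs. c * a \<alpha>) \<alpha>) \<in> integral_span G x"
      by (intro Q.add_mem Q.smult_mem)
    then show ?case by (rule integral_span_restrict) (simp add: case_prod_unfold)
  qed (simp add: Q.zero_mem)
  have left: "(\<lambda>\<alpha>\<in>loops G x. u (path_concat \<alpha> \<beta>)) \<in> integral_span G x" if "\<beta> \<in> loops G x" for \<beta>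
  proof -
    have "(\<lambda>\<alpha>\<in>loops G x. \<Sum>(a, c)\<leftarrow>map (\<lambda>(a, b). (a, b \<beta>)) ps. c * a \<alpha>) \<in> integral_span G x"
      using ps(1) by (intro lin) auto
    then show ?thesis
      by (rule integral_span_restrict) (use ps(2) that in \<open>simp add: case_prod_unfold o_def mult.commute\<close>)
  qed
  have right: "(\<lambda>\<alpha>\<in>loops G x. u (path_concat \<gamma> \<alpha>)) \<in> integral_span G x"
  proof -
    have "(\<lambda>\<alpha>\<in>loops G x. \<Sum>(a, c)\<leftarrow>map (\<lambda>(a, b). (b, a \<gamma>)) ps. c * a \<alpha>) \<in> integral_span G x"
      using ps(1) by (intro lin) auto
    then show ?thesis
      by (rule integral_span_restrict) (use ps(2) \<gamma> in \<open>simp add: case_prod_unfold o_def\<close>)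
  qed
  show "(\<lambda>\<alpha>\<in>loops G x. u (path_concat \<alpha> \<gamma>)) \<in> homotopy_invariants G x"
  proof (rule homotopy_invariantsI[OF left[OF \<gamma>]])
    fix \<alpha> \<beta> assume \<alpha>\<beta>: "\<alpha> \<in> loops G x" "\<beta> \<in> loops G x" "C_homotopic G \<alpha> \<beta>"
    then have "u (path_concat \<alpha> \<gamma>) = u (path_concat \<beta> \<gamma>)"
      using \<gamma> by (intro homotopy_invariantsD(2)[OF u] path_concat_loops C_homotopic_concat_right[of _ G x])
    with \<alpha>\<beta> show "(\<lambda>\<alpha>\<in>loops G x. u (path_concat \<alpha> \<gamma>)) \<alpha> = (\<lambda>\<alpha>\<in>loops G x. u (path_concat \<alpha> \<gamma>)) \<beta>"
      by simp
  qed
  show "(\<lambda>\<alpha>\<in>loops G x. u (path_concat \<gamma> \<alpha>)) \<in> homotopy_invariants G x"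
  proof (rule homotopy_invariantsI[OF right])
    fix \<alpha> \<beta> assume \<alpha>\<beta>: "\<alpha> \<in> loops G x" "\<beta> \<in> loops G x" "C_homotopic G \<alpha> \<beta>"
    let ?r = "\<lambda>\<alpha>. path_reverse (path_concat (path_reverse \<alpha>) (path_reverse \<gamma>))"
    \<comment> \<open>Both loops have the same edges, and the value of \<open>u\<close> depends on nothing else.\<close>
    have flip: "u (path_concat \<gamma> \<delta>) = u (?r \<delta>)" if "\<delta> \<in> loops G x" for \<delta>
      using that \<gamma> by (intro integral_span_determined[OF u_span])
        (simp_all add: path_concat_loops path_reverse_loops path_edges_concat_loops[of _ G x]
          path_edges_reverse_loops[of _ G x] reverse_edges_append)
    have "C_homotopic G (?r \<alpha>) (?r \<beta>)"
      using \<alpha>\<beta> \<gamma> by (intro C_homotopic_reverse[of _ G x] C_homotopic_concat_right[of _ G x])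
        (simp_all add: path_concat_loops path_reverse_loops)
    then have "u (?r \<alpha>) = u (?r \<beta>)"
      using \<alpha>\<beta> \<gamma> by (intro homotopy_invariantsD(2)[OF u]) (simp_all add: path_concat_loops path_reverse_loops)
    with \<alpha>\<beta> show "(\<lambda>\<alpha>\<in>loops G x. u (path_concat \<gamma> \<alpha>)) \<alpha> = (\<lambda>\<alpha>\<in>loops G x. u (path_concat \<gamma> \<alpha>)) \<beta>"
      by (simp add: flip)
  qed
qed

text \<open>
  Factorization is cross approximation by slices, and closure under pullback along reversal holds
  because homotopies can be reversed. The identities between values are inherited from the algebra
  of all integrals.
\<close>

lemma function_hopf_algebra_pi1:
  assumes x: "x \<in> pverts G"
  shows "function_hopf_algebra (pi1_algebra G x) (loops G x) (homotopy_invariants G x)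
    path_concat path_reverse (constant_loop x)"
proof -
  interpret Q: function_hopf_algebra "integral_algebra G x :: ('b, _) module" "loops G x" "integral_span G x"
      path_concat path_reverse "constant_loop x"
    using x by (rule function_hopf_algebra_integral)
  interpret P: function_subalgebra "pi1_algebra G x :: ('b, _) module" "loops G x" "homotopy_invariants G x"
    by (rule function_subalgebra_pi1)
  show ?thesis
  proof
    fix u :: "'a path_map \<Rightarrow> 'b" assume u: "u \<in> homotopy_invariants G x"
    obtain ps where ps: "\<forall>\<alpha>\<in>loops G x. \<forall>\<beta>\<in>loops G x.
        u (path_concat \<alpha> \<beta>) = (\<Sum>(a, b)\<leftarrow>ps. a \<alpha> * b \<beta>)"
      using Q.factorization[OF homotopy_invariantsD(1)[OF u]] by blast
    show "\<exists>ps. set ps \<subseteq> homotopy_invariants G x \<times> homotopy_invariants G x \<and>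
        (\<forall>\<alpha>\<in>loops G x. \<forall>\<beta>\<in>loops G x. u (path_concat \<alpha> \<beta>) = (\<Sum>(a, b)\<leftarrow>ps. a \<alpha> * b \<beta>))"
      using ps by (intro P.cross_approximation[of "\<lambda>\<alpha> \<beta>. u (path_concat \<alpha> \<beta>)" ps])
        (simp_all add: homotopy_invariants_slice[OF u])
  qed (auto intro: Q.mul_mem Q.inverse_mem Q.unit_mem homotopy_invariants_reverse Q.mul_assoc
      Q.mul_unit_left Q.mul_unit_right Q.mul_inverse_left Q.mul_inverse_right
      dest: homotopy_invariantsD(1))
qed

text \<open>
  The defining property of \<open>integral_comult\<close> determines it on iterated integrals and hence, by
  linearity, on their span; pullback along concatenation has this property.
\<close>

lemma integral_comult_eq:
  assumes "x \<in> pverts G" "u \<in> integral_span G x"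
  shows "integral_comult G x u =
    function_hopf_algebra.comult (integral_algebra G x) (loops G x) path_concat u"
proof -
  let ?Q = "integral_algebra G x :: ('b, _) module"
  interpret Q: function_hopf_algebra ?Q "loops G x" "integral_span G x"
      path_concat path_reverse "constant_loop x"
    using assms(1) by (rule function_hopf_algebra_integral)
  have on_integral: "Q.comult (loop_integral G x ws) = (\<Oplus>\<^bsub>tensor ?Q ?Q\<^esub>i\<in>{..length ws}.
      pure_tensor ?Q ?Q (loop_integral G x (take i ws)) (loop_integral G x (drop i ws)))" for ws
  proof (rule Q.comult_unique)
    have closed: "pure_tensor ?Q ?Q (loop_integral G x (take i ws)) (loop_integral G x (drop i ws))
        \<in> carrier (tensor ?Q ?Q)" for i
      by (intro Q.pure_tensor_closed) (simp_all add: Q.carrier_A integral_span.integral)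
    then show "(\<Oplus>\<^bsub>tensor ?Q ?Q\<^esub>i\<in>{..length ws}. pure_tensor ?Q ?Q (loop_integral G x (take i ws))
        (loop_integral G x (drop i ws))) \<in> carrier (tensor ?Q ?Q)"
      by (intro Q.tensor.finsum_closed) auto
    fix \<alpha> \<beta> assume \<alpha>\<beta>: "\<alpha> \<in> loops G x" "\<beta> \<in> loops G x"
    have "tensor_coord (\<lambda>p u. u p) (\<lambda>p u. u p) (\<alpha>, \<beta>) (\<Oplus>\<^bsub>tensor ?Q ?Q\<^esub>i\<in>{..length ws}.
        pure_tensor ?Q ?Q (loop_integral G x (take i ws)) (loop_integral G x (drop i ws)))
        = (\<Sum>i\<le>length ws. loop_integral G x (take i ws) \<alpha> * loop_integral G x (drop i ws) \<beta>)"
      using \<alpha>\<beta> by (subst Q.tensor.coord_finsum[OF closed]) (simp_all add: Q.tensor_coord_pure)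
    with \<alpha>\<beta> show "tensor_coord (\<lambda>p u. u p) (\<lambda>p u. u p) (\<alpha>, \<beta>) (\<Oplus>\<^bsub>tensor ?Q ?Q\<^esub>i\<in>{..length ws}.
        pure_tensor ?Q ?Q (loop_integral G x (take i ws)) (loop_integral G x (drop i ws)))
        = loop_integral G x ws (path_concat \<alpha> \<beta>)"
      by (simp add: loop_integral_def path_concat_loops iterated_integral_eq_transport
          path_edges_concat_loops transport_append convolve_def)
  qed
  have "integral_comult G x = restrict Q.comult (carrier ?Q)"
    unfolding integral_comult_def Let_def
  proof (rule the_equality)
    show "restrict Q.comult (carrier ?Q) \<in> extensional (carrier ?Q) \<and>
        restrict Q.comult (carrier ?Q) \<in> linear_maps ?Q (tensor ?Q ?Q) \<and>
        (\<forall>ws. restrict Q.comult (carrier ?Q) (loop_integral G x ws) =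
          (\<Oplus>\<^bsub>tensor ?Q ?Q\<^esub>i\<in>{..length ws}.
             pure_tensor ?Q ?Q (loop_integral G x (take i ws)) (loop_integral G x (drop i ws))))"
      using Q.comult_linear Q.M.add_closed Q.M.smult_closed on_integral
      by (auto simp: linear_maps_def Q.carrier_A integral_span.integral)
    fix D assume D: "D \<in> extensional (carrier ?Q) \<and> D \<in> linear_maps ?Q (tensor ?Q ?Q) \<and>
        (\<forall>ws. D (loop_integral G x ws) = (\<Oplus>\<^bsub>tensor ?Q ?Q\<^esub>i\<in>{..length ws}.
             pure_tensor ?Q ?Q (loop_integral G x (take i ws)) (loop_integral G x (drop i ws))))"
    show "D = restrict Q.comult (carrier ?Q)"
    proof (rule extensionalityI[of _ "carrier ?Q"])
      fix u assume "u \<in> carrier ?Q"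
      then show "D u = restrict Q.comult (carrier ?Q) u"
        using D Q.comult_linear on_integral
        by (simp add: Q.carrier_A integral_span_linear_eq[of D G x "tensor ?Q ?Q" Q.comult])
    qed (use D in auto)
  qed
  with assms(2) show ?thesis by (simp add: Q.carrier_A)
qed

text \<open>
  As for the comultiplication, reversal of paths provides the linear map whose values on iterated
  integrals are prescribed.
\<close>

lemma integral_antipode_eq:
  assumes "u \<in> integral_span G x"
  shows "integral_antipode G x u = (\<lambda>\<alpha>\<in>loops G x. u (path_reverse \<alpha>))"
proof -
  let ?Q = "integral_algebra G x :: ('b, _) module"
  interpret Q: function_subalgebra ?Q "loops G x" "integral_span G x"
    by (rule function_subalgebra_integral)
  define S where "S u = (\<lambda>\<alpha>\<in>loops G x. u (path_reverse \<alpha>))" for u :: "_ \<Rightarrow> 'b"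
  have S_linear: "S \<in> linear_maps ?Q ?Q"
    by (auto simp: linear_maps_def S_def Q.A_simps integral_span_reverse path_reverse_loops)
  have on_integral: "S (loop_integral G x ws) = (- 1) ^ length ws \<odot>\<^bsub>?Q\<^esub> loop_integral G x (rev ws)" for ws
    by (auto simp: S_def Q.A_simps loop_integral_def path_reverse_loops iterated_integral_eq_transport
        path_edges_reverse_loops transport_reverse_edges)
  have "integral_antipode G x = restrict S (carrier ?Q)"
    unfolding integral_antipode_def Let_def
  proof (rule the_equality)
    show "restrict S (carrier ?Q) \<in> extensional (carrier ?Q) \<and>
        restrict S (carrier ?Q) \<in> linear_maps ?Q ?Q \<and>
        (\<forall>ws. restrict S (carrier ?Q) (loop_integral G x ws) =
          (- 1) ^ length ws \<odot>\<^bsub>?Q\<^esub> loop_integral G x (rev ws))"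
      using S_linear Q.M.add_closed Q.M.smult_closed on_integral
      by (auto simp: linear_maps_def Q.carrier_A integral_span.integral)
    fix D assume D: "D \<in> extensional (carrier ?Q) \<and> D \<in> linear_maps ?Q ?Q \<and>
        (\<forall>ws. D (loop_integral G x ws) = (- 1) ^ length ws \<odot>\<^bsub>?Q\<^esub> loop_integral G x (rev ws))"
    show "D = restrict S (carrier ?Q)"
    proof (rule extensionalityI[of _ "carrier ?Q"])
      fix u assume "u \<in> carrier ?Q"
      then show "D u = restrict S (carrier ?Q) u"
        using D S_linear on_integral
        by (simp add: Q.carrier_A integral_span_linear_eq[of D G x ?Q S])
    qed (use D in auto)
  qed
  with assms show ?thesis by (simp add: Q.carrier_A S_def)
qed

theorem theorem5p8:
  fixes G :: "'v pair_pre_digraph" and x :: 'v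
    and Q P :: "('k::field_char_0, 'v path_map \<Rightarrow> 'k) module"
  assumes G: "pair_digraph G" "connected_digraph G"
    and x: "x \<in> pverts G"
  defines "Q \<equiv> integral_algebra G x"
    and "P \<equiv> pi1_algebra G x"
  shows "(\<exists>\<Delta>. hopf_algebra P (integral_unit G x) \<Delta> (integral_counit x) (integral_antipode G x) \<and>
           (\<forall>u\<in>carrier P. tensor_map Q Q (\<lambda>a. a) (\<lambda>a. a) (\<Delta> u) = integral_comult G x u)) \<and>
         (\<forall>u\<in>carrier P. \<forall>v\<in>carrier P. u \<otimes>\<^bsub>P\<^esub> v = u \<otimes>\<^bsub>Q\<^esub> v) \<and>
         (\<forall>ws vs. loop_integral G x ws \<otimes>\<^bsub>Q\<^esub> loop_integral G x vs =
            (\<Oplus>\<^bsub>Q\<^esub>\<sigma>\<in>shuffle_permutations (length ws) (length vs).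
               loop_integral G x (permute_word \<sigma> (ws @ vs))))"
proof (intro conjI allI ballI)
  interpret Q: function_hopf_algebra Q "loops G x" "integral_span G x"
      path_concat path_reverse "constant_loop x"
    unfolding Q_def using x by (rule function_hopf_algebra_integral)
  interpret P: function_hopf_algebra P "loops G x" "homotopy_invariants G x"
      path_concat path_reverse "constant_loop x"
    unfolding P_def using x by (rule function_hopf_algebra_pi1)
  have subset: "homotopy_invariants G x \<subseteq> (integral_span G x :: ('v path_map \<Rightarrow> 'k) set)"
    by (auto dest: homotopy_invariantsD(1))
  have inclusion: "(\<lambda>a. a) \<in> linear_maps P Q"
    using subset by (auto simp: linear_maps_def P.A_simps Q.A_simps)
  have "integral_unit G x = (\<lambda>c :: 'k. \<lambda>\<alpha>\<in>loops G x. c)"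
    "integral_counit x = (\<lambda>u :: _ \<Rightarrow> 'k. u (constant_loop x))"
    by (auto simp: integral_unit_def integral_counit_def)
  moreover have "hopf_algebra P (\<lambda>c. \<lambda>\<alpha>\<in>loops G x. c) P.comult (\<lambda>u. u (constant_loop x)) (integral_antipode G x)"
    using subset by (intro P.hopf_algebra_comult integral_antipode_eq) blast
  ultimately have "hopf_algebra P (integral_unit G x) P.comult (integral_counit x) (integral_antipode G x)"
    by simp
  moreover have "tensor_map Q Q (\<lambda>a. a) (\<lambda>a. a) (P.comult u) = integral_comult G x u"
    if "u \<in> carrier P" for u
  proof -
    have u: "u \<in> homotopy_invariants G x" "u \<in> integral_span G x"
      using that subset by (auto simp: P.carrier_A)
    obtain ps where ps: "set ps \<subseteq> carrier P \<times> carrier P" "P.comult u = tensor_of P P ps"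
      "\<And>\<alpha> \<beta>. \<lbrakk>\<alpha> \<in> loops G x; \<beta> \<in> loops G x\<rbrakk> \<Longrightarrow> (\<Sum>(a, b)\<leftarrow>ps. a \<alpha> * b \<beta>) = u (path_concat \<alpha> \<beta>)"
      using P.comultE[OF u(1)] unfolding P.carrier_A by blast
    note map = P.tensor_map_tensor_of[OF Q.tensor_coordinates_axioms inclusion inclusion ps(1), folded ps(2)]
    have "Q.comult u = tensor_map Q Q (\<lambda>a. a) (\<lambda>a. a) (P.comult u)"
      using map ps(3) by (intro Q.comult_unique) auto
    then show ?thesis using integral_comult_eq[OF x u(2)] by (simp add: Q_def)
  qed
  ultimately show "\<exists>\<Delta>. hopf_algebra P (integral_unit G x) \<Delta> (integral_counit x) (integral_antipode G x) \<and>
      (\<forall>u\<in>carrier P. tensor_map Q Q (\<lambda>a. a) (\<lambda>a. a) (\<Delta> u) = integral_comult G x u)"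
    by blast
  show "u \<otimes>\<^bsub>P\<^esub> v = u \<otimes>\<^bsub>Q\<^esub> v" for u v by (simp add: P.A_simps Q.A_simps)
  fix ws vs :: "('v, 'k) one_form list"
  have closed: "loop_integral G x w \<in> carrier Q" for w :: "('v, 'k) one_form list"
    by (simp add: Q.carrier_A integral_span.integral)
  show "loop_integral G x ws \<otimes>\<^bsub>Q\<^esub> loop_integral G x vs =
      (\<Oplus>\<^bsub>Q\<^esub>\<sigma>\<in>shuffle_permutations (length ws) (length vs).
         loop_integral G x (permute_word \<sigma> (ws @ vs)))"
  proof (rule Q.M.coord_eqI)
    show "loop_integral G x ws \<otimes>\<^bsub>Q\<^esub> loop_integral G x vs \<in> carrier Q"
      using closed by (simp add: Q.carrier_A Q.op_closed)
    show "(\<Oplus>\<^bsub>Q\<^esub>\<sigma>\<in>shuffle_permutations (length ws) (length vs).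
         loop_integral G x (permute_word \<sigma> (ws @ vs))) \<in> carrier Q"
      by (intro Q.M.finsum_closed) (auto simp: closed)
    fix \<alpha> assume \<alpha>: "\<alpha> \<in> loops G x"
    then have "(\<Oplus>\<^bsub>Q\<^esub>\<sigma>\<in>shuffle_permutations (length ws) (length vs).
          loop_integral G x (permute_word \<sigma> (ws @ vs))) \<alpha> =
        (\<Sum>\<sigma>\<in>shuffle_permutations (length ws) (length vs).
          loop_integral G x (permute_word \<sigma> (ws @ vs)) \<alpha>)"
      by (intro Q.M.coord_finsum closed)
    with \<alpha> show "(loop_integral G x ws \<otimes>\<^bsub>Q\<^esub> loop_integral G x vs) \<alpha> =
        (\<Oplus>\<^bsub>Q\<^esub>\<sigma>\<in>shuffle_permutations (length ws) (length vs).
           loop_integral G x (permute_word \<sigma> (ws @ vs))) \<alpha>"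
      by (simp add: Q.op_eval loop_integral_def iterated_integral_shuffle sum_shuffle_permutations)
  qed
qed

end
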